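(* Let $\mathcal G_1$ be a finite simple graph all of whose vertices have degree at least $2$, let $\mathcal G_\infty$ be the associated continuous graph with edges of length $1$, and for a positive integer $N$ let $\mathcal G_N$ be the $N$-fold refinement of $\mathcal G_1$, with vertex space $\mathbb H_N$ and discrete Fourier transform $\mathcal F_N$. If $N$ is a power of $2$, then the inverse discrete Fourier transform can be computed in time $O(N\log_2 N)$.
   Context: Continuous graph. $\mathcal G_1$ has $N_{\mathcal E}$ edges. Each edge $e$ is identified with $[0,1]$, endpoints being identified with the end vertices of $e$; the result is the continuous graph $\mathcal G_\infty$. $L^2(\mathcal G_\infty)=\bigoplus_e L^2[0,1]$ carries the inner product $\langle f,g\rangle_\infty=\frac1{N_{\mathcal E}}\sum_e\int_0^1 f_e\overline{g_e}\,dx$. The operator $\Delta_\infty f=-f''$ has as domain all $f\in L^2(\mathcal G_\infty)$ with $f_e'$ absolutely continuous on each edge, $f''\in L^2(\mathcal G_\infty)$, $f$ continuous at each vertex, and $\sum_{e\sim v}\partial_\nu f_e(v)=0$ at each vertex $v$ (sum over incident edges), where $\partial_\nu f_e(v)=f_e'(0)$ if $v$ is the endpoint $0$ of $e$ and $-f_e'(1)$ if $v$ is the endpoint $1$. It is self adjoint and nonnegative with compact resolvent; $E(\lambda)$ is its $\lambda$ eigenspace. Refinement. $\mathcal G_N$ is the discrete graph obtained by subdividing each edge $e\cong[0,1]$ of $\mathcal G_1$ into $N$ edges with the points $x_n=n/N$, $0\le n\le N$; its vertices are those of $\mathcal G_1$ and the points $x_1,\dots,x_{N-1}$ on each edge,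 $x_n$ being adjacent to $x_{n\pm1}$ along the edge. $\mathbb H_N$ is the space of functions from the vertices of $\mathcal G_N$ to $\mathbb C$, with inner product $\langle f,g\rangle_N=\frac1{2NN_{\mathcal E}}\sum_v \deg(v)f(v)\overline{g(v)}$ (degrees in $\mathcal G_N$). $R_N$ denotes restriction of functions on $\mathcal G_\infty$ to the vertices of $\mathcal G_N$. Bases. Let $0<\omega_{0,1}<\omega_{0,2}<\dots\le 2\pi$ be the square roots of the $K$ distinct eigenvalues of $\Delta_\infty$ in $(0,(2\pi)^2]$. For each $k$ pick an orthonormal basis $\Psi_j(\omega_{0,k})$, $j=1,\dots,I_k=\dim E(\omega_{0,k}^2)$, of $E(\omega_{0,k}^2)$. On each edge $\Psi_j(\omega_{0,k})=A_e e^{i\omega_{0,k}x}+B_e e^{-i\omega_{0,k}x}$ (coefficients depending on $j,k$). For $m\ge1$ let $\omega_{m,k}=\omega_{0,k}+2m\pi$ and let $\Psi_j(\omega_{m,k})$ be the function equal on each edge to $A_e e^{i\omega_{m,k}x}+B_e e^{-i\omega_{m,k}x}$, with the same $A_e,B_e$; these form a basis of $E(\omega_{m,k}^2)$. Let $\Phi(\omega_{m,k})$ be the family $\Phi_j(\omega_{m,k})=R_N\Psi_j(\omega_{m,k})$, $j=1,\dots,I_k$, regarded as a basis of an eigenspace of the refined graph's discrete Laplacian $N^2(I-T^{-1}A)$ on $\mathbb H_N$, where $Af(v)=\sum_{u\text{ adjacent to }v}f(u)$ and $Tf(v)=\deg(v)f(v)$. Let $I_0=\dim E(0)$. Discrete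 Fourier transform. $\mathcal F_N:\mathbb H_N\to\mathbb C^{I_0}\oplus\bigoplus_{m,k}\mathbb C^{I_k}$, $\mathcal F_N(f)=\{\langle f,\Phi_j(\omega_{m,k})\rangle_N\}$, $\omega_{m,k}\le N\pi$ (for even $N$ this means $m=0,\dots,N/2-1$); the summand $\mathbb C^{I_0}$ holds the inner products of $f$ with the restrictions of an orthonormal basis of $E(0)$. Inverse transform. This is the recovery of the values of $f\in\mathbb H_N$ at the vertices of $\mathcal G_N$ from the given sequence $\mathcal F_N(f)$. Let $B=B(\omega_{m,k})=(b_{ij})$ be a matrix taking the basis $\Phi(\omega_{m,k})$ to an orthonormal basis $\eta_i=\sum_j b_{ij}\Phi_j(\omega_{m,k})$ for the same eigenspace in $\mathbb H_N$. The matrices $B^*B$ depend only on the graph and the functions $\Phi_j(\omega_{m,k})$, and are assumed to be precomputed. In the time bound the graph $\mathcal G_1$ and the bases $\Psi(\omega_{0,k})$ are fixed, so the number of edges and of indices $k$ is constant and the range of $j$ is bounded independently of $m$. *)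

theory Defs
  imports "HOL-Analysis.Analysis" "HOL-Library.Landau_Symbols"
begin

section \<open>The continuous graph\<close>

text \<open>
  The identification of an edge with the unit interval is the choice, for every edge, of
  the end vertex that becomes the endpoint 0 (tail) and of the one that becomes the
  endpoint 1 (head).
\<close>

record 'v fgraph =
  verts :: "'v set"
  edges :: "'v set set"
  tail :: "'v set \<Rightarrow> 'v"
  head :: "'v set \<Rightarrow> 'v"

definition finite_simple_graph :: "'v fgraph \<Rightarrow> bool" where
  "finite_simple_graph G \<longleftrightarrow>
     finite (verts G) \<and>
     (\<forall>e\<in>edges G. e \<subseteq> verts G \<and> tail G e \<noteq> head G e \<and> e = {tail G e, head G e})"

definition vdegree :: "'v fgraph \<Rightarrow> 'v \<Rightarrow> nat" where
  "vdegree G v = card {e \<in> edges G. v \<in> e}"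

datatype 'v point = Vertex 'v | Inner "'v set" real

definition coord :: "'v fgraph \<Rightarrow> 'v set \<Rightarrow> real \<Rightarrow> 'v point" where
  "coord G e x =
     (if x = 0 then Vertex (tail G e) else if x = 1 then Vertex (head G e) else Inner e x)"

definition points :: "'v fgraph \<Rightarrow> 'v point set" where
  "points G = Vertex ` verts G \<union> {Inner e x | e x. e \<in> edges G \<and> 0 < x \<and> x < 1}"

text \<open>
  The component on the edge e of a function f on the continuous graph is
  f (coord G e x), for x in [0,1].
\<close>

abbreviation edge_fun :: "'v fgraph \<Rightarrow> ('v point \<Rightarrow> complex) \<Rightarrow> 'v set \<Rightarrow> real \<Rightarrow> complex" where
  "edge_fun G f e \<equiv> \<lambda>x. f (coord G e x)"

definition L2_graph :: "'v fgraph \<Rightarrow> ('v point \<Rightarrow> complex) \<Rightarrow> bool" where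
  "L2_graph G f \<longleftrightarrow>
     (\<forall>e\<in>edges G. set_borel_measurable lebesgue {0..1} (edge_fun G f e) \<and>
                  set_integrable lebesgue {0..1} (\<lambda>x. (cmod (edge_fun G f e x))\<^sup>2))"

definition inner_inf :: "'v fgraph \<Rightarrow> ('v point \<Rightarrow> complex) \<Rightarrow> ('v point \<Rightarrow> complex) \<Rightarrow> complex" where
  "inner_inf G f g =
     1 / of_nat (card (edges G)) *
     (\<Sum>e\<in>edges G. LINT x:{0..1}|lebesgue. edge_fun G f e x * cnj (edge_fun G g e x))"

definition abs_continuous_on :: "real set \<Rightarrow> (real \<Rightarrow> complex) \<Rightarrow> bool" where
  "abs_continuous_on S f \<longleftrightarrow>
     (\<forall>\<epsilon>>0. \<exists>\<delta>>0. \<forall>D T. D division_of T \<longrightarrow> T \<subseteq> S \<longrightarrow> (\<Sum>J\<in>D. Sup J - Inf J) < \<delta> \<longrightarrow>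
        (\<Sum>J\<in>D. norm (f (Sup J) - f (Inf J))) < \<epsilon>)"

text \<open>
  The relation below says that f is in the domain of the Laplacian and that g represents
  its image, so g matters only up to null sets.  The elements of the domain are represented
  by continuous functions.  Since the components of f on the edges at v all take the value
  f (Vertex v) there, continuity at v is continuity of these components at the endpoint
  corresponding to v.
\<close>

definition is_laplacian :: "'v fgraph \<Rightarrow> ('v point \<Rightarrow> complex) \<Rightarrow> ('v point \<Rightarrow> complex) \<Rightarrow> bool" where
  "is_laplacian G f g \<longleftrightarrow>
     L2_graph G f \<and> L2_graph G g \<and>
     (\<forall>e\<in>edges G. continuous_on {0..1} (edge_fun G f e)) \<and>
     (\<exists>f'.
       (\<forall>e\<in>edges G.
          (\<forall>x\<in>{0..1}. (edge_fun G f e has_vector_derivative f' e x) (at x within {0..1})) \<and>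
          abs_continuous_on {0..1} (f' e) \<and>
          (AE x in lebesgue. x \<in> {0..1} \<longrightarrow>
             (f' e has_vector_derivative - edge_fun G g e x) (at x within {0..1}))) \<and>
       (\<forall>v\<in>verts G.
          (\<Sum>e | e \<in> edges G \<and> v \<in> e. if v = tail G e then f' e 0 else - f' e 1) = 0))"

definition eigenspace :: "'v fgraph \<Rightarrow> real \<Rightarrow> ('v point \<Rightarrow> complex) set" where
  "eigenspace G \<kappa> = {f. is_laplacian G f (\<lambda>p. of_real \<kappa> * f p)}"

definition is_eigenvalue :: "'v fgraph \<Rightarrow> real \<Rightarrow> bool" where
  "is_eigenvalue G \<kappa> \<longleftrightarrow> (\<exists>f\<in>eigenspace G \<kappa>. \<exists>p\<in>points G. f p \<noteq> 0)"

text \<open>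
  Finite orthonormal bases of a space S of functions on X, for an inner product that
  depends only on the values on X.  Functions with the same values on X are identified.
\<close>

definition orthonormal_basis ::
  "'p set \<Rightarrow> (('p \<Rightarrow> complex) \<Rightarrow> ('p \<Rightarrow> complex) \<Rightarrow> complex) \<Rightarrow> ('p \<Rightarrow> complex) set \<Rightarrow>
   nat \<Rightarrow> (nat \<Rightarrow> 'p \<Rightarrow> complex) \<Rightarrow> bool" where
  "orthonormal_basis X ip S d b \<longleftrightarrow>
     (\<forall>j<d. b j \<in> S) \<and>
     (\<forall>i<d. \<forall>j<d. ip (b i) (b j) = (if i = j then 1 else 0)) \<and>
     (\<forall>f\<in>S. \<exists>c. \<forall>p\<in>X. f p = (\<Sum>j<d. c j * b j p))"

section \<open>The refined graphs\<close>

definition ref_verts :: "'v fgraph \<Rightarrow> nat \<Rightarrow> 'v point set" where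
  "ref_verts G N =
     Vertex ` verts G \<union>
     {Inner e (real n / real N) | e n. e \<in> edges G \<and> 0 < n \<and> n < N}"

definition ref_adj :: "'v fgraph \<Rightarrow> nat \<Rightarrow> 'v point \<Rightarrow> 'v point \<Rightarrow> bool" where
  "ref_adj G N p q \<longleftrightarrow>
     (\<exists>e\<in>edges G. \<exists>n<N.
        {p, q} = {coord G e (real n / real N), coord G e (real (Suc n) / real N)})"

definition ref_degree :: "'v fgraph \<Rightarrow> nat \<Rightarrow> 'v point \<Rightarrow> nat" where
  "ref_degree G N p = card {q. ref_adj G N p q}"

text \<open>
  A function on the vertices of the refined graph is represented by its extension by 0.
\<close>

definition HN :: "'v fgraph \<Rightarrow> nat \<Rightarrow> ('v point \<Rightarrow> complex) set" where
  "HN G N = {f. \<forall>p. p \<notin> ref_verts G N \<longrightarrow> f p = 0}"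

definition RN :: "'v fgraph \<Rightarrow> nat \<Rightarrow> ('v point \<Rightarrow> complex) \<Rightarrow> 'v point \<Rightarrow> complex" where
  "RN G N f = (\<lambda>p. if p \<in> ref_verts G N then f p else 0)"

definition inner_N ::
  "'v fgraph \<Rightarrow> nat \<Rightarrow> ('v point \<Rightarrow> complex) \<Rightarrow> ('v point \<Rightarrow> complex) \<Rightarrow> complex" where
  "inner_N G N f g =
     1 / (2 * of_nat N * of_nat (card (edges G))) *
     (\<Sum>p\<in>ref_verts G N. of_nat (ref_degree G N p) * f p * cnj (g p))"

definition laplacian_N :: "'v fgraph \<Rightarrow> nat \<Rightarrow> ('v point \<Rightarrow> complex) \<Rightarrow> 'v point \<Rightarrow> complex" where
  "laplacian_N G N f p =
     (of_nat N)\<^sup>2 * (f p - (\<Sum>q | ref_adj G N p q. f q) / of_nat (ref_degree G N p))"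

definition eigenspace_N :: "'v fgraph \<Rightarrow> nat \<Rightarrow> complex \<Rightarrow> ('v point \<Rightarrow> complex) set" where
  "eigenspace_N G N \<mu> =
     {f \<in> HN G N. \<forall>p\<in>ref_verts G N. laplacian_N G N f p = \<mu> * f p}"

section \<open>The discrete Fourier transform\<close>

text \<open>
  Frequencies omega_{m,k}; the index k of the K base frequencies runs through 0, ..., K - 1.
\<close>

definition freq :: "(nat \<Rightarrow> real) \<Rightarrow> nat \<Rightarrow> nat \<Rightarrow> real" where
  "freq \<omega> m k = \<omega> k + 2 * real m * pi"

text \<open>
  Index set of the coefficients: \<open>Zero j\<close> belongs to the eigenvalue 0, \<open>Mode m k j\<close> to the
  frequency omega_{m,k}.
\<close>

datatype dft_index = Zero nat | Mode nat nat nat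

definition dft_indices ::
  "nat \<Rightarrow> nat \<Rightarrow> (nat \<Rightarrow> nat) \<Rightarrow> (nat \<Rightarrow> real) \<Rightarrow> nat \<Rightarrow> dft_index set" where
  "dft_indices I0 K I \<omega> N =
     {Zero j | j. j < I0} \<union>
     {Mode m k j | m k j. k < K \<and> j < I k \<and> freq \<omega> m k \<le> real N * pi}"

definition DFT ::
  "'v fgraph \<Rightarrow> nat \<Rightarrow> (nat \<Rightarrow> 'v point \<Rightarrow> complex) \<Rightarrow> (nat \<Rightarrow> nat \<Rightarrow> nat \<Rightarrow> 'v point \<Rightarrow> complex) \<Rightarrow>
   ('v point \<Rightarrow> complex) \<Rightarrow> dft_index \<Rightarrow> complex" where
  "DFT G N \<Psi>0 \<Psi> f idx =
     (case idx of
        Zero j \<Rightarrow> inner_N G N f (RN G N (\<Psi>0 j))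
      | Mode m k j \<Rightarrow> inner_N G N f (RN G N (\<Psi> m k j)))"

text \<open>
  The d x I matrix b takes the family phi_j (j < I) in an eigenspace of the discrete
  Laplacian to an orthonormal basis of the same eigenspace.  If the phi_j form a basis, then
  d = I.  The number of rows is kept separate because for the largest frequency,
  omega = N pi, the restrictions of a basis of E(omega^2) span the eigenspace but are in
  general linearly dependent (sin (N pi x) vanishes at all x_n).
\<close>

definition orthonormalizes ::
  "'v fgraph \<Rightarrow> nat \<Rightarrow> nat \<Rightarrow> (nat \<Rightarrow> 'v point \<Rightarrow> complex) \<Rightarrow> nat \<Rightarrow> (nat \<Rightarrow> nat \<Rightarrow> complex) \<Rightarrow> bool" where
  "orthonormalizes G N I \<phi> d b \<longleftrightarrow>
     (\<exists>\<mu>. (\<forall>j<I. \<phi> j \<in> eigenspace_N G N \<mu>) \<and>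
          orthonormal_basis (ref_verts G N) (inner_N G N) (eigenspace_N G N \<mu>) d
            (\<lambda>i p. \<Sum>j<I. b i j * \<phi> j p))"

definition adjoint_mult :: "nat \<Rightarrow> (nat \<Rightarrow> nat \<Rightarrow> complex) \<Rightarrow> nat \<Rightarrow> nat \<Rightarrow> complex" where
  "adjoint_mult d b j l = (\<Sum>i<d. cnj (b i j) * b i l)"

section \<open>The model of computation\<close>

text \<open>
  A uniform-cost random access machine over the complex numbers.  It has registers holding
  natural numbers and finitely many named arrays of complex numbers, whose cells are addressed
  by the contents of registers.  An operand (a, r) is the cell of the array a whose index is
  the content of the register r.  Each instruction and each test takes one unit of time.
  Names and constants occurring in a program are fixed, in particular independent of the
  input.  Only loops with a precomputed number of iterations are available, so every program
  terminates; a machine with arbitrary jumps simulates these programs in proportional time.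
  There is no conversion from complex numbers to natural numbers and no test on complex
  numbers.
\<close>

datatype 'a com =
    RConst nat nat
  | RAdd nat nat nat
  | RSub nat nat nat
  | CConst "'a \<times> nat" complex
  | CCopy "'a \<times> nat" "'a \<times> nat"
  | CAdd "'a \<times> nat" "'a \<times> nat" "'a \<times> nat"
  | CSub "'a \<times> nat" "'a \<times> nat" "'a \<times> nat"
  | CMul "'a \<times> nat" "'a \<times> nat" "'a \<times> nat"
  | CExp "'a \<times> nat" "'a \<times> nat"
  | Seq "'a com" "'a com"
  | IfLess nat nat "'a com" "'a com"
  | Loop nat "'a com"

record 'a state =
  reg :: "nat \<Rightarrow> nat"
  arr :: "'a \<Rightarrow> nat \<Rightarrow> complex"

definition set_reg :: "nat \<Rightarrow> nat \<Rightarrow> 'a state \<Rightarrow> 'a state" where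
  "set_reg r n s = s\<lparr>reg := (reg s)(r := n)\<rparr>"

definition get_cell :: "'a state \<Rightarrow> 'a \<times> nat \<Rightarrow> complex" where
  "get_cell s x = arr s (fst x) (reg s (snd x))"

definition set_cell :: "'a \<times> nat \<Rightarrow> complex \<Rightarrow> 'a state \<Rightarrow> 'a state" where
  "set_cell x z s =
     s\<lparr>arr := (arr s)(fst x := (arr s (fst x))(reg s (snd x) := z))\<rparr>"

text \<open>
  Running a command yields the elapsed time and the final state.  The number of iterations
  of a loop is the content of its register when the loop is entered.
\<close>

primrec exec :: "'a com \<Rightarrow> 'a state \<Rightarrow> nat \<times> 'a state" where
  "exec (RConst r n) s = (1, set_reg r n s)"
| "exec (RAdd r p q) s = (1, set_reg r (reg s p + reg s q) s)"
| "exec (RSub r p q) s = (1, set_reg r (reg s p - reg s q) s)"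
| "exec (CConst x z) s = (1, set_cell x z s)"
| "exec (CCopy x y) s = (1, set_cell x (get_cell s y) s)"
| "exec (CAdd x y z) s = (1, set_cell x (get_cell s y + get_cell s z) s)"
| "exec (CSub x y z) s = (1, set_cell x (get_cell s y - get_cell s z) s)"
| "exec (CMul x y z) s = (1, set_cell x (get_cell s y * get_cell s z) s)"
| "exec (CExp x y) s = (1, set_cell x (exp (get_cell s y)) s)"
| "exec (Seq c1 c2) s =
     (let (t1, s1) = exec c1 s; (t2, s2) = exec c2 s1 in (t1 + t2, s2))"
| "exec (IfLess p q c1 c2) s =
     (let (t, s') = (if reg s p < reg s q then exec c1 s else exec c2 s) in (t + 1, s'))"
| "exec (Loop r c) s =
     ((\<lambda>(t, s1). let (t', s2) = exec c s1 in (t + 1 + t', s2)) ^^ reg s r) (1, s)"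

text \<open>
  Arrays of the inverse transform.  Input: \<open>Coeff0 j\<close> (cell 0 only) and \<open>Coeff k j\<close>, indexed
  by m, hold the transform, \<open>BstarB k j l\<close>, indexed by m, the precomputed entries (j, l) of the
  matrices B^* B.  Output: \<open>Value e\<close>, indexed by n = 0, ..., N, for the values at the points
  x_n of the edge e.  The arrays \<open>Work i\<close> are auxiliary.
\<close>

datatype 'v array_name =
    Coeff0 nat
  | Coeff nat nat
  | BstarB nat nat nat
  | Value "'v set"
  | Work nat

text \<open>
  Initial states: N is in register 0; registers and cells that hold no input are arbitrary.
\<close>

definition input_state ::
  "nat \<Rightarrow> nat \<Rightarrow> (nat \<Rightarrow> nat) \<Rightarrow> (nat \<Rightarrow> real) \<Rightarrow> nat \<Rightarrow> (dft_index \<Rightarrow> complex) \<Rightarrow>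
   (nat \<Rightarrow> nat \<Rightarrow> nat \<Rightarrow> nat \<Rightarrow> complex) \<Rightarrow> 'v array_name state \<Rightarrow> bool" where
  "input_state I0 K I \<omega> N F M s \<longleftrightarrow>
     reg s 0 = N \<and>
     (\<forall>j. Zero j \<in> dft_indices I0 K I \<omega> N \<longrightarrow> arr s (Coeff0 j) 0 = F (Zero j)) \<and>
     (\<forall>m k j. Mode m k j \<in> dft_indices I0 K I \<omega> N \<longrightarrow> arr s (Coeff k j) m = F (Mode m k j)) \<and>
     (\<forall>m k j l. Mode m k j \<in> dft_indices I0 K I \<omega> N \<longrightarrow> l < I k \<longrightarrow>
        arr s (BstarB k j l) m = M m k j l)"

definition output_state ::
  "'v fgraph \<Rightarrow> nat \<Rightarrow> ('v point \<Rightarrow> complex) \<Rightarrow> 'v array_name state \<Rightarrow> bool" where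
  "output_state G N f s \<longleftrightarrow>
     (\<forall>e\<in>edges G. \<forall>n\<le>N. arr s (Value e) n = f (coord G e (real n / real N)))"

end

theory Submission
  imports Defs "HOL-Computational_Algebra.Fundamental_Theorem_Algebra"
begin

text \<open>
  The discrete Laplacian is self adjoint, and along an edge each of its eigenfunctions for an
  eigenvalue \<open>N\<^sup>2 (1 - cos (\<omega> / N))\<close>, \<open>0 < \<omega> \<le> N \<pi>\<close>, is a combination of the waves
  \<open>exp (\<plusminus> i \<omega> x)\<close>.  Lowering \<open>\<omega>\<close> by a multiple of \<open>2 \<pi>\<close> into \<open>(0, 2 \<pi>]\<close> changes neither the
  values at the vertices nor the Kirchhoff conditions, so every discrete eigenfunction is the
  restriction of a combination of the \<open>\<Psi>\<close>.  Hence \<open>f\<close> is the sum of its projections, and the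
  projection onto one eigenspace is \<open>\<Sum>\<^sub>l (\<Sum>\<^sub>j (B\<^sup>* B)\<^sub>j\<^sub>l F\<^sub>j) \<Phi>\<^sub>l\<close>.  For fixed \<open>k\<close>, \<open>l\<close>, edge and
  sign, the sum over \<open>m\<close> at the points \<open>n / N\<close> is the phase \<open>exp (\<plusminus> i \<omega>\<^sub>k n / N)\<close> times a discrete
  Fourier transform of length \<open>N\<close>, which the fast Fourier transform computes.
\<close>

section \<open>The refined graphs\<close>

text \<open>In E(0) the equation holds only almost everywhere, and the shape of its functions must
  be derived from it. For positive eigenvalues \<open>exps\<close> supplies the shape in one
  direction, and the other direction constructs waves explicitly. With l the normalized adjacency
  eigenvalue, 1 - l and 1 + l are quotients of sums of squares; hence l is a cosine. The end l = -1,
  that is omega = N pi, is delicate: there the two waves agree at all grid points, so restrictions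
  of independent functions may become dependent. For this reason the restrictions are only ever used
  as a spanning family, and orthonormality comes from the matrices B alone. The modes fill at most
  about half of a transform of length N; the rest is padded with zeros. The machine offers neither
  division nor logarithms. N / 2, the exponent p and 1 / N are found by counting, doubling and
  halving in loops of N rounds, and roots of unity come from the exponential of an argument halved
  at each stage. The number of quadruples (edge, k, l, sign) depends on the graph only, so the
  iteration over them is unrolled into the program text.\<close>

definition grid :: "'v fgraph \<Rightarrow> nat \<Rightarrow> 'v set \<Rightarrow> nat \<Rightarrow> 'v point" where
  "grid G N e n = coord G e (real n / real N)"

locale refined_graph =
  fixes G :: "'v fgraph" and N :: nat
  assumes graph: "finite_simple_graph G"
    and deg: "\<And>v. v \<in> verts G \<Longrightarrow> 2 \<le> vdegree G v"
    and N_pos: "0 < N"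
begin

abbreviation pt :: "'v set \<Rightarrow> nat \<Rightarrow> 'v point" where
  "pt \<equiv> grid G N"

lemma finite_verts: "finite (verts G)"
  using graph by (simp add: finite_simple_graph_def)

lemma edgeD:
  assumes "e \<in> edges G"
  shows "e \<subseteq> verts G" "tail G e \<noteq> head G e" "e = {tail G e, head G e}"
    "tail G e \<in> verts G" "head G e \<in> verts G" "tail G e \<in> e" "head G e \<in> e"
  using graph assms unfolding finite_simple_graph_def by blast+

lemma mem_edge_iff: "e \<in> edges G \<Longrightarrow> v \<in> e \<longleftrightarrow> v = tail G e \<or> v = head G e"
  using edgeD(3)[of e] by blast

lemma finite_edges: "finite (edges G)"
  by (rule finite_subset[of _ "Pow (verts G)"]) (use edgeD(1) finite_verts in auto)

lemma pt_0: "pt e 0 = Vertex (tail G e)"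
  by (simp add: grid_def coord_def)

lemma pt_N: "pt e N = Vertex (head G e)"
  using N_pos by (simp add: grid_def coord_def)

lemma pt_inner: "0 < n \<Longrightarrow> n < N \<Longrightarrow> pt e n = Inner e (real n / real N)"
  by (simp add: grid_def coord_def)

lemma pt_cases:
  assumes "n \<le> N"
  obtains "n = 0" "pt e n = Vertex (tail G e)"
  | "n = N" "pt e n = Vertex (head G e)"
  | "0 < n" "n < N" "pt e n = Inner e (real n / real N)"
  using assms pt_0 pt_N pt_inner by (metis bot_nat_0.not_eq_extremum le_neq_implies_less)

lemma pt_eq_iff:
  assumes "e \<in> edges G" "n \<le> N" "m \<le> N"
  shows "pt e n = pt e m \<longleftrightarrow> n = m"
  apply (insert edgeD(2)[OF assms(1)] N_pos)
  by (rule pt_cases[OF assms(2), of e]; rule pt_cases[OF assms(3), of e]) auto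

lemma pt_inner_eq_iff:
  assumes "0 < n" "n < N" "m \<le> N"
  shows "pt e n = pt e' m \<longleftrightarrow> e = e' \<and> n = m"
  apply (insert assms(1,2)) by (rule pt_cases[OF assms(3), of e']) (auto simp: pt_inner)

lemma pt_in_ref_verts: "e \<in> edges G \<Longrightarrow> n \<le> N \<Longrightarrow> pt e n \<in> ref_verts G N"
  unfolding ref_verts_def using edgeD(4,5)[of e] pt_0[of e] pt_N[of e] pt_inner[of n e]
  by (cases "n = 0"; cases "n = N") auto

lemma ref_verts_eq:
  "ref_verts G N = Vertex ` verts G \<union> (\<lambda>(e, n). pt e n) ` (edges G \<times> {0<..<N})"
  by (force simp: ref_verts_def pt_inner)

lemma finite_ref_verts: "finite (ref_verts G N)"
  using finite_verts finite_edges by (simp add: ref_verts_eq)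

lemma vertex_in_edge: "v \<in> verts G \<Longrightarrow> \<exists>e\<in>edges G. v \<in> e"
proof (rule ccontr)
  assume "v \<in> verts G" and "\<not> (\<exists>e\<in>edges G. v \<in> e)"
  then have "{e \<in> edges G. v \<in> e} = {}" by blast
  with deg[OF \<open>v \<in> verts G\<close>] show False by (simp add: vdegree_def)
qed

text \<open>No vertex is isolated, since all degrees are positive. Hence properties of all vertices
  of the refinement can be checked along edges, any incident edge serving for a vertex of the
  original graph.\<close>

lemma ref_vertsE:
  assumes "p \<in> ref_verts G N"
  obtains e n where "e \<in> edges G" "n \<le> N" "p = pt e n"
proof -
  consider v where "v \<in> verts G" "p = Vertex v" 
    | e n where "e \<in> edges G" "0 < n" "n < N" "p = pt e n"
    using assms by (auto simp: ref_verts_eq)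
  then show ?thesis
  proof cases
    case 1
    then obtain e where "e \<in> edges G" "v \<in> e" using vertex_in_edge by blast
    with 1 that[of e 0] that[of e N] show ?thesis
      by (auto simp: pt_0 pt_N mem_edge_iff)
  next
    case 2
    then show ?thesis using that[of e n] by simp
  qed
qed

lemma ref_adj_iff:
  "ref_adj G N p q \<longleftrightarrow>
    (\<exists>e\<in>edges G. \<exists>n<N. p = pt e n \<and> q = pt e (Suc n) \<or> q = pt e n \<and> p = pt e (Suc n))"
  unfolding ref_adj_def grid_def by (auto simp: doubleton_eq_iff)

definition nbr :: "'v \<Rightarrow> 'v set \<Rightarrow> 'v point" where
  "nbr v e = (if v = tail G e then pt e 1 else pt e (N - 1))"

lemma nbrs_inner:
  assumes "e \<in> edges G" "0 < n" "n < N"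
  shows "{q. ref_adj G N (pt e n) q} = {pt e (n - 1), pt e (Suc n)}"
proof -
  have "ref_adj G N (pt e n) q \<longleftrightarrow> q = pt e (n - 1) \<or> q = pt e (Suc n)" for q
  proof
    assume "ref_adj G N (pt e n) q"
    then show "q = pt e (n - 1) \<or> q = pt e (Suc n)"
      using assms by (auto simp: ref_adj_iff pt_inner_eq_iff)
  next
    assume "q = pt e (n - 1) \<or> q = pt e (Suc n)"
    then show "ref_adj G N (pt e n) q"
    proof
      assume q: "q = pt e (n - 1)"
      show ?thesis unfolding ref_adj_iff
        by (rule bexI[of _ e], rule exI[of _ "n - 1"]) (use assms q in auto)
    next
      assume q: "q = pt e (Suc n)"
      show ?thesis unfolding ref_adj_iff
        by (rule bexI[of _ e], rule exI[of _ n]) (use assms q in auto)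
    qed
  qed
  then show ?thesis by auto
qed

lemma Vertex_eq_pt_iff:
  assumes "n \<le> N"
  shows "Vertex v = pt e n \<longleftrightarrow> n = 0 \<and> v = tail G e \<or> n = N \<and> v = head G e"
  apply (insert N_pos) by (rule pt_cases[OF assms, of e]) auto

lemma nbrs_vertex:
  assumes "v \<in> verts G"
  shows "{q. ref_adj G N (Vertex v) q} = nbr v ` {e \<in> edges G. v \<in> e}"
proof (intro equalityI subsetI)
  fix q assume "q \<in> {q. ref_adj G N (Vertex v) q}"
  then obtain e n where e: "e \<in> edges G" "n < N"
    and "Vertex v = pt e n \<and> q = pt e (Suc n) \<or> q = pt e n \<and> Vertex v = pt e (Suc n)"
    by (auto simp: ref_adj_iff)
  then have "v \<in> e \<and> q = nbr v e"
    using edgeD(2)[OF e(1)] by (auto simp: Vertex_eq_pt_iff nbr_def mem_edge_iff)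
  with e show "q \<in> nbr v ` {e \<in> edges G. v \<in> e}" by auto
next
  fix q assume "q \<in> nbr v ` {e \<in> edges G. v \<in> e}"
  then obtain e where e: "e \<in> edges G" "v \<in> e" "q = nbr v e" by auto
  from e consider "v = tail G e" | "v = head G e" "v \<noteq> tail G e"
    by (auto simp: mem_edge_iff)
  then show "q \<in> {q. ref_adj G N (Vertex v) q}"
  proof cases
    case 1
    then show ?thesis using e N_pos by (force simp: ref_adj_iff nbr_def pt_0)
  next
    case 2
    then have "ref_adj G N (Vertex v) q" unfolding ref_adj_iff
      by (intro bexI[of _ e] exI[of _ "N - 1"]) (use e N_pos in \<open>auto simp: nbr_def pt_N\<close>)
    then show ?thesis by simp
  qed
qed

text \<open>For N > 1 the neighbour is an inner point, whose name contains its edge. For N = 1 it is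
  the opposite end vertex, and the edge is recovered as the set of its two ends; here it matters
  that the graph has no parallel edges.\<close>

lemma inj_nbr: "inj_on (nbr v) {e \<in> edges G. v \<in> e}"
proof (rule inj_onI; clarify)
  fix e e' assume *: "e \<in> edges G" "v \<in> e" "e' \<in> edges G" "v \<in> e'" "nbr v e = nbr v e'"
  show "e = e'"
  proof (cases "N = 1")
    case True
    have nb: "nbr v e = Vertex (if v = tail G e then head G e else tail G e)" for e
      using pt_N[of e] pt_0[of e] unfolding nbr_def by (simp add: True)
    have "e = {v, if v = tail G e then head G e else tail G e}" if "e \<in> edges G" "v \<in> e" for e
      using mem_edge_iff[OF that(1)] that(2) by (intro set_eqI) auto
    note both = this[OF *(1,2)] this[OF *(3,4)]
    have "{v, if v = tail G e then head G e else tail G e} =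
        {v, if v = tail G e' then head G e' else tail G e'}"
      using *(5) unfolding nb point.inject by (rule arg_cong)
    then show ?thesis by (rule both(1)[THEN trans, OF trans[OF _ both(2)[symmetric]]])
  next
    case False
    then have N: "0 < N - 1" "N - 1 < N" "1 < N" "1 \<le> N" "N - 1 \<le> N" using N_pos by auto
    have "\<exists>n. 0 < n \<and> n < N \<and> nbr v e = pt e n" for e
      using N unfolding nbr_def by (metis zero_less_one)
    then obtain n m where "0 < n" "n < N" "nbr v e = pt e n" "m < N" "nbr v e' = pt e' m"
      by metis
    with *(5) show ?thesis using pt_inner_eq_iff[of n m e e'] by simp
  qed
qed

lemma sum_nbrs_vertex:
  assumes "v \<in> verts G"
  shows "(\<Sum>q | ref_adj G N (Vertex v) q. h q) = (\<Sum>e | e \<in> edges G \<and> v \<in> e. h (nbr v e))"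
  by (simp add: nbrs_vertex[OF assms] sum.reindex[OF inj_nbr] o_def)

lemma sum_nbrs_inner:
  assumes "e \<in> edges G" "0 < n" "n < N"
  shows "(\<Sum>q | ref_adj G N (pt e n) q. h q) = h (pt e (n - 1)) + h (pt e (Suc n))"
  using assms pt_eq_iff[OF assms(1), of "n - 1" "Suc n"] by (simp add: nbrs_inner)

lemma ref_degree_vertex: "v \<in> verts G \<Longrightarrow> ref_degree G N (Vertex v) = vdegree G v"
  by (simp add: ref_degree_def nbrs_vertex card_image[OF inj_nbr] vdegree_def)

lemma ref_degree_inner:
  "e \<in> edges G \<Longrightarrow> 0 < n \<Longrightarrow> n < N \<Longrightarrow> ref_degree G N (pt e n) = 2"
  using pt_eq_iff[of e "n - 1" "Suc n"] by (simp add: ref_degree_def nbrs_inner)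

lemma ref_degree_pos:
  assumes "p \<in> ref_verts G N"
  shows "0 < ref_degree G N p"
proof -
  consider v where "v \<in> verts G" "p = Vertex v" 
    | e n where "e \<in> edges G" "0 < n" "n < N" "p = pt e n"
    using assms by (auto simp: ref_verts_eq)
  then show ?thesis
    by cases (use deg in \<open>force simp: ref_degree_vertex ref_degree_inner\<close>)+
qed

lemma sum_incidences:
  fixes h :: "'v \<Rightarrow> 'v set \<Rightarrow> 'a::comm_monoid_add"
  shows "(\<Sum>v\<in>verts G. \<Sum>e | e \<in> edges G \<and> v \<in> e. h v e) =
    (\<Sum>e\<in>edges G. h (tail G e) e + h (head G e) e)"
proof -
  have "(\<Sum>v\<in>verts G. \<Sum>e | e \<in> edges G \<and> v \<in> e. h v e) =
    (\<Sum>e\<in>edges G. \<Sum>v | v \<in> verts G \<and> v \<in> e. h v e)"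
    by (rule sum.swap_restrict) (use finite_verts finite_edges in auto)
  also have "\<dots> = (\<Sum>e\<in>edges G. h (tail G e) e + h (head G e) e)"
  proof (rule sum.cong)
    fix e assume e: "e \<in> edges G"
    have "{v. v \<in> verts G \<and> v \<in> e} = {tail G e, head G e}"
      using edgeD[OF e] by blast
    then show "(\<Sum>v | v \<in> verts G \<and> v \<in> e. h v e) = h (tail G e) e + h (head G e) e"
      using edgeD(2)[OF e] by simp
  qed simp
  finally show ?thesis .
qed

lemma sum_ref_verts:
  "(\<Sum>p\<in>ref_verts G N. h p) =
    (\<Sum>v\<in>verts G. h (Vertex v)) + (\<Sum>e\<in>edges G. \<Sum>n\<in>{0<..<N}. h (pt e n))"
proof -
  have "(\<Sum>p\<in>ref_verts G N. h p) = (\<Sum>p\<in>Vertex ` verts G. h p) +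
    (\<Sum>p\<in>(\<lambda>(e, n). pt e n) ` (edges G \<times> {0<..<N}). h p)"
    unfolding ref_verts_eq
    by (rule sum.union_disjoint) (use finite_verts finite_edges in \<open>auto simp: pt_inner\<close>)
  also have "(\<Sum>p\<in>Vertex ` verts G. h p) = (\<Sum>v\<in>verts G. h (Vertex v))"
    by (subst sum.reindex) (auto simp: inj_on_def)
  also have "(\<Sum>p\<in>(\<lambda>(e, n). pt e n) ` (edges G \<times> {0<..<N}). h p) =
     (\<Sum>(e, n)\<in>edges G \<times> {0<..<N}. h (pt e n))"
    by (subst sum.reindex) (auto simp: inj_on_def pt_inner_eq_iff case_prod_unfold)
  also have "\<dots> = (\<Sum>e\<in>edges G. \<Sum>n\<in>{0<..<N}. h (pt e n))"
    by (simp add: sum.cartesian_product)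
  finally show ?thesis .
qed

text \<open>Every edge of the refinement yields two ordered adjacent pairs. Exchanging the two
  summands gives the symmetry of the adjacency operator, \<open>H\<close> depending on its first
  argument only gives degree-weighted sums, and both together give the Dirichlet forms
  below.\<close>

lemma sum_adjacent:
  fixes H :: "'v point \<Rightarrow> 'v point \<Rightarrow> 'a::comm_monoid_add"
  shows "(\<Sum>p\<in>ref_verts G N. \<Sum>q | ref_adj G N p q. H p q) =
    (\<Sum>e\<in>edges G. \<Sum>n<N. H (pt e n) (pt e (Suc n)) + H (pt e (Suc n)) (pt e n))"
proof -
  have "(\<Sum>p\<in>ref_verts G N. \<Sum>q | ref_adj G N p q. H p q) =
    (\<Sum>v\<in>verts G. \<Sum>e | e \<in> edges G \<and> v \<in> e. H (Vertex v) (nbr v e)) +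
    (\<Sum>e\<in>edges G. \<Sum>n\<in>{0<..<N}. H (pt e n) (pt e (n - 1)) + H (pt e n) (pt e (Suc n)))"
    by (simp add: sum_ref_verts sum_nbrs_vertex sum_nbrs_inner)
  also have "\<dots> = (\<Sum>e\<in>edges G. (H (pt e 0) (pt e 1) + H (pt e N) (pt e (N - 1))) +
    (\<Sum>n\<in>{0<..<N}. H (pt e n) (pt e (n - 1)) + H (pt e n) (pt e (Suc n))))"
  proof -
    have "nbr (tail G e) e = pt e 1" "nbr (head G e) e = pt e (N - 1)" if "e \<in> edges G" for e
      using edgeD(2)[OF that] by (auto simp: nbr_def)
    then show ?thesis by (simp add: sum_incidences sum.distrib pt_0 pt_N)
  qed
  also have "\<dots> = (\<Sum>e\<in>edges G. \<Sum>n<N. H (pt e n) (pt e (Suc n)) + H (pt e (Suc n)) (pt e n))"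
  proof (rule sum.cong)
    fix e
    obtain M where M: "N = Suc M" using N_pos gr0_implies_Suc by blast
    have I: "{0<..<N} = Suc ` {..<M}"
      unfolding M by (auto simp: image_iff) (metis gr0_implies_Suc less_Suc_eq_0_disj lessThan_iff Suc_less_eq)
    have "(\<Sum>n<N. H (pt e n) (pt e (Suc n))) = H (pt e 0) (pt e 1) + 
        (\<Sum>n<M. H (pt e (Suc n)) (pt e (Suc (Suc n))))"
      unfolding M by (subst sum.lessThan_Suc_shift) simp
    moreover have "(\<Sum>n<N. H (pt e (Suc n)) (pt e n)) = H (pt e N) (pt e (N - 1)) + 
        (\<Sum>n<M. H (pt e (Suc n)) (pt e n))"
      unfolding M by (simp add: add.commute)
    ultimately show "(H (pt e 0) (pt e 1) + H (pt e N) (pt e (N - 1))) +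
      (\<Sum>n\<in>{0<..<N}. H (pt e n) (pt e (n - 1)) + H (pt e n) (pt e (Suc n))) =
      (\<Sum>n<N. H (pt e n) (pt e (Suc n)) + H (pt e (Suc n)) (pt e n))"
      unfolding I by (simp add: sum.reindex sum.distrib ac_simps)
  qed simp
  finally show ?thesis .
qed

lemma sum_degree:
  fixes h :: "'v point \<Rightarrow> complex"
  shows "(\<Sum>p\<in>ref_verts G N. of_nat (ref_degree G N p) * h p) =
    (\<Sum>e\<in>edges G. \<Sum>n<N. h (pt e n) + h (pt e (Suc n)))"
proof -
  have "(\<Sum>p\<in>ref_verts G N. of_nat (ref_degree G N p) * h p) =
    (\<Sum>p\<in>ref_verts G N. \<Sum>q | ref_adj G N p q. h p)"
    by (simp add: ref_degree_def)
  then show ?thesis by (simp only: sum_adjacent)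
qed

end

section \<open>Discrete eigenfunctions\<close>

text \<open>Gaussian elimination on the points of \<open>X\<close>, with a member not vanishing at
  \<open>a\<close> as pivot. The family is indexed, so that coinciding members count as dependent;
  the powers of an operator applied to one function may well coincide.\<close>

lemma linear_dependence:
  fixes h :: "'i \<Rightarrow> 'p \<Rightarrow> 'a::field"
  assumes "finite X" "finite J" "card X < card J"
  shows "\<exists>c. (\<exists>i\<in>J. c i \<noteq> 0) \<and> (\<forall>x\<in>X. (\<Sum>i\<in>J. c i * h i x) = 0)"
  using assms
proof (induction X arbitrary: h J rule: finite_induct)
  case empty
  then obtain k where "k \<in> J" by (metis card.empty ex_in_conv less_irrefl)
  then show ?case by (intro exI[of _ "\<lambda>_. 1"]) auto
next
  case (insert a X)
  show ?case
  proof (cases "\<forall>i\<in>J. h i a = 0")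
    case True
    from insert obtain c where "\<exists>i\<in>J. c i \<noteq> 0" "\<forall>x\<in>X. (\<Sum>i\<in>J. c i * h i x) = 0"
      by (metis Suc_lessD card_insert_disjoint)
    with True show ?thesis by (intro exI[of _ c]) auto
  next
    case False
    then obtain k where k: "k \<in> J" "h k a \<noteq> 0" by blast
    define J' where "J' = J - {k}"
    have J: "J = insert k J'" "k \<notin> J'" "finite J'" "card X < card J'"
      using k insert by (auto simp: J'_def)
    obtain c where c: "\<exists>i\<in>J'. c i \<noteq> 0"
      "\<And>x. x \<in> X \<Longrightarrow> (\<Sum>i\<in>J'. c i * (h i x - h i a / h k a * h k x)) = 0"
      using insert.IH[OF J(3,4), of "\<lambda>i x. h i x - h i a / h k a * h k x"] by blast
    \<comment> \<open>The pivot receives all the multiples of \<open>h k\<close> that the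
      elimination subtracted from the other members.\<close>
    define b where "b = - (\<Sum>i\<in>J'. c i * (h i a / h k a))"
    have split: "(\<Sum>i\<in>J. (c(k := b)) i * h i x) =
        (\<Sum>i\<in>J'. c i * (h i x - h i a / h k a * h k x))" for x
    proof -
      have "(\<Sum>i\<in>J. (c(k := b)) i * h i x) = b * h k x + (\<Sum>i\<in>J'. (c(k := b)) i * h i x)"
        using J by simp
      also have "(\<Sum>i\<in>J'. (c(k := b)) i * h i x) = (\<Sum>i\<in>J'. c i * h i x)"
        using J by (intro sum.cong) auto
      finally show ?thesis
        by (simp add: b_def algebra_simps sum_subtractf sum_distrib_left sum_distrib_right)
    qed
    have "(\<Sum>i\<in>J. (c(k := b)) i * h i x) = 0" if "x \<in> insert a X" for x
      unfolding split using that c(2) k(2) by auto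
    moreover have "\<exists>i\<in>J. (c(k := b)) i \<noteq> 0" using c(1) J by auto
    ultimately show ?thesis by blast
  qed
qed

text \<open>The three-term recurrence of waves with phase t per step. It makes them eigenfunctions
  at inner points, and it propagates a wave from its first two values.\<close>

lemma wave_step:
  "(a * cis (x - t) + b * cis (- (x - t))) + (a * cis (x + t) + b * cis (- (x + t))) =
    2 * of_real (cos t) * (a * cis x + b * cis (- x))"
  by (simp add: complex_eq_iff cos_diff sin_diff cos_add sin_add algebra_simps)

context refined_graph begin

section \<open>Symmetry of the discrete Laplacian\<close>

lemma N_ne: "complex_of_nat N \<noteq> 0" using N_pos by simp

text \<open>The factor \<open>1 - \<mu> / (of_nat N)\<^sup>2\<close> is the eigenvalue of the
  normalized adjacency operator. It is this number that turns out to be a cosine.\<close>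

lemma eigenspace_N_iff:
  "f \<in> eigenspace_N G N \<mu> \<longleftrightarrow> f \<in> HN G N \<and> (\<forall>p\<in>ref_verts G N.
    (\<Sum>q | ref_adj G N p q. f q) = (1 - \<mu> / (of_nat N)\<^sup>2) * of_nat (ref_degree G N p) * f p)"
proof -
  have "laplacian_N G N f p = \<mu> * f p \<longleftrightarrow>
    (\<Sum>q | ref_adj G N p q. f q) = (1 - \<mu> / (of_nat N)\<^sup>2) * of_nat (ref_degree G N p) * f p"
    if "p \<in> ref_verts G N" for p
    using ref_degree_pos[OF that] N_ne unfolding laplacian_N_def
    by (simp add: divide_simps) (auto simp: algebra_simps)
  then show ?thesis by (auto simp: eigenspace_N_def)
qed

lemma adjacency_symmetric:
  fixes f g :: "'v point \<Rightarrow> complex"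
  shows "(\<Sum>p\<in>ref_verts G N. (\<Sum>q | ref_adj G N p q. f q) * cnj (g p)) =
    (\<Sum>p\<in>ref_verts G N. f p * cnj (\<Sum>q | ref_adj G N p q. g q))"
  using sum_adjacent[of "\<lambda>p q. f q * cnj (g p)"] sum_adjacent[of "\<lambda>p q. f p * cnj (g q)"]
  by (simp add: sum_distrib_left sum_distrib_right cnj_sum add.commute)

lemma inner_N_add_left: "inner_N G N (\<lambda>p. f p + g p) h = inner_N G N f h + inner_N G N g h"
  by (simp add: inner_N_def algebra_simps sum.distrib)

lemma inner_N_mult_left: "inner_N G N (\<lambda>p. c * f p) h = c * inner_N G N f h"
  by (simp add: inner_N_def sum_distrib_left ac_simps)

lemma inner_N_mult_right: "inner_N G N h (\<lambda>p. c * f p) = cnj c * inner_N G N h f"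
  by (simp add: inner_N_def sum_distrib_left ac_simps)

lemma inner_N_sum_left: "inner_N G N (\<lambda>p. \<Sum>i\<in>X. f i p) h = (\<Sum>i\<in>X. inner_N G N (f i) h)"
proof -
  have "(\<Sum>p\<in>ref_verts G N. of_nat (ref_degree G N p) * (\<Sum>i\<in>X. f i p) * cnj (h p)) =
    (\<Sum>p\<in>ref_verts G N. \<Sum>i\<in>X. of_nat (ref_degree G N p) * f i p * cnj (h p))"
    by (simp add: sum_distrib_left sum_distrib_right)
  also have "\<dots> = (\<Sum>i\<in>X. \<Sum>p\<in>ref_verts G N. of_nat (ref_degree G N p) * f i p * cnj (h p))"
    by (rule sum.swap)
  finally show ?thesis by (simp add: inner_N_def sum_distrib_left)
qed

lemma inner_N_commute: "inner_N G N f g = cnj (inner_N G N g f)"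
  by (simp add: inner_N_def ac_simps)

lemma inner_N_sum_right: "inner_N G N h (\<lambda>p. \<Sum>i\<in>X. f i p) = (\<Sum>i\<in>X. inner_N G N h (f i))"
  unfolding inner_N_commute[of h] by (simp add: inner_N_sum_left)

lemma inner_N_cong:
  assumes "\<And>p. p \<in> ref_verts G N \<Longrightarrow> f p = f' p" "\<And>p. p \<in> ref_verts G N \<Longrightarrow> g p = g' p"
  shows "inner_N G N f g = inner_N G N f' g'"
  using assms by (simp add: inner_N_def)

lemma laplacian_N_symmetric:
  "inner_N G N (laplacian_N G N f) g = inner_N G N f (laplacian_N G N g)"
proof -
  have "(\<Sum>p\<in>ref_verts G N. of_nat (ref_degree G N p) * laplacian_N G N f p * cnj (g p)) =
    (\<Sum>p\<in>ref_verts G N. (of_nat N)\<^sup>2 * (of_nat (ref_degree G N p) * f p * cnj (g p)) -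
      (of_nat N)\<^sup>2 * ((\<Sum>q | ref_adj G N p q. f q) * cnj (g p)))"
    using ref_degree_pos by (intro sum.cong) (auto simp: laplacian_N_def field_simps)
  also have "\<dots> = (\<Sum>p\<in>ref_verts G N. (of_nat N)\<^sup>2 * (of_nat (ref_degree G N p) * f p * cnj (g p)) -
      (of_nat N)\<^sup>2 * (f p * cnj (\<Sum>q | ref_adj G N p q. g q)))"
    by (simp only: sum_subtractf sum_distrib_left[symmetric] adjacency_symmetric)
  also have "\<dots> = (\<Sum>p\<in>ref_verts G N. of_nat (ref_degree G N p) * f p * cnj (laplacian_N G N g p))"
    using ref_degree_pos by (intro sum.cong) (auto simp: laplacian_N_def field_simps)
  finally show ?thesis by (simp add: inner_N_def)
qed

lemma weighted_norm_eq:
  "(\<Sum>p\<in>ref_verts G N. of_nat (ref_degree G N p) * h p * cnj (h p)) =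
    of_real (\<Sum>p\<in>ref_verts G N. real (ref_degree G N p) * (cmod (h p))\<^sup>2)"
  by (simp add: complex_norm_square ac_simps del: of_real_power)

lemma weighted_norm_pos:
  assumes "p \<in> ref_verts G N" "h p \<noteq> 0"
  shows "0 < (\<Sum>p\<in>ref_verts G N. real (ref_degree G N p) * (cmod (h p))\<^sup>2)"
  using assms ref_degree_pos[OF assms(1)] finite_ref_verts by (intro sum_pos2[of _ p]) auto

lemma inner_N_self_eq_0:
  assumes "inner_N G N h h = 0" "h \<in> HN G N" "edges G \<noteq> {}"
  shows "h = (\<lambda>_. 0)"
proof (rule ccontr)
  assume "h \<noteq> (\<lambda>_. 0)"
  with assms(2) obtain p where p: "p \<in> ref_verts G N" "h p \<noteq> 0"
    unfolding HN_def fun_eq_iff by blast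
  have "card (edges G) \<noteq> 0" using assms(3) finite_edges by simp
  with assms(1) N_pos have "(\<Sum>p\<in>ref_verts G N. of_nat (ref_degree G N p) * h p * cnj (h p)) = 0"
    unfolding inner_N_def by simp
  with weighted_norm_pos[of p h, OF p] show False
    unfolding weighted_norm_eq of_real_eq_0_iff by simp
qed

section \<open>Completeness of the discrete eigenfunctions\<close>

definition lap_restricted :: "('v point \<Rightarrow> complex) \<Rightarrow> 'v point \<Rightarrow> complex" where
  "lap_restricted f = RN G N (laplacian_N G N f)"

definition lap_poly :: "complex poly \<Rightarrow> ('v point \<Rightarrow> complex) \<Rightarrow> 'v point \<Rightarrow> complex" where
  "lap_poly P f x = (\<Sum>i\<le>degree P. coeff P i * (lap_restricted ^^ i) f x)"

text \<open>Padding with zero coefficients allows polynomials of different degrees to be compared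
  over one index range.\<close>

lemma lap_poly_eq:
  assumes "degree P \<le> n"
  shows "lap_poly P f x = (\<Sum>i\<le>n. coeff P i * (lap_restricted ^^ i) f x)"
  unfolding lap_poly_def
  by (rule sum.mono_neutral_left) (use assms in \<open>auto simp: coeff_eq_0\<close>)

lemma lap_restricted_HN: "lap_restricted f \<in> HN G N"
  by (simp add: lap_restricted_def RN_def HN_def)

lemma lap_restricted_sum:
  "lap_restricted (\<lambda>x. \<Sum>i\<in>X. c i * f i x) p = (\<Sum>i\<in>X. c i * lap_restricted (f i) p)"
proof -
  have "(\<Sum>q | ref_adj G N p q. \<Sum>i\<in>X. c i * f i q) = (\<Sum>i\<in>X. c i * (\<Sum>q | ref_adj G N p q. f i q))"
    by (subst sum.swap) (simp add: sum_distrib_left)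
  then show ?thesis
    by (simp add: lap_restricted_def RN_def laplacian_N_def algebra_simps sum_distrib_left
        sum_subtractf sum_divide_distrib)
qed

text \<open>By symmetry each application of the Laplacian moves over to \<open>h\<close>, where it
  only produces the factor \<open>cnj \<mu>\<close>. Orthogonality to an eigenfunction thus extends
  from \<open>g\<close> to its whole cyclic subspace.\<close>

lemma inner_lap_power:
  assumes "h \<in> eigenspace_N G N \<mu>" "inner_N G N g h = 0"
  shows "inner_N G N ((lap_restricted ^^ i) g) h = 0"
proof (induction i)
  case (Suc i)
  have "inner_N G N ((lap_restricted ^^ Suc i) g) h = inner_N G N (laplacian_N G N ((lap_restricted ^^ i) g)) h"
    by (rule inner_N_cong) (auto simp: lap_restricted_def RN_def)
  also have "\<dots> = inner_N G N ((lap_restricted ^^ i) g) (laplacian_N G N h)"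
    by (rule laplacian_N_symmetric)
  also have "\<dots> = inner_N G N ((lap_restricted ^^ i) g) (\<lambda>p. \<mu> * h p)"
    by (rule inner_N_cong) (use assms(1) in \<open>auto simp: eigenspace_N_def\<close>)
  finally show ?case using Suc by (simp add: inner_N_mult_right)
qed (use assms in simp)

text \<open>A factor \<open>X - \<mu>\<close> split off from a polynomial of minimal degree annihilating \<open>g\<close>
  produces an eigenfunction in the cyclic subspace of \<open>g\<close>.\<close>

lemma eigenfunctions_complete:
  assumes g: "g \<in> HN G N" and E: "edges G \<noteq> {}"
    and orth: "\<And>\<mu> h. h \<in> eigenspace_N G N \<mu> \<Longrightarrow> inner_N G N g h = 0"
  shows "g = (\<lambda>_. 0)"
proof (rule ccontr)
  assume g0: "g \<noteq> (\<lambda>_. 0)"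
  define n where "n = card (ref_verts G N)"
  define ann where "ann P \<longleftrightarrow> P \<noteq> 0 \<and> lap_poly P g = (\<lambda>_. 0)" for P
  have HN: "(lap_restricted ^^ i) g \<in> HN G N" for i
    by (cases i) (use g lap_restricted_HN in auto)
  have polyHN: "lap_poly P g \<in> HN G N" for P
    using HN by (simp add: lap_poly_def HN_def)
  \<comment> \<open>These are n + 1 functions on n points, so some nonzero polynomial in the
    Laplacian annihilates \<open>g\<close>.\<close>
  obtain c where c: "\<exists>i\<in>{..n}. c i \<noteq> 0"
    "\<forall>x\<in>ref_verts G N. (\<Sum>i\<le>n. c i * (lap_restricted ^^ i) g x) = 0"
    using linear_dependence[of "ref_verts G N" "{..n}" "\<lambda>i. (lap_restricted ^^ i) g"] finite_ref_verts
    by (auto simp: n_def)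
  define P0 where "P0 = (\<Sum>i\<le>n. monom (c i) i)"
  have coeff_P0: "coeff P0 i = (if i \<le> n then c i else 0)" for i
    by (simp add: P0_def coeff_sum)
  then have "degree P0 \<le> n" by (intro degree_le) auto
  then have "lap_poly P0 g x = (\<Sum>i\<le>n. c i * (lap_restricted ^^ i) g x)" for x
    by (simp add: lap_poly_eq[of P0 n] coeff_P0)
  moreover have "(lap_restricted ^^ i) g x = 0" if "x \<notin> ref_verts G N" for i x
    using that HN[of i] by (simp add: HN_def)
  ultimately have "lap_poly P0 g x = 0" for x
    using c(2) by (cases "x \<in> ref_verts G N") auto
  moreover have "P0 \<noteq> 0" using c(1) coeff_P0 by (metis atMost_iff coeff_0)
  ultimately have "ann P0" by (auto simp: ann_def)
  then obtain P where P: "ann P" and min: "\<And>Q. ann Q \<Longrightarrow> degree P \<le> degree Q"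
    using ex_has_least_nat[of ann P0 degree] by blast
  have "degree P \<noteq> 0"
  proof
    assume "degree P = 0"
    with P g0 show False
      by (auto simp: ann_def lap_poly_def fun_eq_iff) (metis leading_coeff_0_iff)
  qed
  then have "\<not> constant (poly P)" by (simp add: constant_degree)
  then obtain \<mu> where "poly P \<mu> = 0" using fundamental_theorem_of_algebra by blast
  then obtain Q where Q: "P = [:- \<mu>, 1:] * Q" by (metis dvdE poly_eq_0_iff_dvd)
  have "Q \<noteq> 0" using Q P by (auto simp: ann_def)
  then have degP: "degree P = Suc (degree Q)" unfolding Q by (simp add: degree_mult_eq del: mult_pCons_left)
  define h where "h = lap_poly Q g"
  have "\<not> ann Q" using min[of Q] degP by auto
  then have "h \<noteq> (\<lambda>_. 0)" using \<open>Q \<noteq> 0\<close> by (simp add: ann_def h_def)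
  have "lap_restricted h x = \<mu> * h x" for x
  proof -
    let ?m = "degree Q"
    have "h = (\<lambda>x. \<Sum>i\<le>?m. coeff Q i * (lap_restricted ^^ i) g x)"
      by (auto simp: h_def lap_poly_def)
    then have "lap_restricted h x = (\<Sum>i\<le>?m. coeff Q i * (lap_restricted ^^ Suc i) g x)"
      by (simp add: lap_restricted_sum)
    also have "\<dots> = (\<Sum>i\<le>Suc ?m. coeff (pCons 0 Q) i * (lap_restricted ^^ i) g x)"
      by (subst sum.atMost_Suc_shift) simp
    finally have 1: "lap_restricted h x = (\<Sum>i\<le>Suc ?m. coeff (pCons 0 Q) i * (lap_restricted ^^ i) g x)" .
    have 2: "h x = (\<Sum>i\<le>Suc ?m. coeff Q i * (lap_restricted ^^ i) g x)"
      unfolding h_def by (rule lap_poly_eq) simp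
    have "lap_poly P g x = (\<Sum>i\<le>Suc ?m. coeff P i * (lap_restricted ^^ i) g x)"
      by (rule lap_poly_eq) (simp add: degP)
    also have "\<dots> = lap_restricted h x - \<mu> * h x"
      unfolding 1 2 sum_distrib_left sum_subtractf[symmetric]
      by (intro sum.cong) (auto simp: Q algebra_simps)
    finally show ?thesis using P by (simp add: ann_def)
  qed
  then have h: "h \<in> eigenspace_N G N \<mu>"
    using polyHN[of Q] unfolding eigenspace_N_def
    by (auto simp: h_def lap_restricted_def RN_def split: if_splits) metis
  \<comment> \<open>By hypothesis \<open>g\<close> is orthogonal to the eigenfunction
    \<open>h\<close>, hence so are all powers of the Laplacian applied to \<open>g\<close>, and
    \<open>h\<close> itself is a combination of these.\<close>
  have "inner_N G N h h = inner_N G N (\<lambda>x. \<Sum>i\<le>degree Q. coeff Q i * (lap_restricted ^^ i) g x) h"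
    by (simp add: h_def lap_poly_def[abs_def])
  also have "\<dots> = 0"
    by (simp add: inner_N_sum_left inner_N_mult_left inner_lap_power[OF h orth[OF h]])
  finally show False
    using inner_N_self_eq_0[of h] polyHN[of Q] E \<open>h \<noteq> (\<lambda>_. 0)\<close> by (simp add: h_def)
qed

section \<open>Orthogonality and range of the discrete spectrum\<close>

lemma eigenspaces_orthogonal:
  assumes f: "f \<in> eigenspace_N G N (of_real \<mu>)" and g: "g \<in> eigenspace_N G N (of_real \<nu>)"
    and "\<mu> \<noteq> \<nu>"
  shows "inner_N G N f g = 0"
proof -
  have "of_real \<mu> * inner_N G N f g = inner_N G N (laplacian_N G N f) g"
    unfolding inner_N_mult_left[symmetric]
    by (rule inner_N_cong) (use f in \<open>auto simp: eigenspace_N_def\<close>)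
  also have "\<dots> = inner_N G N f (laplacian_N G N g)" by (rule laplacian_N_symmetric)
  also have "\<dots> = inner_N G N f (\<lambda>p. of_real \<nu> * g p)"
    by (rule inner_N_cong) (use g in \<open>auto simp: eigenspace_N_def\<close>)
  finally show ?thesis using assms(3) by (simp add: inner_N_mult_right)
qed

text \<open>Expanding the squares gives the degree-weighted norm minus s times the adjacency form.
  The sign s = 1 is the usual Dirichlet form, s = -1 its signless variant; they control the upper
  and the lower end of the spectrum.\<close>

lemma eigenfunction_dirichlet:
  fixes h :: "'v point \<Rightarrow> complex" and s :: real
  assumes h: "\<And>p. p \<in> ref_verts G N \<Longrightarrow>
      (\<Sum>q | ref_adj G N p q. h q) = l * of_nat (ref_degree G N p) * h p"
    and s: "s = 1 \<or> s = - 1"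
  shows "of_real (\<Sum>e\<in>edges G. \<Sum>n<N. (cmod (h (pt e n) - of_real s * h (pt e (Suc n))))\<^sup>2) =
    (1 - of_real s * l) * of_real (\<Sum>p\<in>ref_verts G N. real (ref_degree G N p) * (cmod (h p))\<^sup>2)"
proof -
  have "of_real (\<Sum>e\<in>edges G. \<Sum>n<N. (cmod (h (pt e n) - of_real s * h (pt e (Suc n))))\<^sup>2) =
    (\<Sum>e\<in>edges G. \<Sum>n<N. (h (pt e n) * cnj (h (pt e n)) + h (pt e (Suc n)) * cnj (h (pt e (Suc n))))
     - of_real s * (h (pt e (Suc n)) * cnj (h (pt e n)) + h (pt e n) * cnj (h (pt e (Suc n)))))"
    using s unfolding of_real_sum complex_norm_square
    by (intro sum.cong) (auto simp: algebra_simps)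
  also have "\<dots> = (\<Sum>e\<in>edges G. \<Sum>n<N. h (pt e n) * cnj (h (pt e n)) + h (pt e (Suc n)) * cnj (h (pt e (Suc n))))
     - of_real s * (\<Sum>e\<in>edges G. \<Sum>n<N. h (pt e (Suc n)) * cnj (h (pt e n)) + h (pt e n) * cnj (h (pt e (Suc n))))"
    by (simp only: sum_subtractf sum_distrib_left)
  also have "(\<Sum>e\<in>edges G. \<Sum>n<N. h (pt e n) * cnj (h (pt e n)) + h (pt e (Suc n)) * cnj (h (pt e (Suc n))))
     = (\<Sum>p\<in>ref_verts G N. of_nat (ref_degree G N p) * (h p * cnj (h p)))"
    by (rule sum_degree[symmetric])
  also have "(\<Sum>e\<in>edges G. \<Sum>n<N. h (pt e (Suc n)) * cnj (h (pt e n)) + h (pt e n) * cnj (h (pt e (Suc n))))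
     = (\<Sum>p\<in>ref_verts G N. \<Sum>q | ref_adj G N p q. h q * cnj (h p))"
    by (rule sum_adjacent[symmetric])
  also have "\<dots> = (\<Sum>p\<in>ref_verts G N. l * (of_nat (ref_degree G N p) * h p * cnj (h p)))"
    by (intro sum.cong) (auto simp: sum_distrib_right[symmetric] h)
  finally show ?thesis unfolding weighted_norm_eq[symmetric]
    by (simp add: algebra_simps sum_distrib_left sum_subtractf)
qed

text \<open>Dividing both Dirichlet forms by the norm expresses 1 - l and 1 + l as nonnegative
  reals, which at once makes l real and confines it to [-1, 1].\<close>

lemma eigenvalue_cos:
  fixes h :: "'v point \<Rightarrow> complex"
  assumes h: "\<And>p. p \<in> ref_verts G N \<Longrightarrow>
      (\<Sum>q | ref_adj G N p q. h q) = l * of_nat (ref_degree G N p) * h p"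
    and p: "p \<in> ref_verts G N" "h p \<noteq> 0"
  obtains \<theta> where "0 \<le> \<theta>" "\<theta> \<le> pi" "l = of_real (cos \<theta>)"
proof -
  define S where "S = (\<Sum>p\<in>ref_verts G N. real (ref_degree G N p) * (cmod (h p))\<^sup>2)"
  have S: "S > 0" unfolding S_def by (rule weighted_norm_pos[of p h, OF p])
  define D where "D = (\<lambda>s. (\<Sum>e\<in>edges G. \<Sum>n<N. (cmod (h (pt e n) - of_real s * h (pt e (Suc n))))\<^sup>2))"
  have D: "of_real (D s) = (1 - of_real s * l) * of_real S" if "s = 1 \<or> s = -1" for s
    unfolding D_def S_def by (rule eigenfunction_dirichlet[OF h that])
  have "D s \<ge> 0" for s unfolding D_def by (intro sum_nonneg) auto
  have l: "1 - of_real s * l = of_real (D s / S)" if "s = 1 \<or> s = -1" for s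
    using D[OF that] S by (simp add: field_simps)
  have "l = of_real (1 - D 1 / S)" using l[of 1] by (simp add: algebra_simps)
  moreover have "1 - D 1 / S = D (-1) / S - 1"
  proof -
    have "complex_of_real (D 1 / S + D (-1) / S) = of_real 2"
    proof -
      have "of_real (D 1 / S) = 1 - l" "of_real (D (-1) / S) = 1 + l"
        using l[of 1] l[of "-1"] by auto
      then show ?thesis by (simp only: of_real_add) simp
    qed
    then show ?thesis unfolding of_real_eq_iff by simp
  qed
  moreover have "D s / S \<ge> 0" for s using \<open>D s \<ge> 0\<close> S by simp
  ultimately have "l = of_real (cos (arccos (1 - D 1 / S)))" "-1 \<le> 1 - D 1 / S" "1 - D 1 / S \<le> 1"
    by (smt (verit) cos_arccos)+
  with arccos_lbound arccos_ubound that show ?thesis by metis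
qed

text \<open>At l = s the Dirichlet form with sign s vanishes, and with it every single square: the
  function is constant (s = 1) or alternating (s = -1) along each edge. These are the cases with
  sine zero, in which two neighbouring values do not determine two amplitudes.\<close>

lemma eigenfunction_extreme:
  fixes h :: "'v point \<Rightarrow> complex" and s :: real
  assumes h: "\<And>p. p \<in> ref_verts G N \<Longrightarrow>
      (\<Sum>q | ref_adj G N p q. h q) = of_real s * of_nat (ref_degree G N p) * h p"
    and s: "s = 1 \<or> s = - 1" and e: "e \<in> edges G" and n: "n \<le> N"
  shows "h (pt e n) = of_real s ^ n * h (pt e 0)"
proof -
  have "complex_of_real (\<Sum>e\<in>edges G. \<Sum>n<N. (cmod (h (pt e n) - of_real s * h (pt e (Suc n))))\<^sup>2) = 0"
    by (rule trans[OF eigenfunction_dirichlet[of h "of_real s" s, OF h s]]) (use s in auto)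
  then have "(\<Sum>e\<in>edges G. \<Sum>n<N. (cmod (h (pt e n) - of_real s * h (pt e (Suc n))))\<^sup>2) = 0"
    by (simp only: of_real_eq_0_iff)
  with finite_edges e have "(\<Sum>n<N. (cmod (h (pt e n) - of_real s * h (pt e (Suc n))))\<^sup>2) = 0"
    by (subst (asm) sum_nonneg_eq_0_iff) (auto intro!: sum_nonneg)
  then have step: "h (pt e m) = of_real s * h (pt e (Suc m))" if "m < N" for m
    using that by (subst (asm) sum_nonneg_eq_0_iff) auto
  show ?thesis using n
  proof (induction n)
    case (Suc n)
    have "of_real s * h (pt e n) = of_real s * (of_real s * h (pt e (Suc n)))"
      using step[of n] Suc.prems by simp
    also have "\<dots> = h (pt e (Suc n))" using s by auto
    finally have "h (pt e (Suc n)) = of_real s * h (pt e n)" by simp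
    also have "h (pt e n) = of_real s ^ n * h (pt e 0)" using Suc by simp
    finally show ?case by simp
  qed simp
qed


section \<open>Waves along edges and the Kirchhoff condition\<close>

definition edge_waves ::
  "real \<Rightarrow> ('v point \<Rightarrow> complex) \<Rightarrow> ('v set \<Rightarrow> complex) \<Rightarrow> ('v set \<Rightarrow> complex) \<Rightarrow> bool" where
  "edge_waves \<theta> h A B \<longleftrightarrow>
    (\<forall>e\<in>edges G. \<forall>n\<le>N. h (pt e n) = A e * cis (real n * \<theta>) + B e * cis (- (real n * \<theta>)))"

text \<open>For a wave of frequency t with amplitudes \<open>A\<close>, \<open>B\<close> on an edge
  of length 1 this is the derivative at \<open>v\<close> into the edge, divided by i t. Without that
  factor it depends on t only through \<open>cis\<close>, so it is unchanged when t moves by a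
  multiple of 2 pi.\<close>

definition flux ::
  "real \<Rightarrow> ('v set \<Rightarrow> complex) \<Rightarrow> ('v set \<Rightarrow> complex) \<Rightarrow> 'v \<Rightarrow> 'v set \<Rightarrow> complex" where
  "flux t A B v e = (if v = tail G e then A e - B e else - (A e * cis t - B e * cis (- t)))"

text \<open>An exact discrete form of the first order expansion into the edge. Summed over the edges
  at \<open>v\<close>, it shows that the eigenvalue equation at \<open>v\<close> is the Kirchhoff
  condition as soon as the sine does not vanish.\<close>

lemma edge_waves_nbr:
  assumes W: "edge_waves \<theta> h A B" and e: "e \<in> edges G" "v \<in> e"
  shows "h (nbr v e) = cos \<theta> * h (Vertex v) + \<i> * sin \<theta> * flux (real N * \<theta>) A B v e"
proof (cases "v = tail G e")
  case True
  have "h (Vertex v) = A e + B e"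
    using W e N_pos unfolding edge_waves_def True pt_0[symmetric] by auto
  moreover have "h (nbr v e) = A e * cis \<theta> + B e * cis (- \<theta>)"
    using W e N_pos by (auto simp: edge_waves_def True nbr_def)
  ultimately show ?thesis
    using True by (simp add: flux_def complex_eq_iff cos_of_real sin_of_real algebra_simps)
next
  case False
  with e have v: "v = head G e" by (simp add: mem_edge_iff)
  have "h (Vertex v) = A e * cis (real N * \<theta>) + B e * cis (- (real N * \<theta>))"
    using W e N_pos unfolding edge_waves_def v pt_N[symmetric] by auto
  moreover have "h (nbr v e) = A e * (cis (real N * \<theta>) * cis (-\<theta>)) + B e * (cis (- (real N * \<theta>)) * cis \<theta>)"
    using W e N_pos False by (simp add: edge_waves_def nbr_def cis_mult of_nat_diff algebra_simps)
  moreover have "cis \<theta> = cos \<theta> + \<i> * sin \<theta>" "cis (-\<theta>) = cos \<theta> - \<i> * sin \<theta>"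
    by (auto simp: complex_eq_iff)
  ultimately show ?thesis
    using False by (simp add: flux_def cos_of_real sin_of_real algebra_simps)
qed

lemma edge_waves_sum_nbrs_vertex:
  assumes W: "edge_waves \<theta> h A B" and v: "v \<in> verts G"
  shows "(\<Sum>q | ref_adj G N (Vertex v) q. h q) = of_real (cos \<theta>) * of_nat (ref_degree G N (Vertex v)) * h (Vertex v)
    + \<i> * of_real (sin \<theta>) * (\<Sum>e | e \<in> edges G \<and> v \<in> e. flux (real N * \<theta>) A B v e)"
proof -
  have "(\<Sum>q | ref_adj G N (Vertex v) q. h q) = (\<Sum>e | e \<in> edges G \<and> v \<in> e. 
      of_real (cos \<theta>) * h (Vertex v) + \<i> * of_real (sin \<theta>) * flux (real N * \<theta>) A B v e)"
    unfolding sum_nbrs_vertex[OF v]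
    by (intro sum.cong) (use edge_waves_nbr[OF W] in \<open>auto simp: cos_of_real sin_of_real\<close>)
  then show ?thesis
    by (simp add: sum.distrib sum_distrib_left ref_degree_vertex[OF v] vdegree_def)
qed

lemma edge_waves_eigenspace:
  assumes W: "edge_waves \<theta> h A B" and h: "h \<in> HN G N"
    and K: "\<And>v. v \<in> verts G \<Longrightarrow> (\<Sum>e | e \<in> edges G \<and> v \<in> e. flux (real N * \<theta>) A B v e) = 0"
  shows "h \<in> eigenspace_N G N (of_real ((real N)\<^sup>2 * (1 - cos \<theta>)))"
proof -
  have "(\<Sum>q | ref_adj G N p q. h q) = of_real (cos \<theta>) * of_nat (ref_degree G N p) * h p"
    if p: "p \<in> ref_verts G N" for p
  proof -
    consider v where "v \<in> verts G" "p = Vertex v" 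
      | e n where "e \<in> edges G" "0 < n" "n < N" "p = pt e n"
      using p by (auto simp: ref_verts_eq)
    then show ?thesis
    proof cases
      case 1
      then show ?thesis using edge_waves_sum_nbrs_vertex[OF W, of v] K by simp
    next
      case 2
      have "real (n - 1) * \<theta> = real n * \<theta> - \<theta>" "real (Suc n) * \<theta> = real n * \<theta> + \<theta>"
        using 2 by (simp_all add: of_nat_diff algebra_simps)
      with 2 W show ?thesis
        using wave_step[of "A e" "real n * \<theta>" \<theta> "B e"]
        by (simp add: sum_nbrs_inner ref_degree_inner edge_waves_def del: of_nat_Suc)
    qed
  qed
  moreover have "1 - of_real ((real N)\<^sup>2 * (1 - cos \<theta>)) / (of_nat N)\<^sup>2 = complex_of_real (cos \<theta>)"
    using N_ne by (simp add: field_simps)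
  ultimately show ?thesis unfolding eigenspace_N_iff using h by simp
qed

text \<open>For \<open>\<theta> < pi\<close> the first two values on an edge determine the
  amplitudes, the recurrence carries the formula along the edge, and the equation at a vertex can be
  divided by the sine to give the Kirchhoff condition. For \<open>\<theta> = pi\<close> the sine
  vanishes and the Kirchhoff condition has to be arranged by the choice of amplitudes.\<close>

lemma edge_waves_exist:
  fixes h :: "'v point \<Rightarrow> complex"
  assumes h: "\<And>p. p \<in> ref_verts G N \<Longrightarrow>
      (\<Sum>q | ref_adj G N p q. h q) = of_real (cos \<theta>) * of_nat (ref_degree G N p) * h p"
    and \<theta>: "0 < \<theta>" "\<theta> \<le> pi"
  obtains A B where "edge_waves \<theta> h A B"
    "\<And>v. v \<in> verts G \<Longrightarrow> (\<Sum>e | e \<in> edges G \<and> v \<in> e. flux (real N * \<theta>) A B v e) = 0"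
proof (cases "\<theta> = pi")
  case True
  \<comment> \<open>Any splitting of \<open>h (pt e 0)\<close> into two amplitudes represents the
    alternating function on the grid. The equal splitting, a cosine, makes the flux zero at both
    ends of every edge.\<close>
  define A where "A e = h (pt e 0) / 2" for e
  have cis: "cis (- (real n * pi)) = cis (real n * pi)" "cis (real n * pi) = (-1) ^ n" for n
    using DeMoivre[of pi n] by (simp_all add: complex_eq_iff)
  have alt: "h (pt e n) = (-1) ^ n * h (pt e 0)" if "e \<in> edges G" "n \<le> N" for e n
    using eigenfunction_extreme[of h "-1" e n] h that by (simp add: True)
  have "edge_waves \<theta> h A A"
    unfolding edge_waves_def True cis A_def
    by (intro ballI allI impI, rule trans[OF alt]) simp_all
  moreover have "flux (real N * \<theta>) A A v e = 0" for v e
    unfolding flux_def True cis by simp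
  ultimately show ?thesis using that by simp
next
  case False
  with \<theta> have sin: "sin \<theta> \<noteq> 0" using sin_gt_zero[of \<theta>] by simp
  have "\<exists>a b. x = a + b \<and> y = a * cis \<theta> + b * cis (- \<theta>)" for x y
  proof -
    \<comment> \<open>Here d is the difference a - b of the amplitudes, while x is their
      sum.\<close>
    define d where "d = (y - of_real (cos \<theta>) * x) / (\<i> * of_real (sin \<theta>))"
    have d: "y = of_real (cos \<theta>) * x + \<i> * of_real (sin \<theta>) * d" using sin by (simp add: d_def)
    have "y = (x + d) / 2 * cis \<theta> + (x - d) / 2 * cis (- \<theta>)"
      unfolding d by (simp add: complex_eq_iff algebra_simps add_divide_distrib diff_divide_distrib)
    moreover have "x = (x + d) / 2 + (x - d) / 2" by (simp add: field_simps)
    ultimately show ?thesis by blast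
  qed
  then have "\<exists>ab. h (pt e 0) = fst ab + snd ab \<and> h (pt e 1) = fst ab * cis \<theta> + snd ab * cis (- \<theta>)" for e
    by (metis fst_conv snd_conv)
  then obtain ab where ab: "\<And>e. h (pt e 0) = fst (ab e) + snd (ab e)"
    "\<And>e. h (pt e 1) = fst (ab e) * cis \<theta> + snd (ab e) * cis (- \<theta>)" by metis
  define A B where "A e = fst (ab e)" and "B e = snd (ab e)" for e
  have "h (pt e n) = A e * cis (real n * \<theta>) + B e * cis (- (real n * \<theta>))" if e: "e \<in> edges G" "n \<le> N" for e n
    using e(2)
  proof (induction n rule: less_induct)
    case (less n)
    consider "n = 0" | "n = 1" | m where "n = Suc (Suc m)" by (metis One_nat_def not0_implies_Suc)
    then show ?case
    proof cases
      case 3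
      have m: "h (pt e m) + h (pt e (Suc (Suc m))) = 2 * of_real (cos \<theta>) * h (pt e (Suc m))"
        using h[OF pt_in_ref_verts[OF e(1), of "Suc m"]] less.prems 3 e(1)
        by (simp add: sum_nbrs_inner ref_degree_inner)
      have "h (pt e n) = 2 * of_real (cos \<theta>) * h (pt e (Suc m)) - h (pt e m)"
        using m 3 by (simp add: algebra_simps)
      also have "\<dots> = A e * cis (real n * \<theta>) + B e * cis (- (real n * \<theta>))"
      proof -
        define X where "X = real (Suc m) * \<theta>"
        have X: "real m * \<theta> = X - \<theta>" "real n * \<theta> = X + \<theta>"
          using 3 by (simp_all add: X_def algebra_simps)
        have hm: "h (pt e m) = A e * cis (X - \<theta>) + B e * cis (- (X - \<theta>))"
          using less.IH[of m] less.prems 3 unfolding X by simp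
        have hSm: "h (pt e (Suc m)) = A e * cis X + B e * cis (- X)"
          unfolding X_def using less.IH[of "Suc m"] less.prems 3 by simp
        show ?thesis unfolding hm hSm X wave_step[symmetric] by simp
      qed
      finally show ?thesis .
    qed (use ab in \<open>simp_all add: A_def B_def\<close>)
  qed
  then have W: "edge_waves \<theta> h A B" by (simp add: edge_waves_def)
  moreover have "(\<Sum>e | e \<in> edges G \<and> v \<in> e. flux (real N * \<theta>) A B v e) = 0" if "v \<in> verts G" for v
    using edge_waves_sum_nbrs_vertex[OF W that] h[of "Vertex v"] that sin
    by (auto simp: ref_verts_def)
  ultimately show ?thesis using that by blast
qed

end

section \<open>Absolutely continuous functions\<close>

lemma abs_continuous_on_subset:
  "abs_continuous_on S f \<Longrightarrow> T \<subseteq> S \<Longrightarrow> abs_continuous_on T f"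
  unfolding abs_continuous_on_def by (meson order_trans)

lemma abs_continuous_on_lipschitz:
  fixes f :: "real \<Rightarrow> complex"
  assumes "\<And>x y. x \<in> S \<Longrightarrow> y \<in> S \<Longrightarrow> x \<le> y \<Longrightarrow> norm (f y - f x) \<le> C * (y - x)"
  shows "abs_continuous_on S f"
  unfolding abs_continuous_on_def
proof (intro allI impI)
  fix \<epsilon> :: real assume \<epsilon>: "0 < \<epsilon>"
  define C' where "C' = \<bar>C\<bar> + 1"
  show "\<exists>\<delta>>0. \<forall>D T. D division_of T \<longrightarrow> T \<subseteq> S \<longrightarrow> (\<Sum>J\<in>D. Sup J - Inf J) < \<delta> \<longrightarrow>
        (\<Sum>J\<in>D. norm (f (Sup J) - f (Inf J))) < \<epsilon>"
  proof (intro exI[of _ "\<epsilon> / C'"] conjI allI impI)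
    show "0 < \<epsilon> / C'" using \<epsilon> by (simp add: C'_def)
    fix D T assume D: "D division_of T" "T \<subseteq> S" "(\<Sum>J\<in>D. Sup J - Inf J) < \<epsilon> / C'"
    have "(\<Sum>J\<in>D. norm (f (Sup J) - f (Inf J))) \<le> (\<Sum>J\<in>D. C' * (Sup J - Inf J))"
    proof (rule sum_mono)
      fix J assume J: "J \<in> D"
      with D(1) obtain a b where ab: "J = cbox a b" "J \<noteq> {}" "J \<subseteq> T" by (metis division_ofD(2-4))
      then have "a \<le> b" "a \<in> S" "b \<in> S" using D(2) by auto
      then have "norm (f b - f a) \<le> C * (b - a)" using assms by blast
      also have "\<dots> \<le> C' * (b - a)"
        using \<open>a \<le> b\<close> by (intro mult_right_mono) (auto simp: C'_def)
      finally show "norm (f (Sup J) - f (Inf J)) \<le> C' * (Sup J - Inf J)"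
        using ab \<open>a \<le> b\<close> by simp
    qed
    also have "\<dots> = C' * (\<Sum>J\<in>D. Sup J - Inf J)" by (simp add: sum_distrib_left)
    also have "\<dots> < C' * (\<epsilon> / C')"
      using D(3) by (intro mult_strict_left_mono) (auto simp: C'_def)
    also have "\<dots> = \<epsilon>" by (simp add: C'_def)
    finally show "(\<Sum>J\<in>D. norm (f (Sup J) - f (Inf J))) < \<epsilon>" .
  qed
qed

text \<open>Cousin's lemma: intervals tagged outside the exceptional null set contribute little by the
  vanishing derivative, those tagged inside it by absolute continuity, since their total length
  is small.\<close>

lemma abs_continuous_on_derivative_zero:
  fixes f :: "real \<Rightarrow> complex"
  assumes ab: "a \<le> b" and ac: "abs_continuous_on {a..b} f"
    and deriv: "AE x in lebesgue. x \<in> {a..b} \<longrightarrow> (f has_vector_derivative 0) (at x within {a..b})"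
  shows "f b = f a"
proof -
  have "norm (f b - f a) \<le> \<epsilon>" if pos: "\<epsilon> > 0" for \<epsilon>
  proof -
    \<comment> \<open>The slope permitted outside the null set, chosen to cost at most half of
      \<epsilon> over the whole interval; the summand 1 covers a = b.\<close>
    define \<eta> where "\<eta> = \<epsilon> / 2 / (b - a + 1)"
    have \<eta>: "\<eta> > 0" using pos ab by (simp add: \<eta>_def)
    have "\<eta> * (b - a) \<le> \<eta> * (b - a + 1)" using \<eta> by (intro mult_left_mono) auto
    also have "\<dots> = \<epsilon> / 2" using ab unfolding \<eta>_def by (intro nonzero_eq_divide_eq[THEN iffD1]) auto
    finally have \<eta>le: "\<eta> * (b - a) \<le> \<epsilon> / 2" .
    obtain \<delta> where \<delta>: "\<delta> > 0" "\<And>D T. D division_of T \<Longrightarrow> T \<subseteq> {a..b} \<Longrightarrow> (\<Sum>J\<in>D. Sup J - Inf J) < \<delta> \<Longrightarrow>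
        (\<Sum>J\<in>D. norm (f (Sup J) - f (Inf J))) < \<epsilon> / 2"
      using ac[unfolded abs_continuous_on_def, rule_format, OF half_gt_zero[OF pos]]
      by (elim exE conjE) blast
    obtain N where N: "N \<in> null_sets lebesgue"
      "\<And>x. x \<in> {a..b} \<Longrightarrow> x \<notin> N \<Longrightarrow> (f has_vector_derivative 0) (at x within {a..b})"
    proof -
      from AE_E3[OF deriv] obtain N where N: "N \<in> null_sets lebesgue"
        "\<And>x. x \<in> space lebesgue - N \<Longrightarrow> x \<in> {a..b} \<longrightarrow> (f has_vector_derivative 0) (at x within {a..b})"
        by blast
      have "space lebesgue = (UNIV :: real set)" by simp
      with N show thesis by (intro that[of N]) auto
    qed
    obtain U where U: "open U" "N \<subseteq> U" "U - N \<in> lmeasurable" "emeasure lebesgue (U - N) < ennreal \<delta>"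
      using sets_lebesgue_outer_open[of N \<delta>] N(1) \<delta>(1) by auto
    have Um: "U \<in> lmeasurable" 
      by (metis U(1-3) N(1) fmeasurable.Un Diff_partition fmeasurableI_null_sets)
    have "emeasure lebesgue U = emeasure lebesgue (U - N)"
      using emeasure_Diff_null_set[OF N(1), of U] Um by (simp add: fmeasurableD)
    then have Ud: "measure lebesgue U < \<delta>"
      using U(4) by (metis Um emeasure_eq_measure2 ennreal_less_iff measure_nonneg)
    \<comment> \<open>One radius for each kind of tag: inside the null set the ball must stay in the
      small open set U, outside it the vanishing derivative must bound the slope by \<eta>.\<close>
    have "\<exists>d>0. (x \<in> N \<longrightarrow> ball x d \<subseteq> U) \<and>
        (x \<notin> N \<longrightarrow> (\<forall>y\<in>{a..b}. dist x y < d \<longrightarrow> norm (f y - f x) \<le> \<eta> * \<bar>y - x\<bar>))"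
      if x: "x \<in> {a..b}" for x
    proof (cases "x \<in> N")
      case True
      then show ?thesis using U(1,2) by (auto simp: open_contains_ball)
    next
      case False
      then have "(f has_derivative (\<lambda>_. 0)) (at x within {a..b})"
        using N(2)[OF x] by (simp add: has_vector_derivative_def)
      then show ?thesis using False \<eta>
        unfolding has_derivative_within_alt
        by (auto simp: dist_commute dist_norm abs_minus_commute)
    qed
    then obtain r where r: "\<And>x. x \<in> {a..b} \<Longrightarrow> r x > 0"
      "\<And>x. x \<in> {a..b} \<Longrightarrow> x \<in> N \<Longrightarrow> ball x (r x) \<subseteq> U"
      "\<And>x y. x \<in> {a..b} \<Longrightarrow> x \<notin> N \<Longrightarrow> y \<in> {a..b} \<Longrightarrow> dist x y < r x \<Longrightarrow> norm (f y - f x) \<le> \<eta> * \<bar>y - x\<bar>"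
      by metis
    define g where "g x = ball x (if x \<in> {a..b} then r x else 1)" for x
    have "gauge g" unfolding g_def by (rule gauge_ball_dependent) (use r(1) in auto)
    then obtain p where p: "p tagged_division_of {a..b}" "g fine p" by (rule fine_division_exists_real)
    note pD = tagged_division_ofD[OF p(1)]
    have K: "\<exists>u v. K = cbox u v \<and> u \<le> x \<and> x \<le> v \<and> u \<in> {a..b} \<and> v \<in> {a..b} \<and> x \<in> {a..b} \<and>
        dist x u < r x \<and> dist x v < r x \<and> K \<subseteq> ball x (r x)"
      if xK: "(x, K) \<in> p" for x K
    proof -
      obtain u v where uv: "K = cbox u v" using pD(4)[OF xK] by blast
      have xK': "x \<in> K" "K \<subseteq> {a..b}" using pD(2,3)[OF xK] by auto
      then have x: "x \<in> {a..b}" by blast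
      have "K \<subseteq> g x" using p(2) xK by (auto simp: fine_def)
      then have ball: "K \<subseteq> ball x (r x)" by (simp only: g_def x if_True)
      have "u \<in> K" "v \<in> K" "u \<le> x" "x \<le> v" using \<open>x \<in> K\<close> by (auto simp: uv)
      moreover from this have "dist x u < r x" "dist x v < r x" "u \<in> {a..b}" "v \<in> {a..b}"
        using ball xK'(2) by (auto simp: subset_iff)
      ultimately show ?thesis using uv x ball by blast
    qed
    define q where "q = {(x, K) \<in> p. x \<in> N}"
    have "q \<subseteq> p" by (auto simp: q_def)
    have fin: "finite p" using pD by simp
    have "f b - f a = (\<Sum>(x, K)\<in>p. f (Sup K) - f (Inf K))"
      by (rule additive_tagged_division_1[OF ab p(1), symmetric])
    also have "\<dots> = (\<Sum>(x, K)\<in>p - q. f (Sup K) - f (Inf K)) + (\<Sum>(x, K)\<in>q. f (Sup K) - f (Inf K))"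
      using fin \<open>q \<subseteq> p\<close> by (rule sum.subset_diff[rotated])
    finally have split: "norm (f b - f a) \<le>
        norm (\<Sum>(x, K)\<in>p - q. f (Sup K) - f (Inf K)) + norm (\<Sum>(x, K)\<in>q. f (Sup K) - f (Inf K))"
      by (simp add: norm_triangle_ineq)
    have "norm (\<Sum>(x, K)\<in>p - q. f (Sup K) - f (Inf K)) \<le> (\<Sum>(x, K)\<in>p - q. \<eta> * measure lborel K)"
    proof (rule sum_norm_le, clarify)
      fix x K assume xK: "(x, K) \<in> p" "(x, K) \<notin> q"
      then have "x \<notin> N" by (auto simp: q_def)
      obtain u v where uv: "K = cbox u v" "u \<le> x" "x \<le> v" "u \<in> {a..b}" "v \<in> {a..b}" "x \<in> {a..b}"
        "dist x u < r x" "dist x v < r x" using K[OF xK(1)] by blast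
      have "norm (f v - f u) \<le> norm (f v - f x) + norm (f u - f x)"
        by (metis norm_diff_triangle_le norm_minus_commute order_refl)
      also have "\<dots> \<le> \<eta> * \<bar>v - x\<bar> + \<eta> * \<bar>u - x\<bar>"
        by (intro add_mono r(3)[OF uv(6) \<open>x \<notin> N\<close>] uv)
      also have "\<dots> = \<eta> * (v - u)" using uv by (simp add: algebra_simps)
      finally show "norm (f (Sup K) - f (Inf K)) \<le> \<eta> * measure lborel K" using uv by simp
    qed
    also have "\<dots> \<le> (\<Sum>(x, K)\<in>p. \<eta> * measure lborel K)"
      using fin \<eta> by (intro sum_mono2) auto
    also have "\<dots> = \<eta> * (b - a)"
      using additive_content_tagged_division[of p a b] p(1) ab
      by (simp add: case_prod_unfold sum_distrib_left[symmetric])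
    finally have 1: "norm (\<Sum>(x, K)\<in>p - q. f (Sup K) - f (Inf K)) \<le> \<epsilon> / 2" using \<eta>le by simp
    have qt: "q tagged_division_of \<Union>(snd ` q)"
      using tagged_partial_division_of_Union_self[of q "{a..b}"]
        tagged_partial_division_subset[of p "{a..b}" q] p(1) \<open>q \<subseteq> p\<close>
      by (auto simp: tagged_division_of_def)
    then have qd: "snd ` q division_of \<Union>(snd ` q)" by (rule division_of_tagged_division)
    have "\<Union>(snd ` q) \<subseteq> {a..b}" using pD(3) \<open>q \<subseteq> p\<close> by force
    have len: "Sup J - Inf J = measure lborel J" if "J \<in> snd ` q" for J
      using that K \<open>q \<subseteq> p\<close> by fastforce
    have "(\<Sum>J\<in>snd ` q. Sup J - Inf J) = (\<Sum>J\<in>snd ` q. measure lborel J)"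
      using len by (rule sum.cong[OF refl])
    also have "\<dots> = measure lebesgue (\<Union>(snd ` q))"
      unfolding content_division[OF qd, symmetric]
    proof (rule sum.cong[OF refl])
      fix J assume "J \<in> snd ` q"
      then obtain u v where "J = cbox u v" using division_ofD(4)[OF qd] by blast
      then show "measure lborel J = measure lebesgue J" by simp
    qed
    also have "\<dots> \<le> measure lebesgue U"
    proof (rule measure_mono_fmeasurable[OF _ _ Um])
      have "J \<subseteq> U" if "(x, J) \<in> q" for x J
      proof -
        have "(x, J) \<in> p" "x \<in> N" using that by (auto simp: q_def)
        with K[of x J] r(2)[of x] show ?thesis by blast
      qed
      then show "\<Union>(snd ` q) \<subseteq> U" by fastforce
      show "\<Union>(snd ` q) \<in> sets lebesgue" using qd lmeasurable_division fmeasurableD by blast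
    qed
    also note Ud
    finally have "(\<Sum>J\<in>snd ` q. norm (f (Sup J) - f (Inf J))) < \<epsilon> / 2"
      using \<delta>(2)[OF qd \<open>\<Union>(snd ` q) \<subseteq> {a..b}\<close>] by simp
    moreover have "(\<Sum>(x, K)\<in>q. norm (f (Sup K) - f (Inf K))) = (\<Sum>J\<in>snd ` q. norm (f (Sup J) - f (Inf J)))"
    proof -
      \<comment> \<open>Absolute continuity speaks of intervals, and different tags may carry the
        same degenerate interval. The passage from tags to intervals requires a summand that
        vanishes on all intervals without interior; the guard ensures this for the empty one, where
        \<open>Sup\<close> and \<open>Inf\<close> tell nothing.\<close>
      have "(\<Sum>(x, K)\<in>q. norm (f (Sup K) - f (Inf K))) = (\<Sum>(x, K)\<in>q. if K = {} then 0 else norm (f (Sup K) - f (Inf K)))"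
        using K \<open>q \<subseteq> p\<close> by (intro sum.cong) force+
      also have "\<dots> = (\<Sum>K\<in>snd ` q. if K = {} then 0 else norm (f (Sup K) - f (Inf K)))"
        by (rule sum.over_tagged_division_lemma[OF qt]) (auto simp: box_eq_empty)
      also have "\<dots> = (\<Sum>J\<in>snd ` q. norm (f (Sup J) - f (Inf J)))"
        using K \<open>q \<subseteq> p\<close> by (intro sum.cong) force+
      finally show ?thesis .
    qed
    moreover have "norm (\<Sum>(x, K)\<in>q. f (Sup K) - f (Inf K)) \<le> (\<Sum>(x, K)\<in>q. norm (f (Sup K) - f (Inf K)))"
      by (rule sum_norm_le) auto
    ultimately show ?thesis using 1 split by linarith
  qed
  then have "norm (f b - f a) \<le> 0" by (rule field_le_epsilon[of _ 0, simplified])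
  then show ?thesis by simp
qed

section \<open>Waves on the continuous graph\<close>

definition wave :: "real \<Rightarrow> complex \<Rightarrow> complex \<Rightarrow> real \<Rightarrow> complex" where
  "wave w a b x = a * cis (w * x) + b * cis (- (w * x))"

lemma wave_deriv:
  "(wave w a b has_vector_derivative wave w (\<i> * of_real w * a) (- (\<i> * of_real w * b)) x) (at x within S)"
proof -
  have "((\<lambda>z. a * exp (\<i> * of_real w * z) + b * exp (- (\<i> * of_real w * z))) has_field_derivative
     \<i> * of_real w * a * exp (\<i> * of_real w * of_real x) + - (\<i> * of_real w * b) * exp (- (\<i> * of_real w * of_real x)))
     (at (of_real x))"
    by (auto intro!: derivative_eq_intros simp: algebra_simps)
  from has_vector_derivative_real_field[OF this, of S] show ?thesis
    by (simp add: wave_def[abs_def] cis_conv_exp mult.assoc)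
qed

lemma continuous_on_wave: "continuous_on S (wave w a b)"
  using wave_deriv by (intro continuous_on_vector_derivative) blast

lemma norm_wave_le: "norm (wave w a b x) \<le> norm a + norm b"
  unfolding wave_def by (rule order_trans[OF norm_triangle_ineq]) (simp add: norm_mult)

lemma abs_continuous_on_wave: "abs_continuous_on {c..d} (wave w a b)"
proof (rule abs_continuous_on_lipschitz)
  fix x y assume xy: "x \<in> {c..d}" "y \<in> {c..d}" "x \<le> y"
  let ?C = "norm (\<i> * of_real w * a) + norm (- (\<i> * of_real w * b))"
  have "norm (wave w a b y - wave w a b x) \<le> ?C * norm (y - x)"
  proof (rule differentiable_bound[of "{c..d}"])
    fix t assume "t \<in> {c..d}"
    show "(wave w a b has_derivative (\<lambda>h. h *\<^sub>R wave w (\<i> * of_real w * a) (- (\<i> * of_real w * b)) t)) (at t within {c..d})"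
      using wave_deriv by (simp add: has_vector_derivative_def)
    show "onorm (\<lambda>h. h *\<^sub>R wave w (\<i> * of_real w * a) (- (\<i> * of_real w * b)) t) \<le> ?C"
    proof (rule onorm_le)
      fix h :: real
      show "norm (h *\<^sub>R wave w (\<i> * of_real w * a) (- (\<i> * of_real w * b)) t) \<le> ?C * norm h"
        using mult_left_mono[OF norm_wave_le abs_ge_zero, of h w "\<i> * of_real w * a" "- (\<i> * of_real w * b)" t]
        by (simp add: mult.commute)
    qed
  qed (use xy in auto)
  then show "norm (wave w a b y - wave w a b x) \<le> ?C * (y - x)" using xy by simp
qed

text \<open>The value at 0 gives a + b = 0 and the derivative at 0 gives a = b. This makes
  amplitudes unique, so that linear relations between waves pass to their amplitudes.\<close>

lemma wave_eq_0D:
  assumes w: "w \<noteq> 0" and eq: "\<And>x. x \<in> {0..1} \<Longrightarrow> wave w a b x = 0"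
  shows "a = 0" "b = 0"
proof -
  have "((\<lambda>_. 0) has_vector_derivative wave w (\<i> * of_real w * a) (- (\<i> * of_real w * b)) 0) (at 0 within cbox 0 1)"
    by (rule has_vector_derivative_transform[OF _ _ wave_deriv]) (use eq in auto)
  then have "wave w (\<i> * of_real w * a) (- (\<i> * of_real w * b)) 0 = 0"
    by (rule vector_derivative_unique_within_closed_interval[rotated 2]) auto
  then have "\<i> * of_real w * (a - b) = 0" by (simp add: wave_def algebra_simps)
  then have "a = b" using w by simp
  moreover have "a + b = 0" using eq[of 0] by (simp add: wave_def)
  ultimately show "a = 0" "b = 0" by auto
qed

lemma wave_sum: "wave w (\<Sum>j\<in>J. c j * a j) (\<Sum>j\<in>J. c j * b j) x = (\<Sum>j\<in>J. c j * wave w (a j) (b j) x)"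
  by (simp add: wave_def sum_distrib_left sum_distrib_right sum.distrib algebra_simps)

lemma L2_graph_continuous:
  assumes "\<And>e. e \<in> edges G \<Longrightarrow> continuous_on {0..1} (edge_fun G f e)"
  shows "L2_graph G f"
  unfolding L2_graph_def
proof (intro ballI conjI)
  fix e assume e: "e \<in> edges G"
  have "set_integrable lebesgue {0..1} (edge_fun G f e)"
    using absolutely_integrable_continuous_real[OF assms[OF e]] .
  then show "set_borel_measurable lebesgue {0..1} (edge_fun G f e)"
    unfolding set_integrable_def set_borel_measurable_def by (rule borel_measurable_integrable)
  show "set_integrable lebesgue {0..1} (\<lambda>x. (cmod (edge_fun G f e x))\<^sup>2)"
    by (intro absolutely_integrable_continuous_real continuous_intros assms[OF e])
qed

context refined_graph begin

lemma eigenspace_waves: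
  assumes F: "\<And>e x. e \<in> edges G \<Longrightarrow> x \<in> {0..1} \<Longrightarrow> edge_fun G F e x = wave w (A e) (B e) x"
    and K: "\<And>v. v \<in> verts G \<Longrightarrow> (\<Sum>e | e \<in> edges G \<and> v \<in> e. flux w A B v e) = 0"
  shows "F \<in> eigenspace G (w\<^sup>2)"
proof -
  define f' where "f' e = wave w (\<i> * of_real w * A e) (- (\<i> * of_real w * B e))" for e
  have cont: "continuous_on {0..1} (edge_fun G F e)" if "e \<in> edges G" for e
    using continuous_on_wave by (rule continuous_on_eq) (use F that in auto)
  have "L2_graph G F" using cont by (rule L2_graph_continuous)
  moreover have "L2_graph G (\<lambda>p. of_real (w\<^sup>2) * F p)"
    by (intro L2_graph_continuous continuous_intros cont)
  moreover have "(edge_fun G F e has_vector_derivative f' e x) (at x within {0..1})"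
    if "e \<in> edges G" "x \<in> {0..1}" for e x
    unfolding f'_def by (rule has_vector_derivative_transform[OF that(2) _ wave_deriv]) (use F that in auto)
  moreover have "abs_continuous_on {0..1} (f' e)" for e
    unfolding f'_def by (rule abs_continuous_on_wave)
  moreover have "(f' e has_vector_derivative - (of_real (w\<^sup>2) * edge_fun G F e x)) (at x within {0..1})"
    if "e \<in> edges G" "x \<in> {0..1}" for e x
  proof -
    have "wave w (\<i> * of_real w * (\<i> * of_real w * A e)) (- (\<i> * of_real w * (- (\<i> * of_real w * B e)))) x
      = - (of_real (w\<^sup>2) * edge_fun G F e x)"
      unfolding F[OF that] by (simp add: wave_def power2_eq_square algebra_simps)
    then show ?thesis unfolding f'_def by (metis wave_deriv)
  qed
  moreover have "(\<Sum>e | e \<in> edges G \<and> v \<in> e. if v = tail G e then f' e 0 else - f' e 1) = 0"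
    if "v \<in> verts G" for v
  proof -
    have "(\<Sum>e | e \<in> edges G \<and> v \<in> e. if v = tail G e then f' e 0 else - f' e 1) =
      (\<Sum>e | e \<in> edges G \<and> v \<in> e. \<i> * of_real w * flux w A B v e)"
      by (intro sum.cong) (auto simp: f'_def wave_def flux_def algebra_simps)
    then show ?thesis using K[OF that] by (simp add: sum_distrib_left[symmetric])
  qed
  ultimately have "is_laplacian G F (\<lambda>p. of_real (w\<^sup>2) * F p)"
    unfolding is_laplacian_def using cont by (intro conjI exI[of _ f'] ballI AE_I2 impI) auto
  then show ?thesis by (simp add: eigenspace_def)
qed

text \<open>The derivative that \<open>is_laplacian\<close> provides is that of the wave, by
  uniqueness of derivatives within the closed interval; its Kirchhoff sum is i w times the sum of
  the fluxes.\<close>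

lemma eigenspace_flux:
  assumes F: "\<And>e x. e \<in> edges G \<Longrightarrow> x \<in> {0..1} \<Longrightarrow> edge_fun G F e x = wave w (A e) (B e) x"
    and E: "F \<in> eigenspace G \<kappa>" and w: "w \<noteq> 0" and v: "v \<in> verts G"
  shows "(\<Sum>e | e \<in> edges G \<and> v \<in> e. flux w A B v e) = 0"
proof -
  obtain f' where f': "\<And>e x. e \<in> edges G \<Longrightarrow> x \<in> {0..1} \<Longrightarrow> (edge_fun G F e has_vector_derivative f' e x) (at x within {0..1})"
    "(\<Sum>e | e \<in> edges G \<and> v \<in> e. if v = tail G e then f' e 0 else - f' e 1) = 0"
    using E v unfolding eigenspace_def is_laplacian_def by blast
  have eq: "f' e x = wave w (\<i> * of_real w * A e) (- (\<i> * of_real w * B e)) x" if "e \<in> edges G" "x \<in> {0..1}" for e x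
  proof (rule vector_derivative_unique_within_closed_interval[of 0 1 x])
    show "(edge_fun G F e has_vector_derivative f' e x) (at x within cbox 0 1)" using f'(1)[OF that] by simp
    show "(edge_fun G F e has_vector_derivative wave w (\<i> * of_real w * A e) (- (\<i> * of_real w * B e)) x) (at x within cbox 0 1)"
      by (rule has_vector_derivative_transform[OF _ _ wave_deriv]) (use F that in auto)
  qed (use that in auto)
  have "(\<Sum>e | e \<in> edges G \<and> v \<in> e. if v = tail G e then f' e 0 else - f' e 1) =
      (\<Sum>e | e \<in> edges G \<and> v \<in> e. \<i> * of_real w * flux w A B v e)"
    by (intro sum.cong) (auto simp: eq wave_def flux_def algebra_simps)
  with f'(2) w show ?thesis by (simp add: sum_distrib_left[symmetric])
qed

text \<open>The derivative on each edge is absolutely continuous with derivative zero almost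
  everywhere, hence constant, so \<open>F\<close> is affine on edges. Summation by parts against
  \<open>F\<close>, with the Kirchhoff conditions, then forces all slopes to vanish.\<close>

lemma eigenspace_0_constant:
  assumes E: "F \<in> eigenspace G 0" and e: "e \<in> edges G" and x: "x \<in> {0..1}"
  shows "edge_fun G F e x = F (Vertex (tail G e))"
proof -
  obtain f' where f': "\<And>e x. e \<in> edges G \<Longrightarrow> x \<in> {0..1} \<Longrightarrow> (edge_fun G F e has_vector_derivative f' e x) (at x within {0..1})"
    "\<And>e. e \<in> edges G \<Longrightarrow> abs_continuous_on {0..1} (f' e)"
    "\<And>e. e \<in> edges G \<Longrightarrow> AE x in lebesgue. x \<in> {0..1} \<longrightarrow>
       (f' e has_vector_derivative - (of_real 0 * edge_fun G F e x)) (at x within {0..1})"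
    "\<And>v. v \<in> verts G \<Longrightarrow> (\<Sum>e | e \<in> edges G \<and> v \<in> e. if v = tail G e then f' e 0 else - f' e 1) = 0"
    using E unfolding eigenspace_def is_laplacian_def by blast
  have const: "f' e x = f' e 0" if e: "e \<in> edges G" and x: "x \<in> {0..1}" for e x
  proof (rule abs_continuous_on_derivative_zero)
    show "AE t in lebesgue. t \<in> {0..x} \<longrightarrow> (f' e has_vector_derivative 0) (at t within {0..x})"
      using f'(3)[OF e]
    proof eventually_elim
      case (elim t)
      then show ?case using x by (auto intro: has_vector_derivative_within_subset)
    qed
    show "abs_continuous_on {0..x} (f' e)"
      using f'(2)[OF e] by (rule abs_continuous_on_subset) (use x in auto)
  qed (use x in auto)
  have lin: "edge_fun G F e x = F (Vertex (tail G e)) + of_real x * f' e 0"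
    if e: "e \<in> edges G" and x: "x \<in> {0..1}" for e x
  proof -
    have "((\<lambda>x. edge_fun G F e x - of_real x * f' e 0) has_vector_derivative 0) (at x within {0..1})"
      if "x \<in> {0..1}" for x
    proof -
      have "((\<lambda>x. edge_fun G F e x - of_real x * f' e 0) has_vector_derivative f' e x - 1 * f' e 0) (at x within {0..1})"
        using has_vector_derivative_of_real[OF DERIV_ident]
        by (intro has_vector_derivative_diff has_vector_derivative_mult_left f'(1)[OF e that]) fastforce
      then show ?thesis using const[OF e that] by simp
    qed
    then obtain c where "\<And>x. x \<in> {0..1} \<Longrightarrow> edge_fun G F e x - of_real x * f' e 0 = c"
      using has_vector_derivative_zero_constant[of "{0..1}" "\<lambda>x. edge_fun G F e x - of_real x * f' e 0"]
      by blast
    from this[of 0] this[OF x] show ?thesis by (simp add: coord_def algebra_simps)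
  qed
  have head: "F (Vertex (head G e)) = F (Vertex (tail G e)) + f' e 0" if "e \<in> edges G" for e
    using lin[OF that, of 1] by (simp add: coord_def)
  \<comment> \<open>The Kirchhoff sums are paired with the conjugate of \<open>F\<close>. Regrouped
    by edges, each edge contributes its slope times the conjugate difference of its end values,
    which is again the slope.\<close>
  have "0 = (\<Sum>v\<in>verts G. \<Sum>e | e \<in> edges G \<and> v \<in> e.
      cnj (F (Vertex v)) * (if v = tail G e then f' e 0 else - f' e 1))"
    by (simp add: f'(4) sum_distrib_left[symmetric])
  also have "\<dots> = (\<Sum>e\<in>edges G. - (f' e 0 * cnj (f' e 0)))"
    unfolding sum_incidences using const[of _ 1] edgeD(2)[THEN not_sym]
    by (intro sum.cong) (auto simp: head algebra_simps)
  finally have "complex_of_real (\<Sum>e\<in>edges G. (cmod (f' e 0))\<^sup>2) = 0"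
    by (simp add: complex_norm_square sum_negf del: of_real_power)
  then have "(\<Sum>e\<in>edges G. (cmod (f' e 0))\<^sup>2) = 0" by (simp only: of_real_eq_0_iff)
  then have "f' e 0 = 0" using finite_edges e by (simp add: sum_nonneg_eq_0_iff)
  with lin[OF e x] show ?thesis by simp
qed

section \<open>Restriction to the grid and extension from it\<close>

lemma flux_0: "flux 0 A A v e = 0"
  by (simp add: flux_def)

lemma RN_pt: "e \<in> edges G \<Longrightarrow> n \<le> N \<Longrightarrow> RN G N F (pt e n) = edge_fun G F e (real n / real N)"
  using pt_in_ref_verts[of e n] by (simp add: RN_def grid_def)

lemma RN_HN: "RN G N F \<in> HN G N"
  by (simp add: RN_def HN_def)

lemma frac_01: "n \<le> N \<Longrightarrow> real n / real N \<in> {0..1}"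
  using N_pos by auto

lemma edge_waves_RN:
  assumes F: "\<And>e x. e \<in> edges G \<Longrightarrow> x \<in> {0..1} \<Longrightarrow> edge_fun G F e x = wave w (A e) (B e) x"
  shows "edge_waves (w / real N) (RN G N F) A B"
  unfolding edge_waves_def
proof (intro ballI allI impI)
  fix e n assume e: "e \<in> edges G" "n \<le> N"
  show "RN G N F (pt e n) = A e * cis (real n * (w / real N)) + B e * cis (- (real n * (w / real N)))"
    unfolding RN_pt[OF e] F[OF e(1) frac_01[OF e(2)]] wave_def by (simp add: mult.commute)
qed

lemma RN_eigenspace:
  assumes F: "\<And>e x. e \<in> edges G \<Longrightarrow> x \<in> {0..1} \<Longrightarrow> edge_fun G F e x = wave w (A e) (B e) x"
    and K: "\<And>v. v \<in> verts G \<Longrightarrow> (\<Sum>e | e \<in> edges G \<and> v \<in> e. flux w A B v e) = 0"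
  shows "RN G N F \<in> eigenspace_N G N (of_real ((real N)\<^sup>2 * (1 - cos (w / real N))))"
  by (rule edge_waves_eigenspace[OF edge_waves_RN[OF F] RN_HN]) (use K N_pos in auto)

lemma RN_eigenspace_0:
  assumes E: "F \<in> eigenspace G 0"
  shows "RN G N F \<in> eigenspace_N G N 0"
proof -
  let ?A = "\<lambda>e. F (Vertex (tail G e)) / 2"
  have "RN G N F \<in> eigenspace_N G N (of_real ((real N)\<^sup>2 * (1 - cos (0 / real N))))"
    by (rule RN_eigenspace[of _ 0 ?A ?A])
      (use eigenspace_0_constant[OF E] in \<open>auto simp: wave_def flux_0\<close>)
  then show ?thesis by simp
qed

text \<open>By \<open>sum_degree\<close> the discrete inner product is the trapezoidal rule, which
  is exact for functions constant on edges. So the restricted basis of E(0) is already orthonormal,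
  and the zero frequency needs no matrix B.\<close>

lemma inner_N_RN_eigenspace_0:
  assumes F: "F \<in> eigenspace G 0" and H: "H \<in> eigenspace G 0"
  shows "inner_N G N (RN G N F) (RN G N H) = inner_inf G F H"
proof -
  have I: "(LINT x:{0..1}|lebesgue. edge_fun G F e x * cnj (edge_fun G H e x)) =
    F (Vertex (tail G e)) * cnj (H (Vertex (tail G e)))" if e: "e \<in> edges G" for e
  proof -
    have "(LINT x:{0..1}|lebesgue. edge_fun G F e x * cnj (edge_fun G H e x)) =
      (LINT x:{0..1::real}|lebesgue. F (Vertex (tail G e)) * cnj (H (Vertex (tail G e))))"
      by (rule set_lebesgue_integral_cong)
        (use eigenspace_0_constant[OF F e] eigenspace_0_constant[OF H e] in auto)
    also have "\<dots> = F (Vertex (tail G e)) * cnj (H (Vertex (tail G e)))"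
      by (subst set_integral_const) auto
    finally show ?thesis .
  qed
  have "(\<Sum>p\<in>ref_verts G N. of_nat (ref_degree G N p) * (RN G N F p * cnj (RN G N H p))) =
    (\<Sum>e\<in>edges G. \<Sum>n<N. 2 * (F (Vertex (tail G e)) * cnj (H (Vertex (tail G e)))))"
    unfolding sum_degree
    by (intro sum.cong refl)
      (use eigenspace_0_constant[OF F] eigenspace_0_constant[OF H] frac_01 in \<open>auto simp: RN_pt\<close>)
  then show ?thesis using N_ne
    by (simp add: inner_N_def inner_inf_def I mult.assoc sum_distrib_left[symmetric])
qed

text \<open>At vertices the value is taken from \<open>h\<close> and not from an incident edge,
  which avoids a choice. Agreement of the waves with \<open>h\<close> at both ends of an edge then
  makes the extension continuous there.\<close>

definition wave_extension ::
  "('v point \<Rightarrow> complex) \<Rightarrow> real \<Rightarrow> ('v set \<Rightarrow> complex) \<Rightarrow> ('v set \<Rightarrow> complex) \<Rightarrow> 'v point \<Rightarrow> complex" where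
  "wave_extension h w A B p =
     (case p of Vertex v \<Rightarrow> h (Vertex v) | Inner e x \<Rightarrow> wave w (A e) (B e) x)"

lemma wave_extension:
  assumes "h (Vertex (tail G e)) = wave w (A e) (B e) 0" "h (Vertex (head G e)) = wave w (A e) (B e) 1"
  shows "edge_fun G (wave_extension h w A B) e x = wave w (A e) (B e) x"
  using assms by (simp add: wave_extension_def coord_def)

lemma coord_in_points: "e \<in> edges G \<Longrightarrow> x \<in> {0..1} \<Longrightarrow> coord G e x \<in> points G"
  using edgeD(4,5)[of e] by (auto simp: coord_def points_def)

lemma eigenfunction_0_extends:
  assumes h: "h \<in> eigenspace_N G N 0"
  obtains F where "F \<in> eigenspace G 0" "RN G N F = h"
proof -
  have const: "h (pt e n) = h (pt e 0)" if "e \<in> edges G" "n \<le> N" for e n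
    using eigenfunction_extreme[of h 1 e n] h that by (auto simp: eigenspace_N_iff)
  let ?A = "\<lambda>e. h (pt e 0) / 2"
  define F where "F = wave_extension h 0 ?A ?A"
  have F: "edge_fun G F e x = wave 0 (?A e) (?A e) x" if "e \<in> edges G" for e x
    unfolding F_def by (rule wave_extension)
      (use const[OF that, of N] in \<open>simp_all add: wave_def pt_0 pt_N\<close>)
  have "F \<in> eigenspace G (0\<^sup>2)"
    by (rule eigenspace_waves[of _ 0 ?A ?A]) (use F in \<open>auto simp: flux_0\<close>)
  moreover have "RN G N F p = h p" for p
  proof (cases "p \<in> ref_verts G N")
    case True
    then obtain e n where p: "e \<in> edges G" "n \<le> N" "p = pt e n" by (rule ref_vertsE)
    show ?thesis unfolding p(3) RN_pt[OF p(1,2)] F[OF p(1)] const[OF p(1,2)] by (simp add: wave_def)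
  next
    case False
    then show ?thesis using h by (auto simp: RN_def eigenspace_N_def HN_def)
  qed
  ultimately show ?thesis using that[of F] by auto
qed

end

section \<open>The inversion formula\<close>

lemma cos_inj_on_0_pi: "0 \<le> x \<Longrightarrow> x \<le> pi \<Longrightarrow> 0 \<le> y \<Longrightarrow> y \<le> pi \<Longrightarrow> cos x = cos y \<Longrightarrow> x = y"
  by (metis arccos_cos)

lemma cis_add_2pi: "cis (x + 2 * real m * pi) = cis x" "cis (- (x + 2 * real m * pi)) = cis (- x)"
proof -
  have "cis (2 * real m * pi) = 1"
    using cis_multiple_2pi[of "real m"] by (simp add: ac_simps)
  then show "cis (x + 2 * real m * pi) = cis x" by (simp add: cis_mult[symmetric])
  then show "cis (- (x + 2 * real m * pi)) = cis (- x)" by (metis cis_cnj)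
qed

lemma freq_shift:
  assumes "0 < w"
  obtains m :: nat and w' where "w = w' + 2 * real m * pi" "0 < w'" "w' \<le> 2 * pi"
proof -
  \<comment> \<open>Ceiling minus one rather than the floor: a multiple of 2 pi has to go to 2 pi,
    since 0 is not among the base frequencies.\<close>
  define m where "m = nat (\<lceil>w / (2 * pi)\<rceil> - 1)"
  have "1 \<le> \<lceil>w / (2 * pi)\<rceil>" using assms by simp
  then have m: "real m = of_int \<lceil>w / (2 * pi)\<rceil> - 1" by (simp add: m_def)
  have "w / (2 * pi) \<le> real m + 1" "real m < w / (2 * pi)" unfolding m by linarith+
  then have "w \<le> 2 * real m * pi + 2 * pi" "2 * real m * pi < w" by (auto simp: field_simps)
  then show ?thesis by (intro that[of "w - 2 * real m * pi" m]) auto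
qed

locale graph_modes = refined_graph G N
  for G :: "'v fgraph" and N :: nat +
  fixes K I0 :: nat and I :: "nat \<Rightarrow> nat" and \<omega> :: "nat \<Rightarrow> real"
    and \<Psi>0 :: "nat \<Rightarrow> 'v point \<Rightarrow> complex"
    and \<Psi> :: "nat \<Rightarrow> nat \<Rightarrow> nat \<Rightarrow> 'v point \<Rightarrow> complex"
    and A B :: "nat \<Rightarrow> nat \<Rightarrow> 'v set \<Rightarrow> complex"
  assumes \<omega>_mono: "strict_mono_on {..<K} \<omega>"
    and \<omega>_range: "\<omega> ` {..<K} = {w. 0 < w \<and> w \<le> 2 * pi \<and> is_eigenvalue G (w\<^sup>2)}"
    and basis0: "orthonormal_basis (points G) (inner_inf G) (eigenspace G 0) I0 \<Psi>0"
    and basis: "\<And>k. k < K \<Longrightarrow>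
      orthonormal_basis (points G) (inner_inf G) (eigenspace G ((\<omega> k)\<^sup>2)) (I k) (\<Psi> 0 k)"
    and exps: "\<And>m k j e x. k < K \<Longrightarrow> j < I k \<Longrightarrow> e \<in> edges G \<Longrightarrow> x \<in> {0..1} \<Longrightarrow>
      edge_fun G (\<Psi> m k j) e x =
        A k j e * exp (\<i> * of_real (freq \<omega> m k * x)) +
        B k j e * exp (- \<i> * of_real (freq \<omega> m k * x))"
begin

section \<open>Frequencies and the eigenvalues of the restricted modes\<close>

lemma \<omega>_bounds: "k < K \<Longrightarrow> 0 < \<omega> k \<and> \<omega> k \<le> 2 * pi"
  using \<omega>_range by blast

lemma freq_pos: "k < K \<Longrightarrow> 0 < freq \<omega> m k"
  using \<omega>_bounds[of k] by (simp add: freq_def add_pos_nonneg)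

lemma \<Psi>_wave:
  "k < K \<Longrightarrow> j < I k \<Longrightarrow> e \<in> edges G \<Longrightarrow> x \<in> {0..1} \<Longrightarrow>
    edge_fun G (\<Psi> m k j) e x = wave (freq \<omega> m k) (A k j e) (B k j e) x"
  using exps[of k j e x m] by (simp add: wave_def cis_conv_exp)

lemma flux_freq: "flux (freq \<omega> m k) a b v e = flux (\<omega> k) a b v e"
  by (simp only: flux_def freq_def cis_add_2pi)

text \<open>Membership in an eigenspace is given for m = 0. The amplitudes are the same for all m
  and the flux is 2 pi periodic in the frequency, so the Kirchhoff condition carries over to every
  m.\<close>

lemma \<Psi>_flux:
  assumes "k < K" "j < I k" "v \<in> verts G"
  shows "(\<Sum>e | e \<in> edges G \<and> v \<in> e. flux (freq \<omega> m k) (A k j) (B k j) v e) = 0"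
  unfolding flux_freq
  by (rule eigenspace_flux[of "\<Psi> 0 k j"])
    (use assms \<Psi>_wave[OF assms(1,2), where m = 0] basis[OF assms(1)] \<omega>_bounds[OF assms(1)] in
      \<open>auto simp: orthonormal_basis_def freq_def\<close>)

definition mode_value :: "nat \<Rightarrow> nat \<Rightarrow> real" where
  "mode_value m k = (real N)\<^sup>2 * (1 - cos (freq \<omega> m k / real N))"

lemma RN_\<Psi>_eigenspace:
  assumes "k < K" "j < I k"
  shows "RN G N (\<Psi> m k j) \<in> eigenspace_N G N (of_real (mode_value m k))"
  unfolding mode_value_def
  by (rule RN_eigenspace[OF \<Psi>_wave[OF assms] \<Psi>_flux[OF assms]])

lemma freq_div_bounds:
  assumes "k < K" "freq \<omega> m k \<le> real N * pi"
  shows "0 < freq \<omega> m k / real N" "freq \<omega> m k / real N \<le> pi"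
  using assms freq_pos[of k m] N_pos by (auto simp: field_simps)

lemma mode_value_pos:
  assumes "k < K" "freq \<omega> m k \<le> real N * pi"
  shows "0 < mode_value m k"
proof -
  have "cos (freq \<omega> m k / real N) \<noteq> cos 0"
    using cos_inj_on_0_pi[of "freq \<omega> m k / real N" 0] freq_div_bounds[OF assms] by auto
  then have "cos (freq \<omega> m k / real N) < 1" by (metis cos_le_one cos_zero less_eq_real_def)
  then show ?thesis using N_pos by (simp add: mode_value_def)
qed

text \<open>The intervals from 2 m pi (excluded) to 2 (m + 1) pi (included) are disjoint, so a
  frequency determines m, and then k by monotonicity.\<close>

lemma freq_inj:
  assumes "k < K" "k' < K" "freq \<omega> m k = freq \<omega> m' k'"
  shows "m = m' \<and> k = k'"
proof -
  have "2 * pi * real m + \<omega> k = 2 * pi * real m' + \<omega> k'" using assms by (simp add: freq_def algebra_simps)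
  moreover have "2 * pi * real m + 2 * pi \<le> 2 * pi * real m'" if "m < m'" for m m' :: nat
  proof -
    have "real m + 1 \<le> real m'" using that by simp
    then have "2 * pi * (real m + 1) \<le> 2 * pi * real m'" by (intro mult_left_mono) auto
    then show ?thesis by (simp add: algebra_simps)
  qed
  ultimately have "m = m'" using \<omega>_bounds[OF assms(1)] \<omega>_bounds[OF assms(2)]
    by (smt (verit) linorder_neqE_nat)
  then have "\<omega> k = \<omega> k'" using assms by (simp add: freq_def)
  then have "k = k'" using strict_mono_on_imp_inj_on[OF \<omega>_mono] assms by (auto dest: inj_onD)
  with \<open>m = m'\<close> show ?thesis by simp
qed

text \<open>The cutoff N pi keeps omega / N within [0, pi], where the cosine is injective. Different
  modes therefore belong to different discrete eigenvalues and are mutually orthogonal.\<close>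

lemma mode_value_inj:
  assumes "k < K" "freq \<omega> m k \<le> real N * pi" "k' < K" "freq \<omega> m' k' \<le> real N * pi"
    and "mode_value m k = mode_value m' k'"
  shows "m = m' \<and> k = k'"
proof -
  have "freq \<omega> m k / real N = freq \<omega> m' k' / real N"
  proof (rule cos_inj_on_0_pi)
    show "cos (freq \<omega> m k / real N) = cos (freq \<omega> m' k' / real N)"
      using assms(5) N_pos unfolding mode_value_def by simp
  qed (use freq_div_bounds[OF assms(1,2)] freq_div_bounds[OF assms(3,4)] in linarith)+
  then show ?thesis using N_pos freq_inj[OF assms(1,3)] by simp
qed

lemma eigenfunction_span:
  assumes h: "h \<in> eigenspace_N G N \<mu>" and nz: "h \<noteq> (\<lambda>_. 0)" and "\<mu> \<noteq> 0"
  obtains m k c where "k < K" "freq \<omega> m k \<le> real N * pi" "\<mu> = of_real (mode_value m k)"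
    "\<And>p. p \<in> ref_verts G N \<Longrightarrow> h p = (\<Sum>j<I k. c j * RN G N (\<Psi> m k j) p)"
proof -
  note H = h[unfolded eigenspace_N_iff]
  obtain p where p: "p \<in> ref_verts G N" "h p \<noteq> 0"
    using nz H unfolding HN_def fun_eq_iff by blast
  have adj: "(\<Sum>q | ref_adj G N p q. h q) = (1 - \<mu> / (of_nat N)\<^sup>2) * of_nat (ref_degree G N p) * h p"
    if "p \<in> ref_verts G N" for p using H that by blast
  obtain \<theta> where \<theta>: "0 \<le> \<theta>" "\<theta> \<le> pi" "1 - \<mu> / (of_nat N)\<^sup>2 = of_real (cos \<theta>)"
    using eigenvalue_cos[OF adj p] by blast
  have "\<theta> \<noteq> 0" using \<theta>(3) \<open>\<mu> \<noteq> 0\<close> N_ne by auto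
  then have \<theta>pos: "0 < \<theta>" using \<theta>(1) by simp
  obtain a b where W: "edge_waves \<theta> h a b"
    and K: "\<And>v. v \<in> verts G \<Longrightarrow> (\<Sum>e | e \<in> edges G \<and> v \<in> e. flux (real N * \<theta>) a b v e) = 0"
    using edge_waves_exist[OF adj[unfolded \<theta>(3)] \<theta>pos \<theta>(2)] by blast
  obtain m w where w: "real N * \<theta> = w + 2 * real m * pi" "0 < w" "w \<le> 2 * pi"
    using freq_shift[of "real N * \<theta>"] N_pos \<theta>pos by (metis mult_pos_pos of_nat_0_less_iff)
  have "\<mu> = (1 - of_real (cos \<theta>)) * (of_nat N)\<^sup>2"
    using \<theta>(3) N_ne by (simp add: field_simps)
  have cis: "cis (real N * \<theta>) = cis w" "cis (- (real N * \<theta>)) = cis (- w)"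
    unfolding w(1) by (rule cis_add_2pi)+
  define F where "F = wave_extension h w a b"
  have F: "edge_fun G F e x = wave w (a e) (b e) x" if "e \<in> edges G" for e x
    unfolding F_def
  proof (rule wave_extension)
    show "h (Vertex (tail G e)) = wave w (a e) (b e) 0"
      using W that unfolding pt_0[symmetric] edge_waves_def by (simp add: wave_def)
    show "h (Vertex (head G e)) = wave w (a e) (b e) 1"
      using W that unfolding pt_N[symmetric] edge_waves_def by (simp add: wave_def cis)
  qed
  have "F \<in> eigenspace G (w\<^sup>2)"
  proof (rule eigenspace_waves)
    fix v assume "v \<in> verts G"
    from K[OF this] show "(\<Sum>e | e \<in> edges G \<and> v \<in> e. flux w a b v e) = 0"
      unfolding flux_def cis .
  qed (use F in simp)
  moreover have "\<exists>p\<in>points G. F p \<noteq> 0"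
  proof (rule ccontr)
    assume "\<not> (\<exists>p\<in>points G. F p \<noteq> 0)"
    then have 0: "wave w (a e) (b e) x = 0" if "e \<in> edges G" "x \<in> {0..1}" for e x
      using F[OF that(1)] coord_in_points[OF that] by metis
    have "a e = 0 \<and> b e = 0" if "e \<in> edges G" for e
      using wave_eq_0D[of w "a e" "b e"] 0[OF that] w(2) by auto
    moreover obtain e n where "e \<in> edges G" "n \<le> N" "p = pt e n" using p(1) by (rule ref_vertsE)
    ultimately show False using p(2) W by (simp add: edge_waves_def)
  qed
  ultimately have "w \<in> \<omega> ` {..<K}" using \<omega>_range w by (auto simp: is_eigenvalue_def)
  then obtain k where k: "k < K" "w = \<omega> k" by auto
  then have fr: "freq \<omega> m k = real N * \<theta>" by (simp add: freq_def w(1))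
  obtain c where c: "\<And>p. p \<in> points G \<Longrightarrow> F p = (\<Sum>j<I k. c j * \<Psi> 0 k j p)"
    using basis[OF k(1)] \<open>F \<in> eigenspace G (w\<^sup>2)\<close> unfolding orthonormal_basis_def k(2) by metis
  \<comment> \<open>The expansion in the basis is known at the base frequency only. Read off on the
    amplitudes, it no longer mentions the frequency and can be evaluated at omega_{m,k}.\<close>
  have ab: "a e = (\<Sum>j<I k. c j * A k j e)" "b e = (\<Sum>j<I k. c j * B k j e)" if e: "e \<in> edges G" for e
  proof -
    have "wave w (a e - (\<Sum>j<I k. c j * A k j e)) (b e - (\<Sum>j<I k. c j * B k j e)) x = 0"
      if x: "x \<in> {0..1}" for x
    proof -
      have "wave w (a e) (b e) x = (\<Sum>j<I k. c j * edge_fun G (\<Psi> 0 k j) e x)"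
        using c[OF coord_in_points[OF e x]] F[OF e] by simp
      also have "\<dots> = wave w (\<Sum>j<I k. c j * A k j e) (\<Sum>j<I k. c j * B k j e) x"
        unfolding wave_sum by (intro sum.cong) (auto simp: \<Psi>_wave[OF k(1) _ e x] freq_def k(2))
      finally show ?thesis by (simp add: wave_def algebra_simps)
    qed
    from wave_eq_0D[OF _ this] w(2) show "a e = (\<Sum>j<I k. c j * A k j e)" "b e = (\<Sum>j<I k. c j * B k j e)" by auto
  qed
  show ?thesis
  proof (rule that[of k m c])
    show "freq \<omega> m k \<le> real N * pi" unfolding fr using \<theta>(2) by (intro mult_left_mono) auto
    show "\<mu> = of_real (mode_value m k)"
      unfolding mode_value_def fr using \<open>\<mu> = _\<close> N_pos by simp
    fix p assume "p \<in> ref_verts G N"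
    then obtain e n where e: "e \<in> edges G" "n \<le> N" "p = pt e n" by (rule ref_vertsE)
    have "h p = wave (freq \<omega> m k) (a e) (b e) (real n / real N)"
      using W e N_pos by (simp add: edge_waves_def wave_def fr mult.commute)
    also have "\<dots> = (\<Sum>j<I k. c j * RN G N (\<Psi> m k j) p)"
      unfolding ab[OF e(1)] wave_sum e(3)
      by (intro sum.cong) (auto simp: RN_pt[OF e(1,2)] \<Psi>_wave[OF k(1) _ e(1) frac_01[OF e(2)]])
    finally show "h p = (\<Sum>j<I k. c j * RN G N (\<Psi> m k j) p)" .
  qed (use k in simp)
qed

section \<open>Expansion of a function on the refined graph into modes\<close>

definition modes :: "(nat \<times> nat) set" where
  "modes = {(m, k). k < K \<and> freq \<omega> m k \<le> real N * pi}"

lemma finite_modes: "finite modes"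
proof (rule finite_subset)
  show "modes \<subseteq> {..N} \<times> {..<K}"
  proof (clarsimp simp: modes_def)
    fix m k assume "k < K" and *: "freq \<omega> m k \<le> real N * pi"
    have "2 * real m * pi = real m * pi + real m * pi" "0 \<le> real m * pi" by auto
    with * \<omega>_bounds[OF \<open>k < K\<close>] have "real m * pi \<le> real N * pi" unfolding freq_def by linarith
    then show "m \<le> N" by simp
  qed
qed simp

lemma sum_delta_cmult:
  fixes c :: "nat \<Rightarrow> 'b::semiring_1"
  assumes "i < n"
  shows "(\<Sum>j<n. c j * (if j = i then 1 else 0)) = c i"
proof -
  have "(\<Sum>j<n. c j * (if j = i then 1 else 0)) = (\<Sum>j<n. if j = i then c j else 0)"
    by (intro sum.cong) auto
  then show ?thesis using assms by simp
qed

text \<open>The remainder \<open>g\<close> left after subtracting the projections of \<open>f\<close> onto all modes is orthogonal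
  to every discrete eigenfunction.\<close>

lemma mode_expansion:
  assumes orth: "\<And>m k. (m, k) \<in> modes \<Longrightarrow>
      orthonormalizes G N (I k) (\<lambda>j. RN G N (\<Psi> m k j)) (d m k) (b m k)"
    and f: "f \<in> HN G N" and p: "p \<in> ref_verts G N"
  shows "f p = (\<Sum>j<I0. inner_N G N f (RN G N (\<Psi>0 j)) * RN G N (\<Psi>0 j) p) +
    (\<Sum>(m, k)\<in>modes. \<Sum>i<d m k. inner_N G N f (\<lambda>p. \<Sum>j<I k. b m k i j * RN G N (\<Psi> m k j) p) *
      (\<Sum>j<I k. b m k i j * RN G N (\<Psi> m k j) p))"
proof -
  define \<eta> where "\<eta> m k i p = (\<Sum>j<I k. b m k i j * RN G N (\<Psi> m k j) p)" for m k i p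
  define \<phi> where "\<phi> j = RN G N (\<Psi>0 j)" for j
  define P0 where "P0 p = (\<Sum>j<I0. inner_N G N f (\<phi> j) * \<phi> j p)" for p
  define P1 where "P1 p = (\<Sum>(m, k)\<in>modes. \<Sum>i<d m k. inner_N G N f (\<eta> m k i) * \<eta> m k i p)" for p
  define g where "g p = f p + (-1) * (P0 p + P1 p)" for p
  have E: "edges G \<noteq> {}" using p by (auto elim: ref_vertsE)
  have \<phi>E: "\<phi> j \<in> eigenspace_N G N 0" if "j < I0" for j
    using basis0 that unfolding \<phi>_def orthonormal_basis_def by (blast intro: RN_eigenspace_0)
  have \<eta>HN: "\<eta> m k i \<in> HN G N" for m k i
    by (simp add: \<eta>_def HN_def RN_def)
  have \<eta>E: "\<eta> m k i \<in> eigenspace_N G N (of_real (mode_value m k))" if "(m, k) \<in> modes" for m k i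
    unfolding eigenspace_N_iff
  proof (intro conjI ballI \<eta>HN)
    fix p assume p: "p \<in> ref_verts G N"
    have "(\<Sum>q | ref_adj G N p q. \<eta> m k i q) = (\<Sum>j<I k. b m k i j * (\<Sum>q | ref_adj G N p q. RN G N (\<Psi> m k j) q))"
      unfolding \<eta>_def by (subst sum.swap) (simp add: sum_distrib_left)
    also have "\<dots> = (\<Sum>j<I k. b m k i j * ((1 - of_real (mode_value m k) / (of_nat N)\<^sup>2) * of_nat (ref_degree G N p) * RN G N (\<Psi> m k j) p))"
      using RN_\<Psi>_eigenspace[of k _ m] that p unfolding eigenspace_N_iff
      by (intro sum.cong) (auto simp: modes_def)
    finally show "(\<Sum>q | ref_adj G N p q. \<eta> m k i q) = (1 - of_real (mode_value m k) / (of_nat N)\<^sup>2) * of_nat (ref_degree G N p) * \<eta> m k i p"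
      by (simp add: \<eta>_def sum_distrib_left ac_simps)
  qed
  have \<phi>\<phi>: "inner_N G N (\<phi> j) (\<phi> i) = (if j = i then 1 else 0)" if "i < I0" "j < I0" for i j
    using basis0 that unfolding \<phi>_def orthonormal_basis_def by (simp add: inner_N_RN_eigenspace_0)
  have \<eta>\<eta>: "inner_N G N (\<eta> m k j) (\<eta> m k i) = (if j = i then 1 else 0)"
    if "(m, k) \<in> modes" "i < d m k" "j < d m k" for m k i j
    using orth[OF that(1)] that unfolding \<eta>_def orthonormalizes_def orthonormal_basis_def by auto
  have \<eta>\<eta>': "inner_N G N (\<eta> m k j) (\<eta> m' k' i) = 0"
    if "(m, k) \<in> modes" "(m', k') \<in> modes" "(m, k) \<noteq> (m', k')" for m k m' k' i j
    using \<eta>E[OF that(1)] \<eta>E[OF that(2)]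
    by (rule eigenspaces_orthogonal) (use mode_value_inj that in \<open>auto simp: modes_def\<close>)
  have \<phi>\<eta>: "inner_N G N (\<phi> j) (\<eta> m k i) = 0" "inner_N G N (\<eta> m k i) (\<phi> j) = 0"
    if "j < I0" "(m, k) \<in> modes" for m k i j
    using eigenspaces_orthogonal[of "\<phi> j" 0 "\<eta> m k i" "mode_value m k"]
      eigenspaces_orthogonal[of "\<eta> m k i" "mode_value m k" "\<phi> j" 0]
      \<phi>E[OF that(1)] \<eta>E[OF that(2)] mode_value_pos[of k m] that by (auto simp: modes_def)
  have P0: "inner_N G N P0 h = (\<Sum>j<I0. inner_N G N f (\<phi> j) * inner_N G N (\<phi> j) h)" for h
    unfolding P0_def by (simp add: inner_N_sum_left inner_N_mult_left)
  have P1: "inner_N G N P1 h = (\<Sum>(m, k)\<in>modes. \<Sum>i<d m k. inner_N G N f (\<eta> m k i) * inner_N G N (\<eta> m k i) h)" for h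
    unfolding P1_def by (simp add: inner_N_sum_left inner_N_mult_left case_prod_unfold)
  have g: "inner_N G N g h = inner_N G N f h - (inner_N G N P0 h + inner_N G N P1 h)" for h
    unfolding g_def inner_N_add_left inner_N_mult_left by simp
  have g\<phi>: "inner_N G N g (\<phi> i) = 0" if i: "i < I0" for i
  proof -
    have "inner_N G N P1 (\<phi> i) = 0"
      unfolding P1 by (rule sum.neutral) (auto simp: \<phi>\<eta>[OF i])
    moreover have "inner_N G N P0 (\<phi> i) = (\<Sum>j<I0. inner_N G N f (\<phi> j) * (if j = i then 1 else 0))"
      unfolding P0 by (intro sum.cong refl arg_cong2[where f = "(*)"] \<phi>\<phi>[OF i]) simp
    then have "inner_N G N P0 (\<phi> i) = inner_N G N f (\<phi> i)" by (simp only: sum_delta_cmult[OF i])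
    ultimately show ?thesis by (simp only: g) simp
  qed
  have g\<eta>: "inner_N G N g (\<eta> m k i) = 0" if mk: "(m, k) \<in> modes" and i: "i < d m k" for m k i
  proof -
    have "inner_N G N P0 (\<eta> m k i) = 0"
      unfolding P0 by (rule sum.neutral) (auto simp: \<phi>\<eta> mk)
    moreover have "inner_N G N P1 (\<eta> m k i) = inner_N G N f (\<eta> m k i)"
    proof -
      have "inner_N G N P1 (\<eta> m k i) = 
        (\<Sum>mk\<in>modes. if mk = (m, k) then inner_N G N f (\<eta> m k i) else 0)"
        unfolding P1
      proof (intro sum.cong refl, clarify)
        fix m' k' assume mk': "(m', k') \<in> modes"
        show "(\<Sum>i'<d m' k'. inner_N G N f (\<eta> m' k' i') * inner_N G N (\<eta> m' k' i') (\<eta> m k i)) =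
          (if (m', k') = (m, k) then inner_N G N f (\<eta> m k i) else 0)"
        proof (cases "(m', k') = (m, k)")
          case True
          then have "(\<Sum>i'<d m' k'. inner_N G N f (\<eta> m' k' i') * inner_N G N (\<eta> m' k' i') (\<eta> m k i)) =
            (\<Sum>i'<d m k. inner_N G N f (\<eta> m k i') * (if i' = i then 1 else 0))"
            by (intro sum.cong) (auto simp: \<eta>\<eta>[OF mk i])
          with True show ?thesis by (simp add: sum_delta_cmult[OF i])
        next
          case False
          then show ?thesis using \<eta>\<eta>'[OF mk' mk False] by auto
        qed
      qed
      then show ?thesis using finite_modes mk by simp
    qed
    ultimately show ?thesis by (simp add: g)
  qed
  have "g = (\<lambda>_. 0)"
  proof (rule eigenfunctions_complete)
    have "\<phi> j \<in> HN G N" for j by (simp add: \<phi>_def RN_HN)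
    then show "g \<in> HN G N" using f \<eta>HN unfolding HN_def g_def P0_def P1_def
      by (auto intro!: sum.neutral)
    fix \<mu> h assume h: "h \<in> eigenspace_N G N \<mu>"
    consider "h = (\<lambda>_. 0)" | "\<mu> = 0" | "h \<noteq> (\<lambda>_. 0)" "\<mu> \<noteq> 0" by blast
    then show "inner_N G N g h = 0"
    proof cases
      case 1
      then show ?thesis by (simp add: inner_N_def)
    next
      case 2
      with h obtain F where F: "F \<in> eigenspace G 0" "RN G N F = h" using eigenfunction_0_extends by blast
      then obtain c where c: "\<forall>p\<in>points G. F p = (\<Sum>j<I0. c j * \<Psi>0 j p)"
        using basis0 unfolding orthonormal_basis_def by blast
      have "h p = (\<Sum>j<I0. c j * \<phi> j p)" for p
      proof (cases "p \<in> ref_verts G N")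
        case True
        then obtain e n where e: "e \<in> edges G" "n \<le> N" "p = pt e n" by (rule ref_vertsE)
        then have "p \<in> points G" using coord_in_points[OF e(1) frac_01] by (simp add: grid_def)
        with c True show ?thesis by (simp add: F(2)[symmetric] RN_def \<phi>_def)
      qed (simp add: F(2)[symmetric] RN_def \<phi>_def)
      then have "h = (\<lambda>p. \<Sum>j<I0. c j * \<phi> j p)" by blast
      then show ?thesis by (simp add: inner_N_sum_right inner_N_mult_right g\<phi>)
    next
      case 3
      obtain m k c where mk: "k < K" "freq \<omega> m k \<le> real N * pi" "\<mu> = of_real (mode_value m k)"
        "\<And>p. p \<in> ref_verts G N \<Longrightarrow> h p = (\<Sum>j<I k. c j * RN G N (\<Psi> m k j) p)"
        using eigenfunction_span[OF h 3] by blast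
      then have mode: "(m, k) \<in> modes" by (simp add: modes_def)
      \<comment> \<open>\<open>orthonormalizes\<close> asserts only that the family lies in some
        eigenspace. As \<open>h\<close> is nonzero, some member of the family is nonzero at a point,
        and comparing the two eigenvalue equations there identifies that eigenspace with the one of
        \<open>h\<close>.\<close>
      obtain \<nu> where \<nu>: "\<And>j. j < I k \<Longrightarrow> RN G N (\<Psi> m k j) \<in> eigenspace_N G N \<nu>"
        "orthonormal_basis (ref_verts G N) (inner_N G N) (eigenspace_N G N \<nu>) (d m k) (\<eta> m k)"
        using orth[OF mode] unfolding orthonormalizes_def \<eta>_def[abs_def] by blast
      obtain p where p: "p \<in> ref_verts G N" "h p \<noteq> 0"
        using 3 h unfolding eigenspace_N_def HN_def fun_eq_iff by blast
      then obtain j where j: "j < I k" "RN G N (\<Psi> m k j) p \<noteq> 0"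
        using mk(4)[OF p(1)] by (metis (no_types, lifting) lessThan_iff mult_zero_right sum.neutral)
      have "\<mu> * RN G N (\<Psi> m k j) p = \<nu> * RN G N (\<Psi> m k j) p"
        using \<nu>(1)[OF j(1)] RN_\<Psi>_eigenspace[OF mk(1) j(1), of m] p(1)
        unfolding mk(3) eigenspace_N_def by fastforce
      then have "\<mu> = \<nu>" using j(2) by simp
      with h \<nu>(2) obtain c where c: "\<forall>p\<in>ref_verts G N. h p = (\<Sum>i<d m k. c i * \<eta> m k i p)"
        unfolding orthonormal_basis_def by blast
      have "inner_N G N g h = inner_N G N g (\<lambda>p. \<Sum>i<d m k. c i * \<eta> m k i p)"
        by (rule inner_N_cong) (use c in auto)
      also have "\<dots> = 0" by (simp add: inner_N_sum_right inner_N_mult_right g\<eta>[OF mode])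
      finally show ?thesis .
    qed
  qed (rule E)
  then have "g p = 0" by simp
  moreover have "f p = g p + (P0 p + P1 p)" by (simp add: g_def)
  ultimately have "f p = P0 p + P1 p" by simp
  then show ?thesis unfolding P0_def P1_def \<phi>_def \<eta>_def[abs_def] .
qed

lemma \<Psi>0_constant:
  assumes "j < I0" "e \<in> edges G" "x \<in> {0..1}"
  shows "\<Psi>0 j (coord G e x) = \<Psi>0 j (Vertex (tail G e))"
  using basis0 assms unfolding orthonormal_basis_def by (blast intro: eigenspace_0_constant)

text \<open>A row of B occurs twice in the projection: conjugated in the inner product with the
  basis vector, and unconjugated in the vector itself. Summing over rows leaves the entries
  \<open>adjoint_mult\<close>, whatever the number of rows.\<close>

lemma inversion_formula:
  assumes orth: "\<And>m k. k < K \<Longrightarrow> freq \<omega> m k \<le> real N * pi \<Longrightarrow>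
      orthonormalizes G N (I k) (\<lambda>j. RN G N (\<Psi> m k j)) (d m k) (b m k)"
    and f: "f \<in> HN G N" and e: "e \<in> edges G" and n: "n \<le> N"
  shows "f (coord G e (real n / real N)) =
    (\<Sum>j<I0. DFT G N \<Psi>0 \<Psi> f (Zero j) * \<Psi>0 j (Vertex (tail G e))) +
    (\<Sum>(m, k)\<in>modes. \<Sum>l<I k.
      (\<Sum>j<I k. adjoint_mult (d m k) (b m k) j l * DFT G N \<Psi>0 \<Psi> f (Mode m k j)) *
      wave (freq \<omega> m k) (A k l e) (B k l e) (real n / real N))"
proof -
  have "f (pt e n) = (\<Sum>j<I0. inner_N G N f (RN G N (\<Psi>0 j)) * RN G N (\<Psi>0 j) (pt e n)) +
    (\<Sum>(m, k)\<in>modes. \<Sum>i<d m k. inner_N G N f (\<lambda>p. \<Sum>j<I k. b m k i j * RN G N (\<Psi> m k j) p) *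
      (\<Sum>j<I k. b m k i j * RN G N (\<Psi> m k j) (pt e n)))"
    by (rule mode_expansion[OF orth f pt_in_ref_verts[OF e n]]) (auto simp: modes_def)
  also have "(\<Sum>j<I0. inner_N G N f (RN G N (\<Psi>0 j)) * RN G N (\<Psi>0 j) (pt e n)) =
    (\<Sum>j<I0. DFT G N \<Psi>0 \<Psi> f (Zero j) * \<Psi>0 j (Vertex (tail G e)))"
    using \<Psi>0_constant[OF _ e frac_01[OF n]] by (simp add: DFT_def RN_pt[OF e n])
  also have "(\<Sum>(m, k)\<in>modes. \<Sum>i<d m k. inner_N G N f (\<lambda>p. \<Sum>j<I k. b m k i j * RN G N (\<Psi> m k j) p) *
      (\<Sum>j<I k. b m k i j * RN G N (\<Psi> m k j) (pt e n))) =
    (\<Sum>(m, k)\<in>modes. \<Sum>l<I k.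
      (\<Sum>j<I k. adjoint_mult (d m k) (b m k) j l * DFT G N \<Psi>0 \<Psi> f (Mode m k j)) *
      wave (freq \<omega> m k) (A k l e) (B k l e) (real n / real N))"
  proof (intro sum.cong refl, clarify)
    fix m k assume mk: "(m, k) \<in> modes"
    let ?F = "\<lambda>j. DFT G N \<Psi>0 \<Psi> f (Mode m k j)"
    let ?W = "\<lambda>l. wave (freq \<omega> m k) (A k l e) (B k l e) (real n / real N)"
    have "(\<Sum>i<d m k. inner_N G N f (\<lambda>p. \<Sum>j<I k. b m k i j * RN G N (\<Psi> m k j) p) *
        (\<Sum>j<I k. b m k i j * RN G N (\<Psi> m k j) (pt e n))) =
      (\<Sum>i<d m k. (\<Sum>j<I k. cnj (b m k i j) * ?F j) * (\<Sum>l<I k. b m k i l * ?W l))"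
      using mk \<Psi>_wave[OF _ _ e frac_01[OF n]]
      by (intro sum.cong refl arg_cong2[where f = "(*)"])
        (auto simp: inner_N_sum_right inner_N_mult_right DFT_def RN_pt[OF e n] modes_def)
    also have "\<dots> = (\<Sum>i<d m k. \<Sum>l<I k. \<Sum>j<I k. cnj (b m k i j) * b m k i l * ?F j * ?W l)"
      by (simp add: sum_product) (subst sum.swap, simp add: ac_simps)
    also have "\<dots> = (\<Sum>l<I k. \<Sum>j<I k. \<Sum>i<d m k. cnj (b m k i j) * b m k i l * ?F j * ?W l)"
      by (rule trans[OF sum.swap]) (intro sum.cong refl sum.swap)
    also have "\<dots> = (\<Sum>l<I k. (\<Sum>j<I k. adjoint_mult (d m k) (b m k) j l * ?F j) * ?W l)"
      by (simp add: adjoint_mult_def sum_distrib_right)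
    finally show "(\<Sum>i<d m k. inner_N G N f (\<lambda>p. \<Sum>j<I k. b m k i j * RN G N (\<Psi> m k j) p) *
        (\<Sum>j<I k. b m k i j * RN G N (\<Psi> m k j) (pt e n))) =
      (\<Sum>l<I k. (\<Sum>j<I k. adjoint_mult (d m k) (b m k) j l * ?F j) * ?W l)" .
  qed
  finally show ?thesis by (simp add: grid_def)
qed

end

section \<open>The fast Fourier transform\<close>

lemma sum_even_odd:
  fixes f :: "nat \<Rightarrow> 'a::comm_monoid_add"
  shows "(\<Sum>m<2 * n. f m) = (\<Sum>m<n. f (2 * m)) + (\<Sum>m<n. f (2 * m + 1))"
  by (induction n) (simp_all add: ac_simps)

text \<open>For \<sigma> = 1 or -1 a primitive root of unity of order 2 ^ s, the sign selecting one
  of the two exponentials of a wave. The exponent is written so that it is i \<sigma> pi for s = 1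
  and is halved when s increases by one, as in the program.\<close>

definition root_of_unity :: "real \<Rightarrow> nat \<Rightarrow> complex" where
  "root_of_unity \<sigma> s = exp (\<i> * of_real (\<sigma> * pi) * 2 / 2 ^ s)"

lemma root_of_unity_Suc_square: "root_of_unity \<sigma> (Suc s) ^ 2 = root_of_unity \<sigma> s"
  by (simp add: root_of_unity_def exp_of_nat_mult[symmetric] mult.commute)

lemma root_of_unity_power: "root_of_unity \<sigma> s ^ (2 ^ s) = exp (2 * \<i> * of_real (\<sigma> * pi))"
  by (simp add: root_of_unity_def exp_of_nat_mult[symmetric] ac_simps)

lemma root_of_unity_half_power: "root_of_unity \<sigma> (Suc s) ^ (2 ^ s) = exp (\<i> * of_real (\<sigma> * pi))"
  by (simp add: root_of_unity_def exp_of_nat_mult[symmetric] ac_simps)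

text \<open>Stage \<open>s\<close> of the autosorting (Stockham) fast Fourier transform of length \<open>2 ^ p\<close>: entry
  \<open>t * 2 ^ (p - s) + j\<close> is the \<open>t\<close>-th entry of the transform of the subsequence of \<open>a\<close> of length
  \<open>2 ^ s\<close> starting at \<open>j\<close> with step \<open>2 ^ (p - s)\<close>.  No bit reversal is needed.\<close>

definition fft_stage :: "real \<Rightarrow> nat \<Rightarrow> (nat \<Rightarrow> complex) \<Rightarrow> nat \<Rightarrow> nat \<Rightarrow> complex" where
  "fft_stage \<sigma> p a s i = (\<Sum>m<2 ^ s. a (i mod 2 ^ (p - s) + 2 ^ (p - s) * m) *
     root_of_unity \<sigma> s ^ (m * (i div 2 ^ (p - s))))"

lemma fft_stage_0: "i < 2 ^ p \<Longrightarrow> fft_stage \<sigma> p a 0 i = a i"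
  by (simp add: fft_stage_def)

lemma fft_stage_last: "fft_stage \<sigma> p a p i = (\<Sum>m<2 ^ p. a m * root_of_unity \<sigma> p ^ (m * i))"
  by (simp add: fft_stage_def)

text \<open>The radix 2 butterfly. Terms with even and odd summation index form two transforms of
  half the length, found side by side at stage s in a block of length 2 r. The outputs t and t + 2 ^
  s lie half an array apart and differ only in the sign of the twiddle factor, because the new root
  to the power 2 ^ s is -1.\<close>

lemma fft_stage_Suc:
  fixes v s p :: nat
  assumes s: "s < p" and v: "v < 2 ^ (p - 1)" and \<sigma>: "\<sigma> = 1 \<or> \<sigma> = - 1"
  defines "r \<equiv> 2 ^ (p - Suc s)"
  defines "t \<equiv> v div r"
  shows "fft_stage \<sigma> p a (Suc s) v = fft_stage \<sigma> p a s (v + t * r) +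
      root_of_unity \<sigma> (Suc s) ^ t * fft_stage \<sigma> p a s (v + t * r + r)"
    and "fft_stage \<sigma> p a (Suc s) (v + 2 ^ (p - 1)) = fft_stage \<sigma> p a s (v + t * r) -
      root_of_unity \<sigma> (Suc s) ^ t * fft_stage \<sigma> p a s (v + t * r + r)"
proof -
  define j where "j = v mod r"
  have r: "r > 0" by (simp add: r_def)
  have r2: "2 ^ (p - s) = 2 * r"
    using s by (simp add: r_def power_Suc[symmetric] Suc_diff_Suc del: power_Suc)
  have vj: "v = t * r + j" by (simp add: t_def j_def)
  have j: "j < r" using r by (simp add: j_def)
  have half: "2 ^ (p - 1) = 2 ^ s * r"
    using s by (simp add: r_def power_add[symmetric])
  have i1: "(v + t * r) mod (2 * r) = j" "(v + t * r) div (2 * r) = t"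
  proof -
    have "v + t * r = j + t * (2 * r)" by (simp add: vj)
    then show "(v + t * r) mod (2 * r) = j" "(v + t * r) div (2 * r) = t"
      using j r by (simp_all only: mod_mult_self1 div_mult_self1) auto
  qed
  have i2: "(v + t * r + r) mod (2 * r) = j + r" "(v + t * r + r) div (2 * r) = t"
  proof -
    have "v + t * r + r = (j + r) + t * (2 * r)" by (simp add: vj)
    then show "(v + t * r + r) mod (2 * r) = j + r" "(v + t * r + r) div (2 * r) = t"
      using j r by (simp_all only: mod_mult_self1 div_mult_self1) auto
  qed
  have i3: "(v + 2 ^ (p - 1)) mod r = j" "(v + 2 ^ (p - 1)) div r = t + 2 ^ s"
    using r unfolding half by (simp_all add: t_def j_def)
  have \<sigma>1: "exp (\<i> * of_real (\<sigma> * pi)) = -1" using \<sigma> by (auto simp: exp_minus)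
  let ?z = "root_of_unity \<sigma> s" and ?\<rho> = "root_of_unity \<sigma> (Suc s)"
  have zs: "?z ^ (2 ^ s) = 1"
  proof -
    have "?z ^ (2 ^ s) = exp (\<i> * of_real (\<sigma> * pi)) ^ 2"
      by (simp only: root_of_unity_power power2_eq_square exp_add[symmetric]) (simp add: algebra_simps)
    then show ?thesis unfolding \<sigma>1 by simp
  qed
  have \<rho>s: "?\<rho> ^ (2 ^ s) = -1" unfolding root_of_unity_half_power by (rule \<sigma>1)
  have \<rho>2: "?\<rho> ^ (2 * n) = ?z ^ n" for n
    by (simp add: power_mult root_of_unity_Suc_square)
  have S1: "fft_stage \<sigma> p a s (v + t * r) = (\<Sum>m<2 ^ s. a (j + 2 * r * m) * ?z ^ (m * t))"
    unfolding fft_stage_def r2 i1 ..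
  have S2: "fft_stage \<sigma> p a s (v + t * r + r) = (\<Sum>m<2 ^ s. a (j + r + 2 * r * m) * ?z ^ (m * t))"
    unfolding fft_stage_def r2 i2 ..
  have S: "fft_stage \<sigma> p a (Suc s) i = (\<Sum>m<2 ^ s. a (j + 2 * r * m) * ?z ^ (m * u)) +
      ?\<rho> ^ u * (\<Sum>m<2 ^ s. a (j + r + 2 * r * m) * ?z ^ (m * u))"
    if i: "i mod r = j" "i div r = u" for i u
  proof -
    have "fft_stage \<sigma> p a (Suc s) i = (\<Sum>m<2 * 2 ^ s. a (j + r * m) * ?\<rho> ^ (m * u))"
      unfolding fft_stage_def i[unfolded r_def] by (simp add: r_def)
    also have "\<dots> = (\<Sum>m<2 ^ s. a (j + 2 * r * m) * ?z ^ (m * u)) +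
        (\<Sum>m<2 ^ s. ?\<rho> ^ u * (a (j + r + 2 * r * m) * ?z ^ (m * u)))"
      unfolding sum_even_odd
      by (intro arg_cong2[where f = "(+)"] sum.cong)
        (auto simp: \<rho>2[symmetric] power_add[symmetric] algebra_simps)
    finally show ?thesis by (simp add: sum_distrib_left)
  qed
  show "fft_stage \<sigma> p a (Suc s) v = fft_stage \<sigma> p a s (v + t * r) +
      root_of_unity \<sigma> (Suc s) ^ t * fft_stage \<sigma> p a s (v + t * r + r)"
    unfolding S1 S2 by (rule S) (simp_all add: j_def t_def)
  have "?z ^ (m * (t + 2 ^ s)) = ?z ^ (m * t)" for m
    by (simp add: add_mult_distrib2 power_add power_mult mult.commute[of m "2 ^ s"] zs)
  moreover have "?\<rho> ^ (t + 2 ^ s) = - (?\<rho> ^ t)" by (simp add: power_add \<rho>s)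
  ultimately show "fft_stage \<sigma> p a (Suc s) (v + 2 ^ (p - 1)) = fft_stage \<sigma> p a s (v + t * r) -
      root_of_unity \<sigma> (Suc s) ^ t * fft_stage \<sigma> p a s (v + t * r + r)"
    unfolding S1 S2 S[OF i3] by simp
qed

section \<open>The program\<close>

primrec written_arrays :: "'a com \<Rightarrow> 'a set" where
  "written_arrays (RConst r n) = {}"
| "written_arrays (RAdd r p q) = {}"
| "written_arrays (RSub r p q) = {}"
| "written_arrays (CConst x z) = {fst x}"
| "written_arrays (CCopy x y) = {fst x}"
| "written_arrays (CAdd x y z) = {fst x}"
| "written_arrays (CSub x y z) = {fst x}"
| "written_arrays (CMul x y z) = {fst x}"
| "written_arrays (CExp x y) = {fst x}"
| "written_arrays (Seq c1 c2) = written_arrays c1 \<union> written_arrays c2"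
| "written_arrays (IfLess p q c1 c2) = written_arrays c1 \<union> written_arrays c2"
| "written_arrays (Loop r c) = written_arrays c"

primrec written_regs :: "'a com \<Rightarrow> nat set" where
  "written_regs (RConst r n) = {r}"
| "written_regs (RAdd r p q) = {r}"
| "written_regs (RSub r p q) = {r}"
| "written_regs (CConst x z) = {}"
| "written_regs (CCopy x y) = {}"
| "written_regs (CAdd x y z) = {}"
| "written_regs (CSub x y z) = {}"
| "written_regs (CMul x y z) = {}"
| "written_regs (CExp x y) = {}"
| "written_regs (Seq c1 c2) = written_regs c1 \<union> written_regs c2"
| "written_regs (IfLess p q c1 c2) = written_regs c1 \<union> written_regs c2"
| "written_regs (Loop r c) = written_regs c"

text \<open>The frame condition that every run satisfies. With \<open>runs_frame\<close>, a
  specification states only what a command establishes, and the rest follows from its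
  syntax.\<close>

definition same_outside :: "'a com \<Rightarrow> 'a state \<Rightarrow> 'a state \<Rightarrow> bool" where
  "same_outside c s s' \<longleftrightarrow> (\<forall>a. a \<notin> written_arrays c \<longrightarrow> arr s' a = arr s a) \<and>
     (\<forall>r. r \<notin> written_regs c \<longrightarrow> reg s' r = reg s r)"

lemma loop_induct:
  assumes "Inv 0 t0 s"
    and "\<And>i t s'. i < n \<Longrightarrow> Inv i t s' \<Longrightarrow> Inv (Suc i) (t + 1 + fst (exec c s')) (snd (exec c s'))"
  shows "case ((\<lambda>(t, s1). let (t', s2) = exec c s1 in (t + 1 + t', s2)) ^^ n) (t0, s) of (t, s') \<Rightarrow> Inv n t s'"
  using assms(2)
proof (induction n)
  case (Suc n)
  obtain t s' where ts: "((\<lambda>(t, s1). let (t', s2) = exec c s1 in (t + 1 + t', s2)) ^^ n) (t0, s) = (t, s')"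
    by fastforce
  with Suc have "Inv n t s'" by (metis (no_types, lifting) case_prod_conv less_Suc_eq)
  then show ?case using Suc.prems[of n t s'] ts by (simp add: case_prod_unfold Let_def)
qed (use assms in simp)

lemma exec_same_outside: "same_outside c s (snd (exec c s))"
proof (induction c arbitrary: s)
  case (Seq c1 c2)
  then show ?case by (simp add: same_outside_def case_prod_unfold Let_def)
next
  case (IfLess p q c1 c2)
  then show ?case by (simp add: same_outside_def case_prod_unfold Let_def)
next
  case (Loop r c)
  have "case ((\<lambda>(t, s1). let (t', s2) = exec c s1 in (t + 1 + t', s2)) ^^ reg s r) (1, s) of (t, s') \<Rightarrow>
     same_outside c s s'"
    by (rule loop_induct[where Inv = "\<lambda>_ _. same_outside c s"]) (use Loop in \<open>auto simp: same_outside_def\<close>)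
  then show ?case by (simp add: same_outside_def case_prod_unfold)
qed (auto simp: same_outside_def set_reg_def set_cell_def)

text \<open>A Hoare triple with an upper bound on the time, for a single initial state. The
  postcondition may therefore refer to the initial contents of registers and arrays.\<close>

definition runs :: "'a com \<Rightarrow> 'a state \<Rightarrow> nat \<Rightarrow> ('a state \<Rightarrow> bool) \<Rightarrow> bool" where
  "runs c s t Q \<longleftrightarrow> fst (exec c s) \<le> t \<and> Q (snd (exec c s))"

lemma runs_mono: "runs c s t Q \<Longrightarrow> t \<le> t' \<Longrightarrow> (\<And>s'. Q s' \<Longrightarrow> Q' s') \<Longrightarrow> runs c s t' Q'"
  by (auto simp: runs_def)

lemma runs_frame:
  "runs c s t Q \<Longrightarrow> t \<le> t' \<Longrightarrow> (\<And>s'. same_outside c s s' \<Longrightarrow> Q s' \<Longrightarrow> Q' s') \<Longrightarrow> runs c s t' Q'"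
  using exec_same_outside by (auto simp: runs_def)

lemma runs_Seq:
  assumes "runs c1 s t1 M" "\<And>s'. M s' \<Longrightarrow> runs c2 s' t2 Q" "t1 + t2 \<le> t"
  shows "runs (Seq c1 c2) s t Q"
proof -
  have "runs c2 (snd (exec c1 s)) t2 Q" using assms by (auto simp: runs_def)
  then show ?thesis using assms(1,3)
    by (auto simp: runs_def case_prod_unfold Let_def intro: order_trans[OF add_mono])
qed

lemma runs_IfLess:
  assumes "reg s p < reg s q \<Longrightarrow> runs c1 s t Q" "\<not> reg s p < reg s q \<Longrightarrow> runs c2 s t Q"
  shows "runs (IfLess p q c1 c2) s (Suc t) Q"
  using assms by (auto simp: runs_def case_prod_unfold Let_def)

lemma runs_Loop:
  assumes "Inv 0 s" "reg s r = n"
    and step: "\<And>i s'. i < n \<Longrightarrow> Inv i s' \<Longrightarrow> runs c s' t (Inv (Suc i))"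
    and "Suc (n * Suc t) \<le> T"
  shows "runs (Loop r c) s T (Inv n)"
proof -
  have step': "fst (exec c s') \<le> t" "Inv (Suc i) (snd (exec c s'))" if "i < n" "Inv i s'" for i s'
    using step[OF that] by (auto simp: runs_def)
  have "case ((\<lambda>(t, s1). let (t', s2) = exec c s1 in (t + 1 + t', s2)) ^^ n) (1, s) of (t', s') \<Rightarrow>
     t' \<le> Suc (n * Suc t) \<and> Inv n s'"
    by (rule loop_induct[where Inv = "\<lambda>i t' s'. t' \<le> Suc (i * Suc t) \<and> Inv i s'"])
      (use assms(1) step' in \<open>fastforce+\<close>)
  then show ?thesis using assms(2,4) by (auto simp: runs_def)
qed

lemmas basic_exec = runs_def set_reg_def set_cell_def get_cell_def Let_def case_prod_unfold


text \<open>An instruction of cost one that overwrites the scratch register 16, in place of an empty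
  command. Register 16 hence appears among the registers written by every conditional and sequence
  using it.\<close>

abbreviation skip :: "'a com" where "skip \<equiv> RConst 16 0"

definition seqs :: "'a com list \<Rightarrow> 'a com" where
  "seqs cs = foldr Seq cs skip"

text \<open>A loop rule for commands unrolled into the program text: the invariant is indexed by the
  prefix already executed. The closing \<open>skip\<close> accounts for the summand 1 and for the
  premise about register 16.\<close>

lemma runs_seqs:
  assumes "Inv [] s"
    and "\<And>ys y zs s'. xs = ys @ y # zs \<Longrightarrow> Inv ys s' \<Longrightarrow> runs (f y) s' t (Inv (ys @ [y]))"
    and "\<And>s'. Inv xs s' \<Longrightarrow> Inv xs (set_reg 16 0 s')"
  shows "runs (seqs (map f xs)) s (length xs * t + 1) (Inv xs)"
proof -
  have "runs (seqs (map f zs)) s' (length zs * t + 1) (Inv xs)" if "xs = ys @ zs" "Inv ys s'" for ys zs s'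
    using that
  proof (induction zs arbitrary: ys s')
    case Nil
    then show ?case using assms(3) by (simp add: seqs_def runs_def)
  next
    case (Cons z zs)
    have "seqs (map f (z # zs)) = Seq (f z) (seqs (map f zs))" by (simp add: seqs_def)
    moreover have "runs (Seq (f z) (seqs (map f zs))) s' (length (z # zs) * t + 1) (Inv xs)"
    proof (rule runs_Seq)
      show "runs (f z) s' t (Inv (ys @ [z]))" by (rule assms(2)) (use Cons.prems in auto)
      show "runs (seqs (map f zs)) s'' (length zs * t + 1) (Inv xs)" if "Inv (ys @ [z]) s''" for s''
        by (rule Cons.IH[OF _ that]) (use Cons.prems in simp)
    qed simp
    ultimately show ?case by simp
  qed
  from this[of "[]" xs s] assms(1) show ?thesis by simp
qed

lemma written_seqs:
  "written_arrays (seqs cs) = (\<Union>c\<in>set cs. written_arrays c)"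
  "written_regs (seqs cs) = insert 16 (\<Union>c\<in>set cs. written_regs c)"
  by (induction cs) (auto simp: seqs_def)

text \<open>A constant, since the simplifier turns an equation \<open>x = 1 / 2\<close> into \<open>x * 2 = 1\<close>.\<close>

definition one_half :: complex where
  "one_half = 1 / 2"

text \<open>\<open>Work 6\<close> holds \<open>1 / N\<close>; scalars live in cell 0 of an array, addressed through register 2.\<close>

definition ready :: "nat \<Rightarrow> 'v array_name state \<Rightarrow> bool" where
  "ready p s \<longleftrightarrow> reg s 0 = 2 ^ p \<and> reg s 1 = 1 \<and> reg s 2 = 0 \<and> reg s 3 = p \<and>
     reg s 4 = (2 ^ p + 1) div 2 \<and> reg s 5 = 2 ^ p + 1 \<and> arr s (Work 6) 0 = one_half ^ p"

section \<open>Computing half, logarithm and reciprocal of N\<close>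

notation Seq (infixr ";;" 60)

text \<open>Register \<open>h\<close> counts up while a copy of \<open>r\<close> counts down, until
  they meet at half the value, rounded up. The remaining rounds are idle, so the time is linear in
  the content of \<open>r\<close>.\<close>

definition halve :: "nat \<Rightarrow> nat \<Rightarrow> 'v array_name com" where
  "halve r h = RConst h 0 ;; RAdd 15 r 2 ;;
     Loop r (IfLess h 15 (RAdd h h 1 ;; RSub 15 15 1) skip)"

lemma runs_halve:
  fixes s :: "'v array_name state"
  assumes "reg s 1 = 1" "reg s 2 = 0" "h \<notin> {0, 1, 2, 15, 16, r}" "r \<notin> {15, 16}"
  shows "runs (halve r h) s (3 + 4 * reg s r) (\<lambda>s'. reg s' h = (reg s r + 1) div 2)"
  unfolding halve_def
proof (rule runs_Seq[where M = "\<lambda>s'. reg s' h = 0 \<and> reg s' 1 = 1 \<and> reg s' 2 = 0 \<and> reg s' r = reg s r"])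
  let ?n = "reg s r"
  show "runs (RConst h 0) s 1 (\<lambda>s'. reg s' h = 0 \<and> reg s' 1 = 1 \<and> reg s' 2 = 0 \<and> reg s' r = reg s r)"
    using assms by (simp add: basic_exec)
  fix s' :: "'v array_name state" assume s': "reg s' h = 0 \<and> reg s' 1 = 1 \<and> reg s' 2 = 0 \<and> reg s' r = reg s r"
  define Inv where "Inv i s' \<longleftrightarrow> reg s' h = min i ((?n + 1) div 2) \<and> reg s' 15 + reg s' h = ?n \<and>
    reg s' 1 = 1" for i and s' :: "'v array_name state"
  show "runs (RAdd 15 r 2 ;; Loop r (IfLess h 15 (RAdd h h 1 ;; RSub 15 15 1) skip)) s' (2 + 4 * ?n)
    (\<lambda>s'. reg s' h = (?n + 1) div 2)"
  proof (rule runs_Seq[where M = "\<lambda>s'. Inv 0 s' \<and> reg s' r = ?n"])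
    show "runs (RAdd 15 r 2) s' 1 (\<lambda>s'. Inv 0 s' \<and> reg s' r = ?n)"
      using assms s' by (simp add: basic_exec Inv_def)
    fix s'' assume s'': "Inv 0 s'' \<and> reg s'' r = ?n"
    have "runs (Loop r (IfLess h 15 (RAdd h h 1 ;; RSub 15 15 1) skip)) s'' (1 + 4 * ?n) (Inv ?n)"
    proof (rule runs_Loop[where t = 3])
      fix i t assume i: "i < ?n" "Inv i t"
      let ?c = "(?n + 1) div 2"
      have "min i ?c < ?n - min i ?c \<longleftrightarrow> i < ?c" by linarith
      moreover have "reg t 15 = ?n - min i ?c" "reg t h = min i ?c" "reg t 1 = 1"
        using i(2) by (auto simp: Inv_def)
      moreover have "min i ?c \<le> ?n" by linarith
      moreover have "i < ?c \<Longrightarrow> min i ?c = i \<and> min (Suc i) ?c = Suc i"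
        "\<not> i < ?c \<Longrightarrow> min i ?c = ?c \<and> min (Suc i) ?c = ?c" by auto
      ultimately show "runs (IfLess h 15 (RAdd h h 1 ;; RSub 15 15 1) skip) t 3 (Inv (Suc i))"
        using assms(3) i(1) by (cases "i < ?c") (simp_all add: basic_exec Inv_def)
    qed (use s'' in auto)
    then show "runs (Loop r (IfLess h 15 (RAdd h h 1 ;; RSub 15 15 1) skip)) s'' (1 + 4 * ?n)
      (\<lambda>s'. reg s' h = (?n + 1) div 2)"
      by (rule runs_mono) (auto simp: Inv_def)
  qed simp
qed simp

text \<open>Register 16 doubles until it reaches N; meanwhile register 3 counts the doublings,
  giving p, and \<open>Work 6\<close> is halved from 1 to 1 / N. The idle branch writes register 15
  instead of using \<open>skip\<close>, which would destroy the power held in register 16.\<close>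

definition setup_prog :: "'v array_name com" where
  "setup_prog = (RConst 1 1 ;; RConst 2 0 ;; RConst 16 1 ;; RConst 3 0 ;; CConst (Work 6, 2) 1 ;;
     CConst (Work 8, 2) one_half) ;;
     Loop 0 (IfLess 16 0 (RAdd 16 16 16 ;; RAdd 3 3 1 ;; CMul (Work 6, 2) (Work 6, 2) (Work 8, 2)) (RConst 15 0)) ;;
     halve 0 4 ;; RAdd 5 0 1"


lemma runs_setup:
  fixes s :: "'v array_name state"
  assumes "reg s 0 = 2 ^ p"
  shows "runs setup_prog s (20 * 2 ^ p) (ready p)"
  unfolding setup_prog_def
proof (rule runs_Seq)
  define Inv where "Inv i s' \<longleftrightarrow> reg s' 0 = 2 ^ p \<and> reg s' 1 = 1 \<and> reg s' 2 = 0 \<and>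
    reg s' 16 = 2 ^ min i p \<and> reg s' 3 = min i p \<and> arr s' (Work 6) 0 = one_half ^ min i p \<and>
    arr s' (Work 8) 0 = one_half" for i and s' :: "'v array_name state"
  show "runs (RConst 1 1 ;; RConst 2 0 ;; RConst 16 1 ;; RConst 3 0 ;; CConst (Work 6, 2) 1 ;;
     CConst (Work 8, 2) one_half) s 6 (Inv 0)"
    using assms by (simp add: basic_exec Inv_def)
  fix s1 assume s1: "Inv 0 s1"
  show "runs (Loop 0 (IfLess 16 0 (RAdd 16 16 16 ;; RAdd 3 3 1 ;; CMul (Work 6, 2) (Work 6, 2) (Work 8, 2)) (RConst 15 0)) ;;
     halve 0 4 ;; RAdd 5 0 1) s1 (14 * 2 ^ p) (ready p)"
  proof (rule runs_Seq)
    show "runs (Loop 0 (IfLess 16 0 (RAdd 16 16 16 ;; RAdd 3 3 1 ;; CMul (Work 6, 2) (Work 6, 2) (Work 8, 2)) (RConst 15 0)))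
      s1 (1 + 5 * 2 ^ p) (Inv (2 ^ p))"
    proof (rule runs_Loop[where t = 4])
      fix i s2 assume "Inv i s2"
      moreover have "min i p = i \<and> min (Suc i) p = Suc i" if "i < p" using that by simp
      moreover have "min i p = p \<and> min (Suc i) p = p" if "\<not> i < p" using that by simp
      ultimately show "runs (IfLess 16 0 (RAdd 16 16 16 ;; RAdd 3 3 1 ;; CMul (Work 6, 2) (Work 6, 2) (Work 8, 2)) (RConst 15 0))
        s2 4 (Inv (Suc i))"
        by (cases "i < p") (simp_all add: basic_exec Inv_def)
    qed (use s1 Inv_def in auto)
    fix s2 assume "Inv (2 ^ p) s2"
    \<comment> \<open>The loop runs N times, and p doublings fit into N = 2 ^ p rounds.\<close>
    moreover have "min (2 ^ p) p = p" by (simp add: less_imp_le)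
    ultimately have s2: "reg s2 0 = 2 ^ p" "reg s2 1 = 1" "reg s2 2 = 0" "reg s2 3 = p" "arr s2 (Work 6) 0 = one_half ^ p"
      by (simp_all add: Inv_def)
    show "runs (halve 0 4 ;; RAdd 5 0 1) s2 (4 + 4 * 2 ^ p) (ready p)"
    proof (rule runs_Seq)
      show "runs (halve 0 4) s2 (3 + 4 * 2 ^ p) (\<lambda>s'. reg s' 4 = (2 ^ p + 1) div 2 \<and> same_outside (halve 0 4) s2 s')"
        by (rule runs_frame[OF runs_halve]) (use s2 in auto)
      fix s3 :: "'v array_name state"
      assume "reg s3 4 = (2 ^ p + 1) div 2 \<and> same_outside (halve 0 4) s2 s3"
      then show "runs (RAdd 5 0 1) s3 1 (ready p)"
        using s2 by (simp add: same_outside_def halve_def basic_exec ready_def)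
    qed simp
  qed simp
qed simp

lemma ready_frame:
  assumes "ready p s" "same_outside c s s'" "written_regs c \<inter> {..5} = {}" "Work 6 \<notin> written_arrays c"
  shows "ready p s'"
proof -
  have "reg s' r = reg s r" if "r \<le> 5" for r
    using assms that unfolding same_outside_def by (metis IntI atMost_iff empty_iff)
  then show ?thesis using assms unfolding ready_def same_outside_def by auto
qed

section \<open>Program for the fast Fourier transform\<close>

definition butterfly :: "'v array_name com" where
  "butterfly = (RAdd 11 6 14 ;; RAdd 13 11 9 ;; RAdd 12 6 4 ;;
     CMul (Work 4, 2) (Work 2, 2) (Work 0, 13) ;;
     CAdd (Work 1, 6) (Work 0, 11) (Work 4, 2) ;; CSub (Work 1, 12) (Work 0, 11) (Work 4, 2) ;;
     RAdd 6 6 1 ;; RAdd 10 10 1) ;;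
     IfLess 10 9 skip (RConst 10 0 ;; RAdd 14 14 9 ;; CMul (Work 2, 2) (Work 2, 2) (Work 3, 2))"

text \<open>Quotient and remainder of the counter v by r are not computed but carried along:
  register 10 is reset when it reaches r, and at that moment register 14 advances by r and the
  twiddle factor in \<open>Work 2\<close> is multiplied by \<rho>. Before any butterfly all entries
  of \<open>Work 0\<close> are the old stage \<open>D\<close>; the new stage goes to
  \<open>Work 1\<close>.\<close>

definition butterfly_inv ::
  "(nat \<Rightarrow> complex) \<Rightarrow> nat \<Rightarrow> nat \<Rightarrow> complex \<Rightarrow> nat \<Rightarrow> 'v array_name state \<Rightarrow> bool" where
  "butterfly_inv D r h \<rho> v s \<longleftrightarrow> reg s 1 = 1 \<and> reg s 2 = 0 \<and> reg s 4 = h \<and> reg s 9 = r \<and>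
     reg s 6 = v \<and> reg s 10 = v mod r \<and> reg s 14 = v div r * r \<and>
     arr s (Work 0) = D \<and> arr s (Work 2) 0 = \<rho> ^ (v div r) \<and> arr s (Work 3) 0 = \<rho> \<and>
     (\<forall>i<v. arr s (Work 1) i = D (i + i div r * r) + \<rho> ^ (i div r) * D (i + i div r * r + r) \<and>
            arr s (Work 1) (i + h) = D (i + i div r * r) - \<rho> ^ (i div r) * D (i + i div r * r + r))"

lemma runs_butterfly:
  fixes s :: "'v array_name state"
  assumes inv: "butterfly_inv D r h \<rho> v s" and v: "v < h" and r: "0 < r"
  shows "runs butterfly s 12 (butterfly_inv D r h \<rho> (Suc v))"
proof -
  define X where "X i = D (i + i div r * r)" for i
  define Y where "Y i = \<rho> ^ (i div r) * D (i + i div r * r + r)" for i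
  note I = inv[unfolded butterfly_inv_def, folded X_def Y_def]
  define P where "P s' \<longleftrightarrow> reg s' 1 = 1 \<and> reg s' 2 = 0 \<and> reg s' 4 = h \<and> reg s' 9 = r \<and> reg s' 6 = Suc v \<and>
    arr s' (Work 0) = D \<and> arr s' (Work 3) 0 = \<rho> \<and>
    (\<forall>i<Suc v. arr s' (Work 1) i = X i + Y i \<and> arr s' (Work 1) (i + h) = X i - Y i)"
    for s' :: "'v array_name state"
  define Q where "Q s' \<longleftrightarrow> P s' \<and> reg s' 10 = Suc (v mod r) \<and> reg s' 14 = v div r * r \<and>
    arr s' (Work 2) 0 = \<rho> ^ (v div r)" for s' :: "'v array_name state"
  have goal: "butterfly_inv D r h \<rho> (Suc v) s'" if "P s'" "reg s' 10 = Suc v mod r"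
    "reg s' 14 = Suc v div r * r" "arr s' (Work 2) 0 = \<rho> ^ (Suc v div r)" for s' :: "'v array_name state"
    using that unfolding butterfly_inv_def P_def X_def Y_def by blast
  show ?thesis
    unfolding butterfly_def
  proof (rule runs_Seq)
    have "W i = X i + Y i \<and> W (i + h) = X i - Y i"
      if "W = (arr s (Work 1))(v := X v + Y v, v + h := X v - Y v)" "i < Suc v" for i W
      using that I v by (cases "i = v") auto
    then show "runs (RAdd 11 6 14 ;; RAdd 13 11 9 ;; RAdd 12 6 4 ;; CMul (Work 4, 2) (Work 2, 2) (Work 0, 13) ;;
      CAdd (Work 1, 6) (Work 0, 11) (Work 4, 2) ;; CSub (Work 1, 12) (Work 0, 11) (Work 4, 2) ;;
      RAdd 6 6 1 ;; RAdd 10 10 1) s 8 Q"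
      using I by (simp add: basic_exec Q_def P_def X_def Y_def)
    fix s' assume s': "Q s'"
    show "runs (IfLess 10 9 skip (RConst 10 0 ;; RAdd 14 14 9 ;; CMul (Work 2, 2) (Work 2, 2) (Work 3, 2)))
      s' 4 (butterfly_inv D r h \<rho> (Suc v))"
    proof (cases "Suc (v mod r) < r")
      case True
      moreover from True have "Suc v mod r = Suc (v mod r)" "Suc v div r = v div r"
        by (auto simp: mod_Suc div_Suc)
      ultimately show ?thesis using s' goal by (simp add: runs_def set_reg_def Q_def P_def)
    next
      case False
      moreover have "v mod r < r" using r by simp
      ultimately have "Suc (v mod r) = r" by linarith
      then have "Suc v mod r = 0" "Suc v div r = Suc (v div r)" by (auto simp: mod_Suc div_Suc)
      with False s' goal show ?thesis by (simp add: basic_exec Q_def P_def)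
    qed
  qed simp
qed

text \<open>Register 8 holds the block length 2 r of the old stage and \<open>Work 5\<close> the
  exponent of the new root of unity; both are halved for the next stage. Since inputs and outputs of
  a butterfly are at different positions, the stage is built in a second array and copied
  back.\<close>

definition fft_stage_prog :: "'v array_name com" where
  "fft_stage_prog = halve 8 9 ;;
     (CConst (Work 2, 2) 1 ;; CExp (Work 3, 2) (Work 5, 2) ;; CMul (Work 5, 2) (Work 5, 2) (Work 8, 2) ;;
      RConst 6 0 ;; RConst 10 0 ;; RConst 14 0) ;;
     Loop 4 butterfly ;; (RAdd 8 9 2 ;; RConst 6 0) ;;
     Loop 0 (CCopy (Work 0, 6) (Work 1, 6) ;; RAdd 6 6 1)"

lemma runs_copy:
  assumes "reg s 1 = 1" "reg s 6 = 0" "reg s 0 = n"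
  shows "runs (Loop 0 (CCopy (Work 0, 6) (Work 1, 6) ;; RAdd 6 6 1)) s (1 + 3 * n)
    (\<lambda>s'. \<forall>i<n. arr s' (Work 0) i = arr s (Work 1) i)"
proof (rule runs_mono[OF runs_Loop[where t = 2 and n = n and Inv =
    "\<lambda>i s'. reg s' 1 = 1 \<and> reg s' 6 = i \<and> arr s' (Work 1) = arr s (Work 1) \<and>
      (\<forall>j<i. arr s' (Work 0) j = arr s (Work 1) j)"]])
qed (use assms in \<open>auto simp: basic_exec less_Suc_eq\<close>)

definition fft_inv :: "real \<Rightarrow> nat \<Rightarrow> (nat \<Rightarrow> complex) \<Rightarrow> nat \<Rightarrow> 'v array_name state \<Rightarrow> bool" where
  "fft_inv \<sigma> p a i s \<longleftrightarrow> ready p s \<and> reg s 8 = 2 ^ (p - i) \<and>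
     arr s (Work 5) 0 = \<i> * of_real (\<sigma> * pi) * 2 / 2 ^ Suc i \<and> arr s (Work 8) 0 = one_half \<and>
     (\<forall>v<2 ^ p. arr s (Work 0) v = fft_stage \<sigma> p a i v)"

lemma runs_fft_stage:
  fixes s :: "'v array_name state"
  assumes inv: "fft_inv \<sigma> p a i s" and i: "i < p" and \<sigma>: "\<sigma> = 1 \<or> \<sigma> = - 1"
  shows "runs fft_stage_prog s (33 * 2 ^ p) (fft_inv \<sigma> p a (Suc i))"
proof -
  define D where "D = arr s (Work 0)"
  define r :: nat where "r = 2 ^ (p - Suc i)"
  define h :: nat where "h = 2 ^ (p - 1)"
  define \<rho> where "\<rho> = root_of_unity \<sigma> (Suc i)"
  define \<theta> where "\<theta> = \<i> * of_real (\<sigma> * pi) * 2 / 2 ^ Suc (Suc i)"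
  have D: "D v = fft_stage \<sigma> p a i v" if "v < 2 ^ p" for v
    using inv that by (simp add: fft_inv_def D_def)
  have r2: "2 ^ (p - i) = 2 * r"
    using i by (simp add: r_def power_Suc[symmetric] Suc_diff_Suc del: power_Suc)
  have h2: "2 ^ p = 2 * h" using i by (cases p) (simp_all add: h_def)
  have r0: "0 < r" by (simp add: r_def)
  have rle: "2 * r \<le> 2 ^ p" unfolding r2[symmetric] by simp
  define P where "P s' \<longleftrightarrow> ready p s' \<and> reg s' 9 = r \<and> arr s' (Work 8) 0 = one_half" for s' :: "'v array_name state"
  have \<theta>: "\<theta> * 2 * one_half = \<theta>" by (simp add: one_half_def)
  have \<rho>: "exp (\<theta> * 2) = \<rho>" by (simp add: \<rho>_def \<theta>_def root_of_unity_def ac_simps)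
  show ?thesis
    unfolding fft_stage_prog_def
  proof (rule runs_Seq)
    show "runs (halve 8 9) s (3 + 4 * (2 * r)) (\<lambda>s'. P s' \<and> arr s' (Work 0) = D \<and> arr s' (Work 5) 0 = \<theta> * 2)"
    proof (rule runs_frame[OF runs_halve])
      fix s' assume *: "same_outside (halve 8 9) s s'" "reg s' 9 = (reg s 8 + 1) div 2"
      then have "ready p s'" using inv by (intro ready_frame[OF _ *(1)]) (auto simp: fft_inv_def halve_def)
      with * inv show "P s' \<and> arr s' (Work 0) = D \<and> arr s' (Work 5) 0 = \<theta> * 2"
        by (simp add: fft_inv_def P_def D_def r2 halve_def same_outside_def \<theta>_def)
    qed (use inv r2 in \<open>auto simp: fft_inv_def ready_def\<close>)
    fix s1 assume s1: "P s1 \<and> arr s1 (Work 0) = D \<and> arr s1 (Work 5) 0 = \<theta> * 2"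
    show "runs ((CConst (Work 2, 2) 1 ;; CExp (Work 3, 2) (Work 5, 2) ;; CMul (Work 5, 2) (Work 5, 2) (Work 8, 2) ;;
      RConst 6 0 ;; RConst 10 0 ;; RConst 14 0) ;;
     Loop 4 butterfly ;; (RAdd 8 9 2 ;; RConst 6 0) ;;
     Loop 0 (CCopy (Work 0, 6) (Work 1, 6) ;; RAdd 6 6 1)) s1 (6 + ((1 + 13 * h) + (2 + (1 + 3 * 2 ^ p)))) (fft_inv \<sigma> p a (Suc i))"
    proof (rule runs_Seq)
      show "runs (CConst (Work 2, 2) 1 ;; CExp (Work 3, 2) (Work 5, 2) ;; CMul (Work 5, 2) (Work 5, 2) (Work 8, 2) ;;
        RConst 6 0 ;; RConst 10 0 ;; RConst 14 0) s1 6 (\<lambda>s'. P s' \<and> butterfly_inv D r h \<rho> 0 s' \<and> arr s' (Work 5) 0 = \<theta>)"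
        using s1 h2 by (simp add: basic_exec P_def ready_def butterfly_inv_def \<rho> \<theta>)
      fix s2 assume s2: "P s2 \<and> butterfly_inv D r h \<rho> 0 s2 \<and> arr s2 (Work 5) 0 = \<theta>"
      show "runs (Loop 4 butterfly ;; (RAdd 8 9 2 ;; RConst 6 0) ;;
        Loop 0 (CCopy (Work 0, 6) (Work 1, 6) ;; RAdd 6 6 1)) s2 ((1 + 13 * h) + (2 + (1 + 3 * 2 ^ p))) (fft_inv \<sigma> p a (Suc i))"
      proof (rule runs_Seq)
        have "runs (Loop 4 butterfly) s2 (1 + 13 * h) (butterfly_inv D r h \<rho> h)"
        proof (rule runs_Loop[where t = 12 and Inv = "butterfly_inv D r h \<rho>"])
          show "reg s2 4 = h" using s2 by (simp add: butterfly_inv_def)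
        qed (use s2 runs_butterfly[OF _ _ r0] in auto)
        then show "runs (Loop 4 butterfly) s2 (1 + 13 * h) (\<lambda>s'. P s' \<and> butterfly_inv D r h \<rho> h s' \<and> arr s' (Work 5) 0 = \<theta>)"
        proof (rule runs_frame)
          fix s' assume *: "same_outside (Loop 4 butterfly) s2 s'" "butterfly_inv D r h \<rho> h s'"
          then have "ready p s'" using s2 by (intro ready_frame[OF _ *(1)]) (auto simp: P_def butterfly_def)
          with * s2 show "P s' \<and> butterfly_inv D r h \<rho> h s' \<and> arr s' (Work 5) 0 = \<theta>"
            by (simp add: P_def butterfly_def same_outside_def)
        qed simp
        fix s3 assume s3: "P s3 \<and> butterfly_inv D r h \<rho> h s3 \<and> arr s3 (Work 5) 0 = \<theta>"
        have W1: "arr s3 (Work 1) v = fft_stage \<sigma> p a (Suc i) v" if v: "v < 2 ^ p" for v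
        proof -
          \<comment> \<open>The largest position read by a butterfly stays within the array, where
            the contents of \<open>D\<close> are known to be the previous stage.\<close>
          have bound: "w + w div r * r + r < 2 ^ p" if w: "w < h" for w
          proof -
            have hr: "h = 2 ^ i * r" using i by (simp add: h_def r_def power_add[symmetric])
            have "w div r < 2 ^ i" using w r0 by (simp add: hr less_mult_imp_div_less)
            then have "(w div r + 1) * (2 * r) \<le> 2 ^ i * (2 * r)" by (intro mult_le_mono) auto
            moreover have "w + w div r * r + r < (w div r + 1) * (2 * r)"
              using dividend_less_div_times[OF r0, of w] by (simp add: algebra_simps)
            ultimately have "w + w div r * r + r < 2 ^ i * (2 * r)" by (rule less_le_trans[rotated])
            then show ?thesis by (simp add: h2 hr mult.left_commute)
          qed
          note S = fft_stage_Suc[OF i _ \<sigma>, folded h_def r_def \<rho>_def]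
          show ?thesis
          proof (cases "v < h")
            case True
            with s3 bound[OF True] S(1)[OF True] show ?thesis
              by (simp add: butterfly_inv_def D)
          next
            case False
            then obtain w where w: "v = w + h" "w < h" using v h2
              by (metis add.commute le_Suc_ex less_diff_conv2 linorder_not_le mult_2 add_less_cancel_left)
            with s3 bound[OF w(2)] S(2)[OF w(2)] show ?thesis
              by (simp add: butterfly_inv_def D)
          qed
        qed
        show "runs ((RAdd 8 9 2 ;; RConst 6 0) ;; Loop 0 (CCopy (Work 0, 6) (Work 1, 6) ;; RAdd 6 6 1)) s3
          (2 + (1 + 3 * 2 ^ p)) (fft_inv \<sigma> p a (Suc i))"
        proof (rule runs_Seq)
          show "runs (RAdd 8 9 2 ;; RConst 6 0) s3 2 (\<lambda>s'. P s' \<and> reg s' 8 = r \<and> reg s' 6 = 0 \<and>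
              arr s' (Work 1) = arr s3 (Work 1) \<and> arr s' (Work 5) 0 = \<theta>)"
            using s3 by (simp add: basic_exec P_def ready_def)
          fix s4 assume s4: "P s4 \<and> reg s4 8 = r \<and> reg s4 6 = 0 \<and> arr s4 (Work 1) = arr s3 (Work 1) \<and> arr s4 (Work 5) 0 = \<theta>"
          show "runs (Loop 0 (CCopy (Work 0, 6) (Work 1, 6) ;; RAdd 6 6 1)) s4 (1 + 3 * 2 ^ p) (fft_inv \<sigma> p a (Suc i))"
          proof (rule runs_frame[OF runs_copy[where n = "2 ^ p"]])
            fix s' assume *: "same_outside (Loop 0 (CCopy (Work 0, 6) (Work 1, 6) ;; RAdd 6 6 1)) s4 s'"
              "\<forall>i<2 ^ p. arr s' (Work 0) i = arr s4 (Work 1) i"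
            then have "ready p s'" using s4 by (intro ready_frame[OF _ *(1)]) (auto simp: P_def)
            with * s4 W1 show "fft_inv \<sigma> p a (Suc i) s'"
              by (simp add: P_def fft_inv_def same_outside_def r_def \<theta>_def)
          qed (use s4 in \<open>auto simp: P_def ready_def\<close>)
        qed simp
      qed simp
    qed simp
  next
    have "1 \<le> h" by (simp add: h_def)
    then show "3 + 4 * (2 * r) + (6 + ((1 + 13 * h) + (2 + (1 + 3 * 2 ^ p)))) \<le> 33 * 2 ^ p"
      using rle h2 by linarith
  qed
qed

definition fft_prog :: "real \<Rightarrow> 'v array_name com" where
  "fft_prog \<sigma> = (CConst (Work 5, 2) (\<i> * of_real (\<sigma> * pi)) ;; RAdd 8 0 2 ;; CConst (Work 8, 2) one_half) ;;
     Loop 3 fft_stage_prog"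

lemma runs_fft:
  assumes s: "ready p s" and a: "\<And>i. i < 2 ^ p \<Longrightarrow> arr s (Work 0) i = a i" and \<sigma>: "\<sigma> = 1 \<or> \<sigma> = - 1"
  shows "runs (fft_prog \<sigma>) s (34 * (2 ^ p * (p + 1)))
    (\<lambda>s'. \<forall>i<2 ^ p. arr s' (Work 0) i = (\<Sum>m<2 ^ p. a m * root_of_unity \<sigma> p ^ (m * i)))"
  unfolding fft_prog_def
proof (rule runs_Seq)
  show "runs (CConst (Work 5, 2) (\<i> * of_real (\<sigma> * pi)) ;; RAdd 8 0 2 ;; CConst (Work 8, 2) one_half) s 3 (fft_inv \<sigma> p a 0)"
    using s a by (simp add: basic_exec fft_inv_def ready_def fft_stage_0)
  fix s1 assume s1: "fft_inv \<sigma> p a 0 s1"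
  have "runs (Loop 3 fft_stage_prog) s1 (1 + p * (1 + 33 * 2 ^ p)) (fft_inv \<sigma> p a p)"
  proof (rule runs_Loop[where t = "33 * 2 ^ p" and Inv = "fft_inv \<sigma> p a"])
    show "reg s1 3 = p" using s1 by (simp add: fft_inv_def ready_def)
  qed (use s1 runs_fft_stage[OF _ _ \<sigma>] in auto)
  then show "runs (Loop 3 fft_stage_prog) s1 (1 + p * (1 + 33 * 2 ^ p))
    (\<lambda>s'. \<forall>i<2 ^ p. arr s' (Work 0) i = (\<Sum>m<2 ^ p. a m * root_of_unity \<sigma> p ^ (m * i)))"
    by (rule runs_mono) (auto simp: fft_inv_def fft_stage_last)
next
  have "p \<le> p * 2 ^ p" "(1::nat) \<le> 2 ^ p" by auto
  moreover have "2 ^ p * (p + 1) = p * 2 ^ p + 2 ^ p" "p * (1 + 33 * 2 ^ p) = p + 33 * (p * 2 ^ p)"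
    by (simp_all add: algebra_simps)
  ultimately show "3 + (1 + p * (1 + 33 * 2 ^ p)) \<le> 34 * (2 ^ p * (p + 1))" by linarith
qed


section \<open>Contribution of one pair (k, l), one edge and one sign\<close>

definition fill_prog :: "nat \<Rightarrow> nat \<Rightarrow> nat \<Rightarrow> 'v array_name com" where
  "fill_prog k l n = RConst 6 0 ;; Loop 0 (CConst (Work 0, 6) 0 ;;
     IfLess 6 7
       (seqs (map (\<lambda>j. CMul (Work 1, 6) (BstarB k j l, 6) (Coeff k j, 6) ;;
                        CAdd (Work 0, 6) (Work 0, 6) (Work 1, 6)) [0..<n]))
       skip ;;
     RAdd 6 6 1)"

text \<open>The coefficient of the l-th restricted function in mode m, padded by zeros beyond the
  \<open>M\<close> modes that occur. Padding turns the sum over the modes into a transform of length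
  N, and the test on m keeps input cells with arbitrary contents out of it.\<close>

definition filled :: "'v array_name state \<Rightarrow> nat \<Rightarrow> nat \<Rightarrow> nat \<Rightarrow> nat \<Rightarrow> nat \<Rightarrow> complex" where
  "filled s k l n M m =
     (if m < M then \<Sum>j<n. arr s (BstarB k j l) m * arr s (Coeff k j) m else 0)"

lemma runs_fill:
  fixes s :: "'v array_name state"
  assumes "reg s 1 = 1" "reg s 0 = N"
  shows "runs (fill_prog k l n) s (2 + N * (2 * n + 5)) (\<lambda>s'. \<forall>m<N. arr s' (Work 0) m = filled s k l n (reg s 7) m)"
  unfolding fill_prog_def
proof (rule runs_Seq)
  let ?g = "\<lambda>m j. arr s (BstarB k j l) m * arr s (Coeff k j) m"
  define Q where "Q i s' \<longleftrightarrow> reg s' 1 = 1 \<and> reg s' 6 = i \<and> reg s' 7 = reg s 7 \<and>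
    (\<forall>j. arr s' (BstarB k j l) = arr s (BstarB k j l) \<and> arr s' (Coeff k j) = arr s (Coeff k j)) \<and>
    (\<forall>m<i. arr s' (Work 0) m = filled s k l n (reg s 7) m)" for i and s' :: "'v array_name state"
  let ?body = "\<lambda>j. CMul (Work 1, 6) (BstarB k j l, 6) (Coeff k j, 6) ;;
    CAdd (Work 0, 6) (Work 0, 6) (Work 1, 6)"
  show "runs (RConst 6 0) s 1 (\<lambda>s'. Q 0 s' \<and> reg s' 0 = N)"
    using assms by (simp add: basic_exec Q_def)
  fix s1 assume s1: "Q 0 s1 \<and> reg s1 0 = N"
  have "runs (Loop 0 (CConst (Work 0, 6) 0 ;; IfLess 6 7 (seqs (map ?body [0..<n])) skip ;; RAdd 6 6 1))
    s1 (1 + N * (2 * n + 5)) (Q N)"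
  proof (rule runs_Loop[where t = "2 * n + 4" and Inv = Q])
    fix i s2 assume s2: "Q i s2"
    show "runs (CConst (Work 0, 6) 0 ;; IfLess 6 7 (seqs (map ?body [0..<n])) skip ;; RAdd 6 6 1) s2 (2 * n + 4) (Q (Suc i))"
    proof (rule runs_Seq)
      show "runs (CConst (Work 0, 6) 0) s2 1 (\<lambda>s'. Q i s' \<and> arr s' (Work 0) i = 0)"
        using s2 by (simp add: basic_exec Q_def)
      fix s3 assume s3: "Q i s3 \<and> arr s3 (Work 0) i = 0"
      show "runs (IfLess 6 7 (seqs (map ?body [0..<n])) skip ;; RAdd 6 6 1) s3 (2 * n + 3) (Q (Suc i))"
      proof (rule runs_Seq)
        show "runs (IfLess 6 7 (seqs (map ?body [0..<n])) skip) s3 (Suc (2 * n + 1))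
          (\<lambda>s'. Q i s' \<and> arr s' (Work 0) i = filled s k l n (reg s 7) i)"
        proof (rule runs_IfLess)
          assume lt: "reg s3 6 < reg s3 7"
          have "runs (seqs (map ?body [0..<n])) s3 (length [0..<n] * 2 + 1)
            (\<lambda>s'. Q i s' \<and> arr s' (Work 0) i = (\<Sum>j\<leftarrow>[0..<n]. ?g i j))"
            by (rule runs_seqs) (use s3 in \<open>auto simp: basic_exec Q_def\<close>)
          then show "runs (seqs (map ?body [0..<n])) s3 (2 * n + 1)
            (\<lambda>s'. Q i s' \<and> arr s' (Work 0) i = filled s k l n (reg s 7) i)"
            by (rule runs_mono)
              (use lt s3 in \<open>auto simp: filled_def Q_def interv_sum_list_conv_sum_set_nat atLeast0LessThan\<close>)
        next
          assume "\<not> reg s3 6 < reg s3 7"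
          then show "runs skip s3 (2 * n + 1) (\<lambda>s'. Q i s' \<and> arr s' (Work 0) i = filled s k l n (reg s 7) i)"
            using s3 by (simp add: basic_exec filled_def Q_def)
        qed
        fix s4 assume "Q i s4 \<and> arr s4 (Work 0) i = filled s k l n (reg s 7) i"
        then show "runs (RAdd 6 6 1) s4 1 (Q (Suc i))"
          by (auto simp: basic_exec Q_def less_Suc_eq)
      qed simp
    qed simp
  qed (use s1 in auto)
  then show "runs (Loop 0 (CConst (Work 0, 6) 0 ;; IfLess 6 7 (seqs (map ?body [0..<n])) skip ;; RAdd 6 6 1))
    s1 (1 + N * (2 * n + 5)) (\<lambda>s'. \<forall>m<N. arr s' (Work 0) m = filled s k l n (reg s 7) m)"
    by (rule runs_mono) (auto simp: Q_def)
qed simp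

text \<open>The test on register 0 singles out N = 1. There the count depends on whether
  \<open>w\<close> exceeds pi, which is decided when the program is written, \<open>w\<close> being
  a constant of the graph; otherwise the count is N / 2, found in register 4.\<close>

definition count_prog :: "real \<Rightarrow> 'v array_name com" where
  "count_prog w = RConst 15 2 ;; IfLess 0 15 (RConst 7 (if w \<le> pi then 1 else 0)) (RAdd 7 4 2)"

text \<open>The number of m with \<open>w + 2 * m * pi\<close> at most N pi. For even N the bound N
  pi is a multiple of 2 pi, so every \<open>w\<close> in (0, 2 pi] gives N / 2; for N = 1 the bound
  pi cuts that interval in the middle.\<close>

definition mode_count :: "real \<Rightarrow> nat \<Rightarrow> nat" where
  "mode_count w p = (if p = 0 then if w \<le> pi then 1 else 0 else 2 ^ (p - 1))"

lemma runs_count: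
  assumes "ready p s"
  shows "runs (count_prog w) s 3 (\<lambda>s'. reg s' 7 = mode_count w p)"
proof (cases p)
  case 0
  then show ?thesis using assms by (simp add: count_prog_def mode_count_def basic_exec ready_def)
next
  case (Suc q)
  moreover have "\<not> (2::nat) * 2 ^ q < 2" by simp
  ultimately show ?thesis using assms
    by (simp add: count_prog_def mode_count_def basic_exec ready_def del: mult_less_cancel_left2)
qed

text \<open>\<open>Work 7\<close> runs through \<alpha> times the powers of the phase per step, so
  one exponential suffices. The copy within \<open>Work 0\<close> puts cell 0 into cell N (register
  0 holds N, register 2 holds 0): the transform has period N, and the edge has a grid point n = N as
  well. Hence also N + 1 rounds, from register 5.\<close>

definition emit_prog :: "'v set \<Rightarrow> complex \<Rightarrow> real \<Rightarrow> 'v array_name com" where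
  "emit_prog e \<alpha> w = (CConst (Work 3, 2) (\<i> * of_real w) ;; CMul (Work 3, 2) (Work 3, 2) (Work 6, 2) ;;
     CExp (Work 3, 2) (Work 3, 2) ;; CConst (Work 7, 2) \<alpha> ;; CCopy (Work 0, 0) (Work 0, 2) ;; RConst 6 0) ;;
     Loop 5 (CMul (Work 4, 2) (Work 7, 2) (Work 0, 6) ;; CAdd (Value e, 6) (Value e, 6) (Work 4, 2) ;;
       CMul (Work 7, 2) (Work 7, 2) (Work 3, 2) ;; RAdd 6 6 1)"

lemma runs_emit:
  fixes s :: "'v array_name state"
  assumes s: "ready p s"
  shows "runs (emit_prog e \<alpha> w) s (12 + 5 * 2 ^ p) (\<lambda>s'. \<forall>n\<le>2 ^ p. arr s' (Value e) n =
    arr s (Value e) n + \<alpha> * exp (\<i> * of_real w * one_half ^ p) ^ n * arr s (Work 0) (if n = 2 ^ p then 0 else n))"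
  unfolding emit_prog_def
proof (rule runs_Seq)
  define \<rho> where "\<rho> = exp (\<i> * of_real w * one_half ^ p)"
  define D where "D n = arr s (Work 0) (if n = 2 ^ p then 0 else n)" for n
  define Q where "Q i s' \<longleftrightarrow> reg s' 1 = 1 \<and> reg s' 2 = 0 \<and> reg s' 6 = i \<and> arr s' (Work 3) 0 = \<rho> \<and>
    arr s' (Work 7) 0 = \<alpha> * \<rho> ^ i \<and> arr s' (Work 0) = D \<and>
    (\<forall>n. arr s' (Value e) n = arr s (Value e) n + (if n < i then \<alpha> * \<rho> ^ n * D n else 0))"
    for i and s' :: "'v array_name state"
  show "runs (CConst (Work 3, 2) (\<i> * of_real w) ;; CMul (Work 3, 2) (Work 3, 2) (Work 6, 2) ;;
     CExp (Work 3, 2) (Work 3, 2) ;; CConst (Work 7, 2) \<alpha> ;; CCopy (Work 0, 0) (Work 0, 2) ;; RConst 6 0)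
     s 6 (\<lambda>s'. Q 0 s' \<and> reg s' 5 = 2 ^ p + 1)"
    using s by (auto simp: basic_exec ready_def Q_def \<rho>_def D_def)
  let ?body = "CMul (Work 4, 2) (Work 7, 2) (Work 0, 6) ;; CAdd (Value e, 6) (Value e, 6) (Work 4, 2) ;;
     CMul (Work 7, 2) (Work 7, 2) (Work 3, 2) ;; RAdd 6 6 1"
  fix s1 assume s1: "Q 0 s1 \<and> reg s1 5 = 2 ^ p + 1"
  have "runs (Loop 5 ?body) s1 (6 + 5 * 2 ^ p) (Q (2 ^ p + 1))"
  proof (rule runs_Loop[where t = 4 and Inv = Q])
    fix i s2 assume "Q i s2"
    then show "runs ?body s2 4 (Q (Suc i))"
      by (auto simp: basic_exec Q_def less_Suc_eq)
  qed (use s1 in auto)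
  then show "runs (Loop 5 ?body) s1 (6 + 5 * 2 ^ p) (\<lambda>s'. \<forall>n\<le>2 ^ p. arr s' (Value e) n =
    arr s (Value e) n + \<alpha> * exp (\<i> * of_real w * one_half ^ p) ^ n * arr s (Work 0) (if n = 2 ^ p then 0 else n))"
    by (rule runs_mono) (auto simp: Q_def \<rho>_def D_def)
qed simp

definition mode_prog ::
  "real \<Rightarrow> nat \<Rightarrow> nat \<Rightarrow> nat \<Rightarrow> 'v set \<Rightarrow> complex \<Rightarrow> real \<Rightarrow> 'v array_name com" where
  "mode_prog w k l n e \<alpha> \<sigma> = count_prog w ;; fill_prog k l n ;; fft_prog \<sigma> ;; emit_prog e \<alpha> (\<sigma> * w)"

definition mode_term ::
  "'v array_name state \<Rightarrow> nat \<Rightarrow> real \<Rightarrow> nat \<Rightarrow> nat \<Rightarrow> nat \<Rightarrow> complex \<Rightarrow> real \<Rightarrow> nat \<Rightarrow> complex" where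
  "mode_term s p w k l n \<alpha> \<sigma> i = \<alpha> * exp (\<i> * of_real (\<sigma> * w) * one_half ^ p) ^ i *
     (\<Sum>m<2 ^ p. filled s k l n (mode_count w p) m *
        root_of_unity \<sigma> p ^ (m * (if i = 2 ^ p then 0 else i)))"

definition same_inputs :: "'v array_name state \<Rightarrow> 'v array_name state \<Rightarrow> bool" where
  "same_inputs s s' \<longleftrightarrow> (\<forall>j. arr s' (Coeff0 j) = arr s (Coeff0 j)) \<and>
     (\<forall>k j. arr s' (Coeff k j) = arr s (Coeff k j)) \<and>
     (\<forall>k j l. arr s' (BstarB k j l) = arr s (BstarB k j l))"

lemma written_progs:
  "written_regs (halve r h) = {h, 15, 16}" "written_arrays (halve r h) = {}"
  "written_regs (count_prog w) = {7, 15}" "written_arrays (count_prog w) = {}"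
  "written_regs (fill_prog k l n) = {6, 16}" "written_arrays (fill_prog k l n) \<subseteq> {Work 0, Work 1}"
  "written_regs (fft_prog \<sigma>) \<inter> {..5} = {}"
  "written_arrays (fft_prog \<sigma>) = {Work 0, Work 1, Work 2, Work 3, Work 4, Work 5, Work 8}"
  "written_regs (emit_prog e \<alpha> w) = {6}"
  "written_arrays (emit_prog e \<alpha> w) = {Work 0, Work 3, Work 4, Work 7, Value e}"
  by (auto simp: halve_def count_prog_def fill_prog_def fft_prog_def fft_stage_prog_def
      butterfly_def emit_prog_def written_seqs)

lemma runs_mode:
  fixes s :: "'v array_name state"
  assumes s: "ready p s" and \<sigma>: "\<sigma> = 1 \<or> \<sigma> = - 1"
  shows "runs (mode_prog w k l n e \<alpha> \<sigma>) s ((2 * n + 61) * (2 ^ p * (p + 1)))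
    (\<lambda>s'. ready p s' \<and> same_inputs s s' \<and> (\<forall>e' i. i \<le> 2 ^ p \<longrightarrow>
      arr s' (Value e') i = arr s (Value e') i + (if e' = e then mode_term s p w k l n \<alpha> \<sigma> i else 0)))"
  unfolding mode_prog_def
proof (rule runs_Seq)
  define P where "P s' \<longleftrightarrow> ready p s' \<and> same_inputs s s' \<and> (\<forall>e. arr s' (Value e) = arr s (Value e))"
    for s' :: "'v array_name state"
  have P: "P s'" if "P s0" "same_outside c s0 s'" "written_regs c \<inter> {..5} = {}"
    "written_arrays c \<subseteq> {Work 0, Work 1, Work 2, Work 3, Work 4, Work 5, Work 8}" for c s0 s'
  proof -
    have "ready p s'" using that by (intro ready_frame[OF _ that(2)]) (auto simp: P_def)
    moreover have "arr s' a = arr s0 a" if "\<forall>i. a \<noteq> Work i" for a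
      using \<open>same_outside c s0 s'\<close> \<open>written_arrays c \<subseteq> _\<close> that unfolding same_outside_def by blast
    ultimately show ?thesis using that(1) by (simp add: P_def same_inputs_def)
  qed
  have "P s" using s by (simp add: P_def same_inputs_def)
  let ?M = "mode_count w p"
  show "runs (count_prog w) s 3 (\<lambda>s'. P s' \<and> reg s' 7 = ?M)"
    by (rule runs_frame[OF runs_count[OF s]]) (use P[OF \<open>P s\<close>] in \<open>auto simp: written_progs\<close>)
  fix s1 assume s1: "P s1 \<and> reg s1 7 = ?M"
  show "runs (fill_prog k l n ;; fft_prog \<sigma> ;; emit_prog e \<alpha> (\<sigma> * w)) s1
     ((2 + 2 ^ p * (2 * n + 5)) + (34 * (2 ^ p * (p + 1)) + (12 + 5 * 2 ^ p)))
    (\<lambda>s'. ready p s' \<and> same_inputs s s' \<and> (\<forall>e' i. i \<le> 2 ^ p \<longrightarrow>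
      arr s' (Value e') i = arr s (Value e') i + (if e' = e then mode_term s p w k l n \<alpha> \<sigma> i else 0)))"
  proof (rule runs_Seq)
    show "runs (fill_prog k l n) s1 (2 + 2 ^ p * (2 * n + 5))
      (\<lambda>s'. P s' \<and> (\<forall>m<2 ^ p. arr s' (Work 0) m = filled s k l n ?M m))"
    proof (rule runs_frame[OF runs_fill])
      fix s' assume *: "same_outside (fill_prog k l n) s1 s'"
        "\<forall>m<2 ^ p. arr s' (Work 0) m = filled s1 k l n (reg s1 7) m"
      have "P s'" by (rule P[OF _ *(1)]) (use s1 written_progs(6) in \<open>auto simp: written_progs(5)\<close>)
      moreover have "filled s1 k l n ?M m = filled s k l n ?M m" for m
        using s1 by (simp add: filled_def P_def same_inputs_def)
      ultimately show "P s' \<and> (\<forall>m<2 ^ p. arr s' (Work 0) m = filled s k l n ?M m)"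
        using * s1 by simp
    qed (use s1 in \<open>auto simp: P_def ready_def\<close>)
    fix s2 assume s2: "P s2 \<and> (\<forall>m<2 ^ p. arr s2 (Work 0) m = filled s k l n ?M m)"
    let ?Y = "\<lambda>i. \<Sum>m<2 ^ p. filled s k l n ?M m * root_of_unity \<sigma> p ^ (m * i)"
    show "runs (fft_prog \<sigma> ;; emit_prog e \<alpha> (\<sigma> * w)) s2 (34 * (2 ^ p * (p + 1)) + (12 + 5 * 2 ^ p))
      (\<lambda>s'. ready p s' \<and> same_inputs s s' \<and> (\<forall>e' i. i \<le> 2 ^ p \<longrightarrow>
      arr s' (Value e') i = arr s (Value e') i + (if e' = e then mode_term s p w k l n \<alpha> \<sigma> i else 0)))"
    proof (rule runs_Seq)
      have "ready p s2" using s2 by (simp add: P_def)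
      then show "runs (fft_prog \<sigma>) s2 (34 * (2 ^ p * (p + 1))) (\<lambda>s'. P s' \<and> (\<forall>i<2 ^ p. arr s' (Work 0) i = ?Y i))"
      proof (rule runs_frame[OF runs_fft[where a = "filled s k l n ?M", OF _ _ \<sigma>]])
        fix s' assume *: "same_outside (fft_prog \<sigma>) s2 s'" "\<forall>i<2 ^ p. arr s' (Work 0) i = ?Y i"
        have "P s'" by (rule P[OF _ *(1)]) (use s2 in \<open>auto simp: written_progs\<close>)
        with * show "P s' \<and> (\<forall>i<2 ^ p. arr s' (Work 0) i = ?Y i)" by simp
      qed (use s2 in auto)
      fix s3 assume s3: "P s3 \<and> (\<forall>i<2 ^ p. arr s3 (Work 0) i = ?Y i)"
      then have "ready p s3" by (simp add: P_def)
      then show "runs (emit_prog e \<alpha> (\<sigma> * w)) s3 (12 + 5 * 2 ^ p) (\<lambda>s'. ready p s' \<and> same_inputs s s' \<and> (\<forall>e' i. i \<le> 2 ^ p \<longrightarrow>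
        arr s' (Value e') i = arr s (Value e') i + (if e' = e then mode_term s p w k l n \<alpha> \<sigma> i else 0)))"
      proof (rule runs_frame[OF runs_emit])
        fix s' assume *: "same_outside (emit_prog e \<alpha> (\<sigma> * w)) s3 s'"
          "\<forall>i\<le>2 ^ p. arr s' (Value e) i = arr s3 (Value e) i +
             \<alpha> * exp (\<i> * of_real (\<sigma> * w) * one_half ^ p) ^ i * arr s3 (Work 0) (if i = 2 ^ p then 0 else i)"
        have "ready p s'"
          by (rule ready_frame[OF \<open>ready p s3\<close> *(1)]) (auto simp: written_progs)
        moreover have "same_inputs s s'"
          using s3 *(1) by (simp add: P_def same_inputs_def same_outside_def written_progs)
        moreover have "arr s' (Value e') = arr s (Value e')" if "e' \<noteq> e" for e'
          using s3 *(1) that by (simp add: P_def same_outside_def written_progs)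
        moreover have "arr s' (Value e) i = arr s (Value e) i + mode_term s p w k l n \<alpha> \<sigma> i" if "i \<le> 2 ^ p" for i
          using s3 *(2) that by (simp add: P_def mode_term_def)
        ultimately show "ready p s' \<and> same_inputs s s' \<and> (\<forall>e' i. i \<le> 2 ^ p \<longrightarrow>
          arr s' (Value e') i = arr s (Value e') i + (if e' = e then mode_term s p w k l n \<alpha> \<sigma> i else 0))"
          by simp
      qed simp
    qed simp
  qed simp
next
  \<comment> \<open>With 1 and 2 ^ p bounded by X, the constant is 61 = 3 + 2 + 5 + 34 + 12 +
    5.\<close>
  define X :: nat where "X = 2 ^ p * (p + 1)"
  have "2 ^ p \<le> X" "(1::nat) \<le> 2 ^ p" by (simp_all add: X_def)
  then have X: "2 ^ p \<le> X" "1 \<le> X" by linarith+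
  have "2 ^ p * (2 * n + 5) \<le> X * (2 * n + 5)" by (rule mult_right_mono[OF X(1)]) simp
  then show "3 + ((2 + 2 ^ p * (2 * n + 5)) + (34 * (2 ^ p * (p + 1)) + (12 + 5 * 2 ^ p)))
    \<le> (2 * n + 61) * (2 ^ p * (p + 1))"
    unfolding X_def[symmetric] using X by (simp add: algebra_simps)
qed


section \<open>The zero frequency and the assembled program\<close>

definition init_prog :: "(nat \<Rightarrow> complex) \<Rightarrow> nat \<Rightarrow> 'v set \<Rightarrow> 'v array_name com" where
  "init_prog c n e = CConst (Work 4, 2) 0 ;;
     seqs (map (\<lambda>j. CConst (Work 8, 2) (c j) ;; CMul (Work 8, 2) (Coeff0 j, 2) (Work 8, 2) ;;
                     CAdd (Work 4, 2) (Work 4, 2) (Work 8, 2)) [0..<n]) ;;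
     RConst 6 0 ;; Loop 5 (CCopy (Value e, 6) (Work 4, 2) ;; RAdd 6 6 1)"

text \<open>Functions in E(0) are constant on an edge, so one number per edge suffices for the zero
  frequency. Writing it to all N + 1 cells also erases the arbitrary initial contents of the output,
  to which the tasks then add.\<close>

lemma runs_init:
  fixes s :: "'v array_name state"
  assumes s: "ready p s"
  shows "runs (init_prog c n e) s ((3 * n + 10) * (2 ^ p * (p + 1)))
    (\<lambda>s'. \<forall>i\<le>2 ^ p. arr s' (Value e) i = (\<Sum>j<n. arr s (Coeff0 j) 0 * c j))"
  unfolding init_prog_def
proof (rule runs_Seq)
  define x where "x = (\<Sum>j<n. arr s (Coeff0 j) 0 * c j)"
  define R where "R s' \<longleftrightarrow> reg s' 1 = 1 \<and> reg s' 2 = 0 \<and> reg s' 5 = 2 ^ p + 1 \<and>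
    (\<forall>j. arr s' (Coeff0 j) = arr s (Coeff0 j))" for s' :: "'v array_name state"
  let ?body = "\<lambda>j. CConst (Work 8, 2) (c j) ;; CMul (Work 8, 2) (Coeff0 j, 2) (Work 8, 2) ;;
    CAdd (Work 4, 2) (Work 4, 2) (Work 8, 2)"
  let ?copy = "CCopy (Value e, 6) (Work 4, 2) ;; RAdd 6 6 1"
  show "runs (CConst (Work 4, 2) 0) s 1 (\<lambda>s'. R s' \<and> arr s' (Work 4) 0 = 0)"
    using s by (simp add: basic_exec R_def ready_def)
  fix s1 assume s1: "R s1 \<and> arr s1 (Work 4) 0 = 0"
  show "runs (seqs (map ?body [0..<n]) ;; RConst 6 0 ;; Loop 5 ?copy) s1 ((3 * n + 1) + (1 + (4 + 3 * 2 ^ p)))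
    (\<lambda>s'. \<forall>i\<le>2 ^ p. arr s' (Value e) i = (\<Sum>j<n. arr s (Coeff0 j) 0 * c j))"
  proof (rule runs_Seq)
    have "runs (seqs (map ?body [0..<n])) s1 (length [0..<n] * 3 + 1)
      (\<lambda>s'. R s' \<and> arr s' (Work 4) 0 = (\<Sum>j\<leftarrow>[0..<n]. arr s (Coeff0 j) 0 * c j))"
      by (rule runs_seqs) (use s1 in \<open>auto simp: basic_exec R_def\<close>)
    then show "runs (seqs (map ?body [0..<n])) s1 (3 * n + 1) (\<lambda>s'. R s' \<and> arr s' (Work 4) 0 = x)"
      by (rule runs_mono) (auto simp: x_def interv_sum_list_conv_sum_set_nat atLeast0LessThan)
    fix s2 assume s2: "R s2 \<and> arr s2 (Work 4) 0 = x"
    show "runs (RConst 6 0 ;; Loop 5 ?copy) s2 (1 + (4 + 3 * 2 ^ p))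
      (\<lambda>s'. \<forall>i\<le>2 ^ p. arr s' (Value e) i = (\<Sum>j<n. arr s (Coeff0 j) 0 * c j))"
    proof (rule runs_Seq)
      define Q where "Q i s' \<longleftrightarrow> R s' \<and> arr s' (Work 4) 0 = x \<and> reg s' 6 = i \<and>
        (\<forall>j<i. arr s' (Value e) j = x)" for i and s' :: "'v array_name state"
      show "runs (RConst 6 0) s2 1 (Q 0)" using s2 by (simp add: basic_exec Q_def R_def)
      fix s3 assume s3: "Q 0 s3"
      have "runs (Loop 5 ?copy) s3 (4 + 3 * 2 ^ p) (Q (2 ^ p + 1))"
      proof (rule runs_Loop[where t = 2 and Inv = Q])
        fix i s4 assume "Q i s4"
        then show "runs ?copy s4 2 (Q (Suc i))" by (auto simp: basic_exec Q_def R_def less_Suc_eq)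
      qed (use s3 in \<open>auto simp: Q_def R_def\<close>)
      then show "runs (Loop 5 ?copy) s3 (4 + 3 * 2 ^ p)
        (\<lambda>s'. \<forall>i\<le>2 ^ p. arr s' (Value e) i = (\<Sum>j<n. arr s (Coeff0 j) 0 * c j))"
        by (rule runs_mono) (auto simp: Q_def x_def)
    qed simp
  qed simp
next
  define X :: nat where "X = 2 ^ p * (p + 1)"
  have "2 ^ p \<le> X" "(1::nat) \<le> 2 ^ p" by (simp_all add: X_def)
  then have "2 ^ p \<le> X" "1 \<le> X" by linarith+
  moreover from this have "3 * n * 1 \<le> 3 * n * X" by (intro mult_left_mono) auto
  moreover have "(3 * n + 10) * X = 3 * n * X + 10 * X" by (simp add: algebra_simps)
  ultimately show "1 + (3 * n + 1 + (1 + (4 + 3 * 2 ^ p))) \<le> (3 * n + 10) * (2 ^ p * (p + 1))"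
    unfolding X_def[symmetric] by linarith
qed

text \<open>A task (edge, (k, l), flag) stands for one exponential on one edge: the flag
  \<open>True\<close> selects the amplitude \<open>A\<close> and the sign +1, \<open>False\<close>
  the amplitude \<open>B\<close> and -1. Neither the list of tasks nor the bound \<open>J\<close>
  refers to N.\<close>

locale inverse_program =
  fixes es :: "'v set list" and ts :: "('v set \<times> (nat \<times> nat) \<times> bool) list"
    and c :: "'v set \<Rightarrow> nat \<Rightarrow> complex" and I0 J :: nat and I :: "nat \<Rightarrow> nat" and \<omega> :: "nat \<Rightarrow> real"
    and A B :: "nat \<Rightarrow> nat \<Rightarrow> 'v set \<Rightarrow> complex"
  assumes J: "\<And>e k l b. (e, (k, l), b) \<in> set ts \<Longrightarrow> I k \<le> J"
begin

fun task_prog :: "'v set \<times> (nat \<times> nat) \<times> bool \<Rightarrow> 'v array_name com" where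
  "task_prog (e, (k, l), b) =
     mode_prog (\<omega> k) k l (I k) e (if b then A k l e else B k l e) (if b then 1 else - 1)"

fun task_term ::
  "'v array_name state \<Rightarrow> nat \<Rightarrow> 'v set \<times> (nat \<times> nat) \<times> bool \<Rightarrow> nat \<Rightarrow> complex" where
  "task_term s p (e, (k, l), b) i =
     mode_term s p (\<omega> k) k l (I k) (if b then A k l e else B k l e) (if b then 1 else - 1) i"

definition prog :: "'v array_name com" where
  "prog = setup_prog ;; seqs (map (\<lambda>e. init_prog (c e) I0 e) es) ;; seqs (map task_prog ts)"

text \<open>The constant 22 is 20 for the setup and 1 for the closing \<open>skip\<close> of each of
  the two sequences.\<close>

definition cost :: nat where
  "cost = 22 + length es * (3 * I0 + 10) + length ts * (2 * J + 61)"

lemma task_term_cong: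
  assumes "same_inputs s s'"
  shows "task_term s' p t i = task_term s p t i"
proof -
  obtain e k l b where "t = (e, (k, l), b)" by (metis prod.exhaust)
  moreover have "filled s' = filled s" using assms by (simp add: filled_def same_inputs_def fun_eq_iff)
  ultimately show ?thesis by (simp add: mode_term_def)
qed

lemma runs_prog:
  fixes s :: "'v array_name state"
  assumes s: "reg s 0 = 2 ^ p"
  shows "runs prog s (cost * (2 ^ p * (p + 1))) (\<lambda>s'. \<forall>e\<in>set es. \<forall>i\<le>2 ^ p. arr s' (Value e) i =
    (\<Sum>j<I0. arr s (Coeff0 j) 0 * c e j) + (\<Sum>t\<leftarrow>ts. if fst t = e then task_term s p t i else 0))"
proof -
  define X :: nat where "X = 2 ^ p * (p + 1)"
  define R where "R s' \<longleftrightarrow> ready p s' \<and> same_inputs s s'" for s' :: "'v array_name state"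
  define x where "x e = (\<Sum>j<I0. arr s (Coeff0 j) 0 * c e j)" for e
  have R16: "R (set_reg 16 0 s')" if "R s'" for s' :: "'v array_name state"
    using that by (simp add: R_def ready_def same_inputs_def set_reg_def)
  show ?thesis
    unfolding prog_def
  proof (rule runs_Seq)
    show "runs setup_prog s (20 * 2 ^ p) R"
    proof (rule runs_frame[OF runs_setup[OF s]])
      fix s' assume "same_outside setup_prog s s'" "ready p s'"
      then show "R s'"
        by (simp add: R_def same_inputs_def same_outside_def setup_prog_def written_progs)
    qed simp
    fix s1 assume s1: "R s1"
    show "runs (seqs (map (\<lambda>e. init_prog (c e) I0 e) es) ;; seqs (map task_prog ts)) s1
        ((length es * ((3 * I0 + 10) * X) + 1) + (length ts * ((2 * J + 61) * X) + 1))
      (\<lambda>s'. \<forall>e\<in>set es. \<forall>i\<le>2 ^ p. arr s' (Value e) i =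
      (\<Sum>j<I0. arr s (Coeff0 j) 0 * c e j) + (\<Sum>t\<leftarrow>ts. if fst t = e then task_term s p t i else 0))"
    proof (rule runs_Seq)
      define Q where "Q ys s' \<longleftrightarrow> R s' \<and> (\<forall>e\<in>set ys. \<forall>i\<le>2 ^ p. arr s' (Value e) i = x e)"
        for ys and s' :: "'v array_name state"
      show "runs (seqs (map (\<lambda>e. init_prog (c e) I0 e) es)) s1 (length es * ((3 * I0 + 10) * X) + 1) (Q es)"
      proof (rule runs_seqs)
        show "Q [] s1" using s1 by (simp add: Q_def)
        show "Q es (set_reg 16 0 s')" if "Q es s'" for s'
          using that R16[of s'] by (simp add: Q_def set_reg_def)
        fix ys e zs s2 assume s2: "Q ys s2"
        then have "ready p s2" by (simp add: Q_def R_def)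
        then show "runs (init_prog (c e) I0 e) s2 ((3 * I0 + 10) * X) (Q (ys @ [e]))"
          unfolding X_def
        proof (rule runs_frame[OF runs_init])
          fix s' assume *: "same_outside (init_prog (c e) I0 e) s2 s'"
            "\<forall>i\<le>2 ^ p. arr s' (Value e) i = (\<Sum>j<I0. arr s2 (Coeff0 j) 0 * c e j)"
          have w: "written_regs (init_prog (c e) I0 e) = {6, 16}"
            "written_arrays (init_prog (c e) I0 e) \<subseteq> {Work 4, Work 8, Value e}"
            by (auto simp: init_prog_def written_seqs)
          have "ready p s'"
            by (rule ready_frame[OF \<open>ready p s2\<close> *(1)]) (use w in auto)
          moreover have same: "arr s' a = arr s2 a" if "\<forall>i. a \<noteq> Work i" "a \<noteq> Value e" for a
            using *(1) w(2) that unfolding same_outside_def by blast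
          moreover have "\<forall>i\<le>2 ^ p. arr s' (Value e) i = x e"
            using * s2 by (simp add: x_def Q_def R_def same_inputs_def)
          moreover have "arr s' (Value e') i = x e'" if "e' \<in> set ys" "i \<le> 2 ^ p" for e' i
            using that s2 same[of "Value e'"] \<open>\<forall>i\<le>2 ^ p. arr s' (Value e) i = x e\<close>
            by (cases "e' = e") (auto simp: Q_def)
          ultimately show "Q (ys @ [e]) s'"
            using s2 by (auto simp: Q_def R_def same_inputs_def)
        qed simp
      qed
      fix s2 assume s2: "Q es s2"
      define Q' where "Q' ys s' \<longleftrightarrow> R s' \<and> (\<forall>e\<in>set es. \<forall>i\<le>2 ^ p. arr s' (Value e) i =
        x e + (\<Sum>t\<leftarrow>ys. if fst t = e then task_term s p t i else 0))"
        for ys and s' :: "'v array_name state"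
      have "runs (seqs (map task_prog ts)) s2 (length ts * ((2 * J + 61) * X) + 1) (Q' ts)"
      proof (rule runs_seqs)
        show "Q' [] s2" using s2 by (simp add: Q_def Q'_def)
        show "Q' ts (set_reg 16 0 s')" if "Q' ts s'" for s'
          using that R16[of s'] by (simp add: Q'_def set_reg_def)
        fix ys t zs s3 assume ts: "ts = ys @ t # zs" and s3: "Q' ys s3"
        obtain e k l b where t: "t = (e, (k, l), b)" by (metis prod.exhaust)
        have "I k \<le> J" using J[of e k l b] by (simp add: ts t)
        have "ready p s3" using s3 by (simp add: Q'_def R_def)
        then have "runs (task_prog t) s3 ((2 * I k + 61) * X)
          (\<lambda>s'. ready p s' \<and> same_inputs s3 s' \<and> (\<forall>e' i. i \<le> 2 ^ p \<longrightarrow>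
             arr s' (Value e') i = arr s3 (Value e') i + (if e' = e then task_term s3 p t i else 0)))"
          unfolding t task_prog.simps task_term.simps X_def by (rule runs_mode) auto
        then show "runs (task_prog t) s3 ((2 * J + 61) * X) (Q' (ys @ [t]))"
        proof (rule runs_mono)
          show "(2 * I k + 61) * X \<le> (2 * J + 61) * X" using \<open>I k \<le> J\<close> by (intro mult_le_mono) auto
          fix s' assume *: "ready p s' \<and> same_inputs s3 s' \<and> (\<forall>e' i. i \<le> 2 ^ p \<longrightarrow>
             arr s' (Value e') i = arr s3 (Value e') i + (if e' = e then task_term s3 p t i else 0))"
          have "same_inputs s s3" using s3 by (simp add: Q'_def R_def)
          then have "same_inputs s s'" "task_term s3 p t i = task_term s p t i" for i
            using * task_term_cong by (auto simp: same_inputs_def)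
          with * s3 show "Q' (ys @ [t]) s'"
            by (auto simp: Q'_def R_def t)
        qed
      qed
      then show "runs (seqs (map task_prog ts)) s2 (length ts * ((2 * J + 61) * X) + 1)
        (\<lambda>s'. \<forall>e\<in>set es. \<forall>i\<le>2 ^ p. arr s' (Value e) i =
          (\<Sum>j<I0. arr s (Coeff0 j) 0 * c e j) + (\<Sum>t\<leftarrow>ts. if fst t = e then task_term s p t i else 0))"
        by (rule runs_mono) (auto simp: Q'_def x_def)
    qed simp
  next
    have "2 ^ p \<le> X" "(1::nat) \<le> 2 ^ p" by (simp_all add: X_def)
    then have "2 ^ p \<le> X" "1 \<le> X" by linarith+
    then show "20 * 2 ^ p + ((length es * ((3 * I0 + 10) * X) + 1) + (length ts * ((2 * J + 61) * X) + 1))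
      \<le> cost * (2 ^ p * (p + 1))"
      unfolding X_def[symmetric] cost_def by (simp add: algebra_simps)
  qed
qed

end

section \<open>Correctness of the output and the asymptotic bound\<close>

lemma mode_count_iff:
  assumes w: "0 < w" "w \<le> 2 * pi"
  shows "w + 2 * real m * pi \<le> real (2 ^ p) * pi \<longleftrightarrow> m < mode_count w p"
proof (cases p)
  case 0
  have "pi < w + 2 * real m * pi" if "m \<noteq> 0"
  proof -
    have "1 * pi \<le> real m * pi" using that by (intro mult_right_mono) auto
    moreover have "2 * real m * pi = real m * pi + real m * pi" by simp
    ultimately show ?thesis using w pi_gt_zero by linarith
  qed
  then have "w + 2 * real m * pi \<le> pi \<longleftrightarrow> m = 0 \<and> w \<le> pi"
    by (cases "m = 0") (simp_all add: not_le)
  then show ?thesis using 0 by (simp add: mode_count_def)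
next
  case (Suc q)
  have N: "real (2 ^ p) * pi = 2 * (2 ^ q) * pi" "mode_count w p = 2 ^ q"
    using Suc by (simp_all add: mode_count_def)
  show ?thesis
  proof
    assume "w + 2 * real m * pi \<le> real (2 ^ p) * pi"
    then have "2 * real m * pi < 2 * (2 ^ q) * pi" using w N by linarith
    then have "real m < real (2 ^ q)" by simp
    then show "m < mode_count w p" unfolding N by (simp only: of_nat_less_iff)
  next
    assume "m < mode_count w p"
    then have "real (m + 1) \<le> real (2 ^ q)" unfolding N of_nat_le_iff by simp
    then have "2 * real (m + 1) * pi \<le> 2 * real (2 ^ q) * pi" by simp
    then show "w + 2 * real m * pi \<le> real (2 ^ p) * pi" using w N by (simp add: algebra_simps)
  qed
qed

lemma mode_count_le: "mode_count w p \<le> 2 ^ p"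
  by (simp add: mode_count_def)

text \<open>The phase of the base frequency at i / N times the power m i of the root of unity is the
  exponential of frequency w + 2 m pi at i / N. Periodicity removes the special case i = N, and the
  padded terms vanish.\<close>

lemma mode_term_eq:
  assumes \<sigma>: "\<sigma> = 1 \<or> \<sigma> = - 1" and i: "i \<le> 2 ^ p"
  shows "mode_term s p w k l n \<alpha> \<sigma> i = (\<Sum>m<mode_count w p.
    (\<Sum>j<n. arr s (BstarB k j l) m * arr s (Coeff k j) m) *
      (\<alpha> * cis (\<sigma> * ((w + 2 * real m * pi) * (real i / real (2 ^ p))))))"
proof -
  have "exp (2 * \<i> * of_real pi) = 1" using exp_two_pi_i by (simp add: ac_simps)
  then have "root_of_unity \<sigma> p ^ (2 ^ p) = 1"
    unfolding root_of_unity_power using \<sigma> by (auto simp: exp_minus)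
  then have per: "root_of_unity \<sigma> p ^ (m * (if i = 2 ^ p then 0 else i)) = root_of_unity \<sigma> p ^ (m * i)" for m
    by (simp add: mult.commute[of m] power_mult)
  have phase: "exp (\<i> * of_real (\<sigma> * w) * one_half ^ p) ^ i * root_of_unity \<sigma> p ^ (m * i) =
    cis (\<sigma> * ((w + 2 * real m * pi) * (real i / real (2 ^ p))))" for m
    unfolding root_of_unity_def cis_conv_exp exp_of_nat_mult[symmetric] exp_add[symmetric]
    by (rule arg_cong[where f = exp]) (simp add: one_half_def field_simps)
  have "mode_term s p w k l n \<alpha> \<sigma> i = (\<Sum>m<2 ^ p. filled s k l n (mode_count w p) m *
      (\<alpha> * cis (\<sigma> * ((w + 2 * real m * pi) * (real i / real (2 ^ p))))))"
    unfolding mode_term_def per phase[symmetric] sum_distrib_left by (simp add: ac_simps)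
  also have "\<dots> = (\<Sum>m<mode_count w p. filled s k l n (mode_count w p) m *
      (\<alpha> * cis (\<sigma> * ((w + 2 * real m * pi) * (real i / real (2 ^ p))))))"
    using mode_count_le[of w p] by (intro sum.mono_neutral_right) (auto simp: filled_def)
  finally show ?thesis by (simp add: filled_def)
qed

lemma linearithmic_bigo:
  "(\<lambda>N. real (C * (N * (nat \<lfloor>log 2 (real N)\<rfloor> + 1)))) \<in> O(\<lambda>N. real N * log 2 (real N))"
proof (rule bigoI)
  show "\<forall>\<^sub>F N in sequentially. norm (real (C * (N * (nat \<lfloor>log 2 (real N)\<rfloor> + 1)))) \<le>
    (real C * 2) * norm (real N * log 2 (real N))"
    using eventually_ge_at_top[of 2]
  proof eventually_elim
    case (elim N)
    then have "1 \<le> log 2 (real N)" by simp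
    then have "real (nat \<lfloor>log 2 (real N)\<rfloor> + 1) \<le> 2 * log 2 (real N)" by linarith
    then have "real C * (real N * real (nat \<lfloor>log 2 (real N)\<rfloor> + 1)) \<le> real C * (real N * (2 * log 2 (real N)))"
      by (intro mult_left_mono) auto
    then show ?case using \<open>1 \<le> log 2 (real N)\<close> by (simp add: abs_mult algebra_simps)
  qed
qed

theorem theorem4p3:
  fixes G :: "'v fgraph"
    and K I0 :: nat and I :: "nat \<Rightarrow> nat" and \<omega> :: "nat \<Rightarrow> real"
    and \<Psi>0 :: "nat \<Rightarrow> 'v point \<Rightarrow> complex"
    and \<Psi> :: "nat \<Rightarrow> nat \<Rightarrow> nat \<Rightarrow> 'v point \<Rightarrow> complex"
    and A B :: "nat \<Rightarrow> nat \<Rightarrow> 'v set \<Rightarrow> complex"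
  assumes graph: "finite_simple_graph G"
    and deg: "\<And>v. v \<in> verts G \<Longrightarrow> 2 \<le> vdegree G v"
    and \<omega>_mono: "strict_mono_on {..<K} \<omega>"
    and \<omega>_range: "\<omega> ` {..<K} = {w. 0 < w \<and> w \<le> 2 * pi \<and> is_eigenvalue G (w\<^sup>2)}"
    and basis0: "orthonormal_basis (points G) (inner_inf G) (eigenspace G 0) I0 \<Psi>0"
    and basis: "\<And>k. k < K \<Longrightarrow>
      orthonormal_basis (points G) (inner_inf G) (eigenspace G ((\<omega> k)\<^sup>2)) (I k) (\<Psi> 0 k)"
    and exps: "\<And>m k j e x. k < K \<Longrightarrow> j < I k \<Longrightarrow> e \<in> edges G \<Longrightarrow> x \<in> {0..1} \<Longrightarrow>
      edge_fun G (\<Psi> m k j) e x =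
        A k j e * exp (\<i> * of_real (freq \<omega> m k * x)) +
        B k j e * exp (- \<i> * of_real (freq \<omega> m k * x))"
  shows "\<exists>(prog :: 'v array_name com) (T :: nat \<Rightarrow> nat).
    (\<lambda>N. real (T N)) \<in> O(\<lambda>N. real N * log 2 (real N)) \<and>
    (\<forall>N p d b f s.
       N = 2 ^ p \<longrightarrow>
       (\<forall>m k. k < K \<longrightarrow> freq \<omega> m k \<le> real N * pi \<longrightarrow>
          orthonormalizes G N (I k) (\<lambda>j. RN G N (\<Psi> m k j)) (d m k) (b m k)) \<longrightarrow>
       f \<in> HN G N \<longrightarrow>
       input_state I0 K I \<omega> N (DFT G N \<Psi>0 \<Psi> f)
         (\<lambda>m k. adjoint_mult (d m k) (b m k)) s \<longrightarrow>
       (case exec prog s of (t, s') \<Rightarrow> t \<le> T N \<and> output_state G N f s'))"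
proof -
  have modes: "graph_modes G N K I0 I \<omega> \<Psi>0 \<Psi> A B" if "0 < N" for N
    using assms that by unfold_locales auto
  \<comment> \<open>The program has to be fixed before N is given. The instance N = 1 provides the
    finiteness of the edge set needed to list the tasks.\<close>
  interpret one: graph_modes G 1 K I0 I \<omega> \<Psi>0 \<Psi> A B by (rule modes) simp
  define S where "S = (SIGMA k:{..<K}. {..<I k})"
  define TS where "TS = edges G \<times> S \<times> (UNIV :: bool set)"
  have "finite S" unfolding S_def by blast
  then have "finite TS" unfolding TS_def using one.finite_edges by (intro finite_cartesian_product) auto
  then obtain ts where ts: "distinct ts" "set ts = TS" using finite_distinct_list by metis
  obtain es where es: "set es = edges G" using finite_list[OF one.finite_edges] by blast
  define c where "c e j = \<Psi>0 j (Vertex (tail G e))" for e j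
  define J where "J = (\<Sum>k<K. I k)"
  interpret P: inverse_program es ts c I0 J I \<omega> A B
  proof
    fix e k l b assume "(e, (k, l), b) \<in> set ts"
    then have "k < K" by (simp add: ts TS_def S_def)
    then show "I k \<le> J" unfolding J_def by (intro member_le_sum) auto
  qed
  \<comment> \<open>The bound must be a function of N alone; for N = 2 ^ p the floor of the
    logarithm returns the exponent p.\<close>
  define T where "T N = P.cost * (N * (nat \<lfloor>log 2 (real N)\<rfloor> + 1))" for N
  have "case exec P.prog s of (t, s') \<Rightarrow> t \<le> T N \<and> output_state G N f s'"
    if N: "N = 2 ^ p"
      and orth: "\<forall>m k. k < K \<longrightarrow> freq \<omega> m k \<le> real N * pi \<longrightarrow>
          orthonormalizes G N (I k) (\<lambda>j. RN G N (\<Psi> m k j)) (d m k) (b m k)"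
      and f: "f \<in> HN G N"
      and s: "input_state I0 K I \<omega> N (DFT G N \<Psi>0 \<Psi> f) (\<lambda>m k. adjoint_mult (d m k) (b m k)) s"
    for N p d b f s
  proof -
    interpret graph_modes G N K I0 I \<omega> \<Psi>0 \<Psi> A B by (rule modes) (simp add: N)
    let ?F = "DFT G N \<Psi>0 \<Psi> f"
    have mode_iff: "freq \<omega> m k \<le> real N * pi \<longleftrightarrow> m < mode_count (\<omega> k) p" if "k < K" for m k
      unfolding freq_def N using \<omega>_bounds[OF that] by (intro mode_count_iff) auto
    have inputs: "arr s (Coeff0 j) 0 = ?F (Zero j)" if "j < I0" for j
      using s that by (simp add: input_state_def dft_indices_def)
    have inputs': "arr s (Coeff k j) m = ?F (Mode m k j)"
      "l < I k \<Longrightarrow> arr s (BstarB k j l) m = adjoint_mult (d m k) (b m k) j l"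
      if "k < K" "m < mode_count (\<omega> k) p" "j < I k" for k m j l
      using s that mode_iff[OF that(1), of m] by (simp_all add: input_state_def dft_indices_def)
    have recovered: "(\<Sum>j<I0. arr s (Coeff0 j) 0 * c e j) + (\<Sum>t\<leftarrow>ts. if fst t = e then P.task_term s p t i else 0) =
      f (coord G e (real i / real N))" if e: "e \<in> edges G" and i: "i \<le> N" for e i
    proof -
      let ?C = "\<lambda>m k l. \<Sum>j<I k. adjoint_mult (d m k) (b m k) j l * ?F (Mode m k j)"
      let ?W = "\<lambda>m k l. wave (freq \<omega> m k) (A k l e) (B k l e) (real i / real N)"
      \<comment> \<open>The two signs of a task together make up the full wave, so the sum over
        tasks can be matched with the inversion formula.\<close>
      have pair: "P.task_term s p (e, (k, l), True) i + P.task_term s p (e, (k, l), False) i =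
        (\<Sum>m<mode_count (\<omega> k) p. ?C m k l * ?W m k l)" if kl: "k < K" "l < I k" for k l
      proof -
        have C: "(\<Sum>j<I k. arr s (BstarB k j l) m * arr s (Coeff k j) m) = ?C m k l"
          if "m < mode_count (\<omega> k) p" for m
          using that kl by (intro sum.cong) (auto simp: inputs')
        have "i \<le> 2 ^ p" using i N by simp
        then have single: "P.task_term s p (e, (k, l), b) i = (\<Sum>m<mode_count (\<omega> k) p. ?C m k l *
            ((if b then A k l e else B k l e) *
              cis ((if b then 1 else - 1) * (freq \<omega> m k * (real i / real N)))))" for b
          unfolding P.task_term.simps freq_def N
          by (subst mode_term_eq) (auto intro!: sum.cong simp: C[unfolded N])
        show ?thesis
          using single[of True] single[of False] by (simp add: wave_def distrib_left sum.distrib)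
      qed
      have "(\<Sum>t\<leftarrow>ts. if fst t = e then P.task_term s p t i else 0) =
        (\<Sum>t\<in>TS. if fst t = e then P.task_term s p t i else 0)"
        using ts by (simp add: sum_list_distinct_conv_sum_set)
      also have "\<dots> = (\<Sum>e'\<in>edges G. \<Sum>kl\<in>S. \<Sum>b\<in>UNIV. if e' = e then P.task_term s p (e', kl, b) i else 0)"
        unfolding TS_def sum.cartesian_product
        by (intro sum.cong refl) (simp split: prod.split del: P.task_term.simps)
      also have "\<dots> = (\<Sum>e'\<in>edges G. if e' = e then \<Sum>kl\<in>S. \<Sum>b\<in>UNIV. P.task_term s p (e, kl, b) i else 0)"
        by (intro sum.cong) auto
      also have "\<dots> = (\<Sum>kl\<in>S. \<Sum>b\<in>UNIV. P.task_term s p (e, kl, b) i)"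
        using e finite_edges by simp
      also have "\<dots> = (\<Sum>(k, l)\<in>S. \<Sum>m<mode_count (\<omega> k) p. ?C m k l * ?W m k l)"
        unfolding S_def using pair by (intro sum.cong) (auto simp: UNIV_bool add.commute simp del: P.task_term.simps)
      also have "\<dots> = (\<Sum>k<K. \<Sum>m<mode_count (\<omega> k) p. \<Sum>l<I k. ?C m k l * ?W m k l)"
        unfolding S_def by (subst sum.Sigma[symmetric]) (auto intro: sum.cong sum.swap)
      also have "\<dots> = (\<Sum>(k, m)\<in>(SIGMA k:{..<K}. {..<mode_count (\<omega> k) p}). \<Sum>l<I k. ?C m k l * ?W m k l)"
        by (subst sum.Sigma) auto
      also have "\<dots> = (\<Sum>(m, k)\<in>modes. \<Sum>l<I k. ?C m k l * ?W m k l)"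
        by (rule sum.reindex_bij_witness[of _ "\<lambda>(m, k). (k, m)" "\<lambda>(k, m). (m, k)"])
          (auto simp: modes_def mode_iff)
      finally show ?thesis
        using inversion_formula[of d b f e i] orth f e i by (simp add: inputs c_def)
    qed
    have "runs P.prog s (P.cost * (2 ^ p * (p + 1))) (\<lambda>s'. \<forall>e\<in>set es. \<forall>i\<le>2 ^ p. arr s' (Value e) i =
      (\<Sum>j<I0. arr s (Coeff0 j) 0 * c e j) + (\<Sum>t\<leftarrow>ts. if fst t = e then P.task_term s p t i else 0))"
      by (rule P.runs_prog) (use s N in \<open>simp add: input_state_def\<close>)
    moreover have "T N = P.cost * (2 ^ p * (p + 1))"
      by (simp add: T_def N log_nat_power)
    ultimately show ?thesis
      by (auto simp: runs_def output_state_def es recovered N[symmetric])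
  qed
  moreover have "(\<lambda>N. real (T N)) \<in> O(\<lambda>N. real N * log 2 (real N))"
    unfolding T_def by (rule linearithmic_bigo)
  ultimately show ?thesis by (intro exI[of _ P.prog] exI[of _ T]) blast
qed

end
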